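(* Let $N\ge 1$ and let $\gamma_1,\dots,\gamma_N,\gamma^c$ be nonzero real numbers. Let $T>0$ and let $(x_{0,1},\dots,x_{0,N},y_0)$ and $(x_{f,1},\dots,x_{f,N},y_f)$ be two $(N+1)$-tuples of distinct points in $\mathbb{R}^2$ (the points within each tuple are pairwise distinct). Then there exists $y\in C^\infty([0,T];\mathbb{R}^2)$ satisfying $y(0)=y_0$ and $y(T)=y_f$, and such that the corresponding solution $(x_1,\dots,x_N)$ of the system $$\frac{dx_i}{dt}(t)=\sum_{j=1,\,j\neq i}^{N}\frac{\gamma_j}{2\pi}\frac{(x_i(t)-x_j(t))^\perp}{|x_i(t)-x_j(t)|^2}+\frac{\gamma^c}{2\pi}\frac{(x_i(t)-y(t))^\perp}{|x_i(t)-y(t)|^2},\qquad x_i(0)=x_{0,i},\qquad i=1,\dots,N,$$ is defined on the whole of $[0,T]$ and satisfies $(x_1(T),\dots,x_N(T))=(x_{f,1},\dots,x_{f,N})$.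
   Context: For $x=(x^1,x^2)\in\mathbb{R}^2$, $x^\perp=(-x^2,x^1)$, and $|\cdot|$ is the Euclidean norm. A solution of the system is said to be defined on $[0,T]$ if it exists on $[0,T]$ with no collisions: for all $t\in[0,T]$, $x_i(t)\neq x_j(t)$ for $i\neq j$, and $x_i(t)\neq y(t)$ for all $i$. *)

theory Defs
  imports "HOL-Analysis.Analysis"
begin

definition perp :: "real ^ 2 \<Rightarrow> real ^ 2" where
  "perp v = vector [- (v $ 2), v $ 1]"

(* D k is the k-th derivative of f on S; derivatives are taken within S, hence they are
   one-sided at the end points when S is a compact interval. *)
definition smooth_on :: "real set \<Rightarrow> (real \<Rightarrow> 'a::real_normed_vector) \<Rightarrow> bool" where
  "smooth_on S f \<longleftrightarrow>
    (\<exists>D :: nat \<Rightarrow> real \<Rightarrow> 'a. (\<forall>t\<in>S. D 0 t = f t) \<and>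
      (\<forall>k. \<forall>t\<in>S. (D k has_vector_derivative D (Suc k) t) (at t within S)))"

definition distinct_points :: "nat \<Rightarrow> (nat \<Rightarrow> 'a) \<Rightarrow> 'a \<Rightarrow> bool" where
  "distinct_points N p q \<longleftrightarrow>
    (\<forall>i\<in>{1..N}. \<forall>j\<in>{1..N}. i \<noteq> j \<longrightarrow> p i \<noteq> p j) \<and> (\<forall>i\<in>{1..N}. p i \<noteq> q)"

definition vortex_velocity ::
  "real \<Rightarrow> real ^ 2 \<Rightarrow> real ^ 2 \<Rightarrow> real ^ 2" where
  "vortex_velocity g a b = (g / (2 * pi)) *\<^sub>R ((1 / (norm (a - b))\<^sup>2) *\<^sub>R perp (a - b))"

(* x i t is the position at time t of the i-th vortex, 1 <= i <= N; y is the trajectory of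
   the controlled vortex. Absence of collisions on [0,T] is part of being a solution. *)
definition is_vortex_solution ::
  "nat \<Rightarrow> (nat \<Rightarrow> real) \<Rightarrow> real \<Rightarrow> (nat \<Rightarrow> real ^ 2) \<Rightarrow> real \<Rightarrow> (real \<Rightarrow> real ^ 2) \<Rightarrow>
    (nat \<Rightarrow> real \<Rightarrow> real ^ 2) \<Rightarrow> bool" where
  "is_vortex_solution N \<gamma> \<gamma>c x0 T y x \<longleftrightarrow>
    (\<forall>i\<in>{1..N}. x i 0 = x0 i) \<and>
    (\<forall>t\<in>{0..T}. distinct_points N (\<lambda>i. x i t) (y t)) \<and>
    (\<forall>i\<in>{1..N}. \<forall>t\<in>{0..T}.
      (x i has_vector_derivative
        ((\<Sum>j\<in>{1..N} - {i}. vortex_velocity (\<gamma> j) (x i t) (x j t))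
          + vortex_velocity \<gamma>c (x i t) (y t)))
      (at t within {0..T}))"

end

theory Submission
  imports Defs "HOL-Complex_Analysis.Complex_Analysis" "HOL-Computational_Algebra.Polynomial"
    "HOL-Probability.Discrete_Topology"
begin

text \<open>
  In complex notation a vortex at \<open>b\<close> moves a vortex at \<open>a\<close> with velocity proportional to
  \<open>\<i> / cnj (a - b)\<close>, so that everything is governed by the holomorphic function \<open>1 / (a - b)\<close>.

  Choose a collision-free motion \<open>\<xi>\<close> of the \<open>N\<close> vortices from the initial to the final configuration
  (\<open>collision_free_motion\<close>). It would solve the system if the controlled vortex contributed, at each
  time, a prescribed value \<open>G\<^sub>i t\<close> of \<open>1 / (\<xi>\<^sub>i - y)\<close> for every \<open>i\<close>. One point \<open>y\<close> cannot
  do this, but a fast moving \<open>y\<close> can do it on average. If \<open>u\<close> runs over the unit circle and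
  \<open>y = c\<^sub>i + r (u + b u\<^sup>2)\<close>, then, by the mean value property of holomorphic functions, the average of
  \<open>1 / (c\<^sub>i - y)\<close> is \<open>b / r\<close>, while for the other vortices \<open>1 / (c\<^sub>j - y)\<close> has the average
  \<open>1 / (c\<^sub>j - c\<^sub>i)\<close>, which does not depend on \<open>b\<close> (\<open>loop_average_inside\<close>, \<open>loop_average_outside\<close>).
  Hence a round in which \<open>y\<close> visits all vortices, one loop around each, realises any prescribed
  averages by an affine choice of the coefficients \<open>b\<^sub>i\<close> (\<open>round_of_loops\<close>). Between two loops \<open>y\<close>
  returns to a far away hub, along paths that keep a distance from the vortices bounded below
  uniformly in time (\<open>uniform_transit\<close>). Concatenating many short rounds gives controls that
  stay at a distance at least \<open>\<rho>\<close> from \<open>\<xi>\<close> and whose accumulated error is as small as desired, with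
  \<open>\<rho>\<close> independent of the error (\<open>hub_steering\<close>, \<open>steering\<close>). As the vector field is Lipschitz
  at distance \<open>\<rho>\<close> from the collisions, Gronwall's inequality shows that the vortices follow \<open>\<xi>\<close> closely
  (\<open>ode_difference\<close>).

  To reach the target exactly, the prescribed averages get an additional term \<open>\<sigma>(t) w\<^sub>i\<close> with parameters
  \<open>w\<close>, which moves the final configuration linearly in \<open>w\<close>, up to an error that is small compared with
  this displacement. The controls depend on \<open>w\<close> in an affine way, the final configuration
  depends on it continuously, and the Poincare-Miranda theorem, which follows from Kuhn's combinatorial lemma,
  provides a parameter for which the final configuration is exactly the required one
  (\<open>complex_control\<close>). Since a control is an affine combination of finitely many
  continuous curves, replacing these by Bernstein polynomials beforehand makes it smooth, without
  changing its end points (\<open>control_family_polynomial\<close>).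
\<close>

section \<open>Differential equations with a Lipschitz right-hand side\<close>

lemma gronwall:
  fixes u :: "real \<Rightarrow> real"
  assumes cont: "continuous_on {0..T} u" and "0 \<le> L"
    and bound: "\<And>t. t \<in> {0..T} \<Longrightarrow> u t \<le> a + L * integral {0..t} u"
    and t: "t \<in> {0..T}"
  shows "u t \<le> a * exp (L * t)"
proof -
  define v where "v = (\<lambda>t. (a + L * integral {0..t} u) * exp (- L * t))"
  have d: "(v has_real_derivative (L * (u s - (a + L * integral {0..s} u)) * exp (- L * s)))
      (at s within {0..T})" if s: "s \<in> {0..T}" for s
  proof -
    have "((\<lambda>t. integral {0..t} u) has_real_derivative u s) (at s within {0..T})"
      using integral_has_real_derivative[OF cont s] .
    then show ?thesis
      unfolding v_def by (auto intro!: derivative_eq_intros simp: algebra_simps)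
  qed
  have "v t \<le> v 0"
  proof (rule DERIV_nonpos_imp_decreasing_open[of 0 t v])
    show "0 \<le> t" using t by simp
    fix x assume x: "0 < x" "x < t"
    have "(v has_real_derivative (L * (u x - (a + L * integral {0..x} u)) * exp (- L * x))) (at x)"
      using d[of x] x t by (simp add: at_within_Icc_at)
    moreover have "L * (u x - (a + L * integral {0..x} u)) * exp (- L * x) \<le> 0"
      using bound[of x] x t \<open>0 \<le> L\<close> by (simp add: mult_nonneg_nonpos mult_nonpos_nonneg)
    ultimately show "\<exists>y. DERIV v x :> y \<and> y \<le> 0" by blast
  next
    have "continuous_on {0..T} v"
      using d by (intro DERIV_continuous_on)
    then show "continuous_on {0..t} v"
      by (rule continuous_on_subset) (use t in auto)
  qed
  then have "(a + L * integral {0..t} u) * exp (- L * t) \<le> a"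
    by (simp add: v_def)
  then have "(a + L * integral {0..t} u) \<le> a * exp (L * t)"
    by (simp add: exp_minus field_simps)
  with bound[OF t] show ?thesis by linarith
qed

text \<open>
  A solution \<open>x\<close> of \<open>x' = f t x\<close> stays close to every curve \<open>\<xi>\<close> that satisfies the integrated equation
  with the same initial value up to \<open>\<epsilon>\<close>. This one estimate serves three purposes: the comparison
  with the reference motion, the continuous dependence on parameters, and (with \<open>\<epsilon> = 0\<close>) uniqueness.
\<close>
lemma ode_difference:
  fixes x \<xi> :: "real \<Rightarrow> 'a::banach"
  assumes x: "\<And>t. t \<in> {0..T} \<Longrightarrow> (x has_vector_derivative f t (x t)) (at t within {0..T})"
    and cf: "continuous_on {0..T} (\<lambda>t. f t (x t))" "continuous_on {0..T} (\<lambda>t. f t (\<xi> t))"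
    and \<xi>: "continuous_on {0..T} \<xi>"
    and lip: "\<And>t. t \<in> {0..T} \<Longrightarrow> norm (f t (x t) - f t (\<xi> t)) \<le> L * norm (x t - \<xi> t)"
    and err: "\<And>t. t \<in> {0..T} \<Longrightarrow> norm (\<xi> t - x 0 - integral {0..t} (\<lambda>s. f s (\<xi> s))) \<le> \<epsilon>"
    and "0 \<le> L" and t: "t \<in> {0..T}"
  shows "norm (x t - \<xi> t) \<le> \<epsilon> * exp (L * t)"
proof -
  have cx: "continuous_on {0..T} x"
    using x by (meson continuous_on_eq_continuous_within has_vector_derivative_continuous)
  have "continuous_on {0..T} (\<lambda>t. norm (x t - \<xi> t))"
    by (intro continuous_intros cx \<xi>)
  then show ?thesis
  proof (rule gronwall[OF _ \<open>0 \<le> L\<close> _ t])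
    fix t assume t: "t \<in> {0..T}"
    then have sub: "{0..t} \<subseteq> {0..T}" by auto
    have I: "((\<lambda>s. f s (x s)) has_integral (x t - x 0)) {0..t}"
      using t by (intro fundamental_theorem_of_calculus has_vector_derivative_within_subset[OF x sub]) auto
    have int1: "(\<lambda>s. f s (x s) - f s (\<xi> s)) integrable_on {0..t}"
      by (intro integrable_continuous_real continuous_on_subset[OF _ sub] continuous_intros cf)
    have int2: "(\<lambda>s. f s (\<xi> s)) integrable_on {0..t}"
      by (intro integrable_continuous_real continuous_on_subset[OF cf(2) sub])
    have "x t - \<xi> t = integral {0..t} (\<lambda>s. f s (x s) - f s (\<xi> s))
        - (\<xi> t - x 0 - integral {0..t} (\<lambda>s. f s (\<xi> s)))"
      using integral_unique[OF I] has_integral_integrable[OF I] int2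
      by (simp add: integral_diff)
    also have "norm \<dots> \<le> norm (integral {0..t} (\<lambda>s. f s (x s) - f s (\<xi> s))) + \<epsilon>"
      using err[OF t] norm_triangle_ineq4 by (smt (verit))
    also have "norm (integral {0..t} (\<lambda>s. f s (x s) - f s (\<xi> s)))
        \<le> integral {0..t} (\<lambda>s. L * norm (x s - \<xi> s))"
      using lip sub by (intro integral_norm_bound_integral int1 integrable_continuous_real
        continuous_on_subset[OF _ sub] continuous_intros cx \<xi>) auto
    finally show "norm (x t - \<xi> t) \<le> \<epsilon> + L * integral {0..t} (\<lambda>s. norm (x s - \<xi> s))"
      by simp
  qed
qed

text \<open>Global existence for a right-hand side that is Lipschitz on the whole space.\<close>
lemma picard:
  fixes f :: "real \<Rightarrow> 'a::banach \<Rightarrow> 'a"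
  assumes "0 \<le> T" "0 < L"
    and cont: "continuous_on ({0..T} \<times> UNIV) (\<lambda>p. f (fst p) (snd p))"
    and lip: "\<And>t x y. t \<in> {0..T} \<Longrightarrow> norm (f t x - f t y) \<le> L * norm (x - y)"
  obtains x where "x 0 = a"
    "\<And>t. t \<in> {0..T} \<Longrightarrow> (x has_vector_derivative f t (x t)) (at t within {0..T})"
proof -
  \<comment> \<open>The unknown is \<open>u t = exp (- 2 L t) x t\<close>; with this weight the integral operator contracts by 1/2.\<close>
  define W :: "(real \<Rightarrow>\<^sub>C 'a) \<Rightarrow> real \<Rightarrow> 'a"
    where "W = (\<lambda>u t. exp (2 * L * t) *\<^sub>R apply_bcontfun u t)"
  define \<Psi> where "\<Psi> = (\<lambda>u t. exp (- 2 * L * t) *\<^sub>R (a + integral {0..t} (\<lambda>s. f s (W u s))))"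
  have cW: "continuous_on S (W u)" for S u
    unfolding W_def by (intro continuous_intros continuous_on_apply_bcontfun)
  have cf: "continuous_on {0..T} (\<lambda>t. f t (g t))" if "continuous_on {0..T} g" for g
  proof -
    have "continuous_on {0..T} (\<lambda>t. (t, g t))" by (intro continuous_intros that)
    from continuous_on_compose2[OF cont this] show ?thesis by auto
  qed
  have c\<Psi>: "continuous_on {0..T} (\<Psi> u)" for u
    unfolding \<Psi>_def
    by (intro continuous_intros indefinite_integral_continuous_1 integrable_continuous_real cf cW)
  have "\<exists>g :: real \<Rightarrow>\<^sub>C 'a. (\<forall>t\<in>{0..T}. g t = \<Psi> u t) \<and> (\<forall>t. g t = \<Psi> u (clamp 0 T t))" for u
    using continuous_on_cbox_bcontfunE[of 0 T "\<Psi> u"] c\<Psi> by (metis box_real(2))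
  then obtain \<Phi> :: "(real \<Rightarrow>\<^sub>C 'a) \<Rightarrow> (real \<Rightarrow>\<^sub>C 'a)"
    where \<Phi>: "\<And>u t. t \<in> {0..T} \<Longrightarrow> \<Phi> u t = \<Psi> u t" "\<And>u t. \<Phi> u t = \<Psi> u (clamp 0 T t)"
    by metis
  have "dist (\<Phi> u) (\<Phi> v) \<le> 1/2 * dist u v" for u v
  proof (rule dist_bound)
    fix r :: real
    define t where "t = clamp 0 T r"
    have t: "t \<in> {0..T}"
      using clamp_in_interval[of 0 T r] \<open>0 \<le> T\<close> by (simp add: t_def)
    have sub: "{0..t} \<subseteq> {0..T}" using t by auto
    have int: "(\<lambda>s. f s (W u s)) integrable_on {0..t}" for u
      by (intro integrable_continuous_real continuous_on_subset[OF _ sub] cf cW)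
    have "norm (integral {0..t} (\<lambda>s. f s (W u s)) - integral {0..t} (\<lambda>s. f s (W v s)))
       = norm (integral {0..t} (\<lambda>s. f s (W u s) - f s (W v s)))"
      by (simp add: integral_diff int)
    also have "\<dots> \<le> integral {0..t} (\<lambda>s. L * exp (2 * L * s) * dist u v)"
    proof (intro integral_norm_bound_integral integrable_diff int)
      show "(\<lambda>s. L * exp (2 * L * s) * dist u v) integrable_on {0..t}"
        by (intro integrable_continuous_real continuous_intros)
      fix s assume "s \<in> {0..t}"
      then have "s \<in> {0..T}" using sub by auto
      from lip[OF this] have "norm (f s (W u s) - f s (W v s)) \<le> L * norm (W u s - W v s)" .
      also have "norm (W u s - W v s) = exp (2 * L * s) * dist (u s) (v s)"
        by (simp add: W_def dist_norm flip: scaleR_diff_right)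
      also have "\<dots> \<le> exp (2 * L * s) * dist u v"
        by (intro mult_left_mono dist_bounded) simp
      finally show "norm (f s (W u s) - f s (W v s)) \<le> L * exp (2 * L * s) * dist u v"
        using \<open>0 < L\<close> by (simp add: mult.assoc)
    qed
    also have "((\<lambda>s. L * exp (2 * L * s) * dist u v) has_integral
        (exp (2 * L * t) / 2 * dist u v - exp (2 * L * 0) / 2 * dist u v)) {0..t}"
      using t by (intro fundamental_theorem_of_calculus)
        (auto intro!: derivative_eq_intros simp: field_simps simp flip: has_real_derivative_iff_has_vector_derivative)
    then have "integral {0..t} (\<lambda>s. L * exp (2 * L * s) * dist u v) \<le> exp (2 * L * t) / 2 * dist u v"
      by (subst integral_unique, assumption) simp
    finally have *: "norm (integral {0..t} (\<lambda>s. f s (W u s)) - integral {0..t} (\<lambda>s. f s (W v s)))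
        \<le> exp (2 * L * t) / 2 * dist u v" .
    have "dist (\<Phi> u r) (\<Phi> v r) = exp (- 2 * L * t) *
        norm (integral {0..t} (\<lambda>s. f s (W u s)) - integral {0..t} (\<lambda>s. f s (W v s)))"
      by (simp add: \<Phi>(2)[of _ r] t_def[symmetric] \<Psi>_def dist_norm flip: scaleR_diff_right)
    also have "\<dots> \<le> exp (- 2 * L * t) * (exp (2 * L * t) / 2 * dist u v)"
      by (intro mult_left_mono *) simp
    also have "\<dots> = 1/2 * dist u v"
      by (simp add: exp_minus)
    finally show "dist (\<Phi> u r) (\<Phi> v r) \<le> 1/2 * dist u v" .
  qed
  then have "\<exists>!u. \<Phi> u = u"
    by (intro banach_fix_type[of "1/2"]) auto
  then obtain u where u: "\<Phi> u = u" by blast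
  have W: "W u t = a + integral {0..t} (\<lambda>s. f s (W u s))" if "t \<in> {0..T}" for t
  proof -
    have "apply_bcontfun u t = \<Psi> u t" using \<Phi>(1)[OF that, of u] u by simp
    then have "W u t = exp (2 * L * t) *\<^sub>R \<Psi> u t" by (simp add: W_def)
    then show ?thesis by (simp add: \<Psi>_def exp_minus)
  qed
  show ?thesis
  proof
    show "W u 0 = a" using W[of 0] \<open>0 \<le> T\<close> by simp
    fix t assume t: "t \<in> {0..T}"
    have "((\<lambda>t. integral {0..t} (\<lambda>s. f s (W u s))) has_vector_derivative f t (W u t)) (at t within {0..T})"
      by (intro integral_has_vector_derivative cf cW t)
    then have "((\<lambda>t. a + integral {0..t} (\<lambda>s. f s (W u s))) has_vector_derivative f t (W u t)) (at t within {0..T})"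
      by (auto intro!: derivative_eq_intros)
    then show "(W u has_vector_derivative f t (W u t)) (at t within {0..T})"
      using t W by (rule has_vector_derivative_transform[rotated 2])
  qed
qed

section \<open>The Poincare-Miranda theorem\<close>

lemma coordinatewise_convergent_subsequence:
  fixes x :: "nat \<Rightarrow> nat \<Rightarrow> real"
  assumes "\<And>k j. j < n \<Longrightarrow> x k j \<in> {a..b}"
  shows "\<exists>r l. strict_mono (r :: nat \<Rightarrow> nat) \<and> (\<forall>j<n. l j \<in> {a..b} \<and> (\<lambda>k. x (r k) j) \<longlonglongrightarrow> l j)"
  using assms
proof (induction n)
  case 0
  then show ?case by (auto intro: strict_mono_id)
next
  case (Suc n)
  then obtain r l where r: "strict_mono (r :: nat \<Rightarrow> nat)"
    "\<And>j. j < n \<Longrightarrow> l j \<in> {a..b}" "\<And>j. j < n \<Longrightarrow> (\<lambda>k. x (r k) j) \<longlonglongrightarrow> l j"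
    by (metis less_SucI)
  have "\<And>k. x (r k) n \<in> {a..b}" using Suc.prems by blast
  then obtain m q where q: "m \<in> {a..b}" "strict_mono (q :: nat \<Rightarrow> nat)" "((\<lambda>k. x (r k) n) \<circ> q) \<longlonglongrightarrow> m"
    using compact_Icc[of a b] unfolding compact_def by (metis (no_types, lifting))
  show ?case
  proof (intro exI conjI allI impI)
    show "strict_mono (r \<circ> q)" using r(1) q(2) by (rule strict_mono_o)
    fix j assume "j < Suc n"
    then consider "j < n" | "j = n" by linarith
    then show "(l(n := m)) j \<in> {a..b}" and "(\<lambda>k. x ((r \<circ> q) k) j) \<longlonglongrightarrow> (l(n := m)) j"
      using r(2) q LIMSEQ_subseq_LIMSEQ[OF r(3) q(2)] by (cases; force simp: o_def)+
  qed
qed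

text \<open>
  Only the coordinates below \<open>n\<close> of the argument matter, so that the dimension is a number and not a type.
\<close>
lemma poincare_miranda:
  fixes F :: "(nat \<Rightarrow> real) \<Rightarrow> nat \<Rightarrow> real"
  assumes cont: "\<And>e. e > 0 \<Longrightarrow> \<exists>d>0. \<forall>v v'.
      (\<forall>j<n. v j \<in> {-1..1} \<and> v' j \<in> {-1..1} \<and> \<bar>v j - v' j\<bar> < d) \<longrightarrow> (\<forall>i<n. \<bar>F v i - F v' i\<bar> < e)"
    and low: "\<And>v i. i < n \<Longrightarrow> \<forall>j<n. v j \<in> {-1..1} \<Longrightarrow> v i = -1 \<Longrightarrow> F v i \<le> 0"
    and high: "\<And>v i. i < n \<Longrightarrow> \<forall>j<n. v j \<in> {-1..1} \<Longrightarrow> v i = 1 \<Longrightarrow> F v i \<ge> 0"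
  obtains v where "\<forall>j<n. v j \<in> {-1..1}" "\<forall>i<n. F v i = 0"
proof -
  have approx: "\<exists>v. (\<forall>j<n. v j \<in> {-1..1}) \<and> (\<forall>i<n. \<bar>F v i\<bar> \<le> e)" if epos: "e > 0" for e :: real
  proof -
    obtain d where d: "d > 0" "\<And>v v' i. (\<And>j. j < n \<Longrightarrow> v j \<in> {-1..1} \<and> v' j \<in> {-1..1} \<and> \<bar>v j - v' j\<bar> < d)
        \<Longrightarrow> i < n \<Longrightarrow> \<bar>F v i - F v' i\<bar> < e"
      using cont[OF epos] by metis
    obtain p :: nat where p: "2 / d < p" using reals_Archimedean2 by blast
    then have "p > 0" using d(1) by (metis divide_pos_pos gr0I less_asym of_nat_0 zero_less_numeral)
    have dp: "2 / p < d" using p d(1) \<open>p > 0\<close> by (simp add: field_simps)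
    define V where "V = (\<lambda>x :: nat \<Rightarrow> nat. \<lambda>j. 2 * real (x j) / p - 1)"
    have V: "V x j \<in> {-1..1}" if "x j \<le> p" for x j
      using that \<open>p > 0\<close> by (simp add: V_def field_simps)
    \<comment> \<open>On a face the label is prescribed; there the hypotheses fix the weak sign of \<open>F\<close>.\<close>
    define lab where "lab = (\<lambda>x i. if x i = 0 then 0 else if x i = p then 1 else if F (V x) i > 0 then 1 else (0::nat))"
    obtain q where q: "\<forall>i<n. q i < p"
      "\<forall>i<n. \<exists>r s. (\<forall>j<n. q j \<le> r j \<and> r j \<le> q j + 1) \<and> (\<forall>j<n. q j \<le> s j \<and> s j \<le> q j + 1) \<and> lab r i \<noteq> lab s i"
      by (rule kuhn_lemma[OF \<open>p > 0\<close>, of n lab]) (use \<open>p > 0\<close> in \<open>auto simp: lab_def\<close>)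
    have lab0: "F (V x) i \<le> 0" if "lab x i = 0" "\<And>j. j < n \<Longrightarrow> x j \<le> p" "i < n" for x i
    proof (cases "x i = 0")
      case True
      then have "V x i = -1" by (simp add: V_def)
      then show ?thesis using low that V by blast
    qed (use that \<open>p > 0\<close> in \<open>auto simp: lab_def split: if_splits\<close>)
    have lab1: "F (V x) i \<ge> 0" if "lab x i \<noteq> 0" "\<And>j. j < n \<Longrightarrow> x j \<le> p" "i < n" for x i
    proof (cases "x i = p")
      case True
      then have "V x i = 1" using \<open>p > 0\<close> by (simp add: V_def)
      then show ?thesis using high that V by blast
    qed (use that \<open>p > 0\<close> in \<open>auto simp: lab_def split: if_splits\<close>)
    have "\<bar>F (V q) i\<bar> \<le> e" if i: "i < n" for i
    proof -
      obtain r s where rs: "\<And>j. j < n \<Longrightarrow> q j \<le> r j \<and> r j \<le> q j + 1"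
        "\<And>j. j < n \<Longrightarrow> q j \<le> s j \<and> s j \<le> q j + 1" "lab r i \<noteq> lab s i"
        using q(2) i by blast
      have near: "\<bar>F (V q) i - F (V x) i\<bar> < e" if "\<And>j. j < n \<Longrightarrow> q j \<le> x j \<and> x j \<le> q j + 1" for x
      proof (rule d(2)[OF _ i])
        fix j assume j: "j < n"
        have "q j < p" using q(1) j by blast
        then have "x j \<le> p" "q j \<le> p" using that[OF j] by linarith+
        moreover have "\<bar>V q j - V x j\<bar> \<le> 2 / p"
        proof -
          have "V q j - V x j = 2 * (real (q j) - real (x j)) / p" by (simp add: V_def diff_divide_distrib algebra_simps)
          moreover have "\<bar>real (q j) - real (x j)\<bar> \<le> 1" using that[OF j] by linarith
          ultimately show ?thesis by (simp add: abs_mult divide_right_mono)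
        qed
        ultimately show "V q j \<in> {-1..1} \<and> V x j \<in> {-1..1} \<and> \<bar>V q j - V x j\<bar> < d"
          using V dp by force
      qed
      have le: "r j \<le> p" "s j \<le> p" if "j < n" for j
        using q(1) rs(1,2)[OF that] that by (metis Suc_eq_plus1 Suc_leI order_trans)+
      have "(F (V r) i \<le> 0 \<and> F (V s) i \<ge> 0) \<or> (F (V s) i \<le> 0 \<and> F (V r) i \<ge> 0)"
        using lab0[of r] lab0[of s] lab1[of r] lab1[of s] le i rs(3) by (cases "lab r i = 0") (auto simp: lab_def split: if_splits)
      with near[of r] near[of s] rs(1,2) show ?thesis by fastforce
    qed
    moreover have "\<forall>j<n. V q j \<in> {-1..1}" using V q(1) less_imp_le by blast
    ultimately show ?thesis by blast
  qed
  have "\<forall>k. \<exists>v. (\<forall>j<n. v j \<in> {-1..1}) \<and> (\<forall>i<n. \<bar>F v i\<bar> \<le> inverse (real (Suc k)))"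
    using approx by simp
  then obtain v where v: "\<And>k j. j < n \<Longrightarrow> v k j \<in> {-1..1}"
    "\<And>k i. i < n \<Longrightarrow> \<bar>F (v k) i\<bar> \<le> inverse (real (Suc k))" by metis
  obtain r l where r: "strict_mono (r :: nat \<Rightarrow> nat)" "\<And>j. j < n \<Longrightarrow> l j \<in> {-1..1}"
    "\<And>j. j < n \<Longrightarrow> (\<lambda>k. v (r k) j) \<longlonglongrightarrow> l j"
    using coordinatewise_convergent_subsequence[of n v "-1" 1] v(1) by blast
  have "F l i = 0" if i: "i < n" for i
  proof (rule ccontr)
    assume "F l i \<noteq> 0"
    then have e: "\<bar>F l i\<bar> / 2 > 0" by simp
    then obtain d where d: "d > 0" "\<And>v v' k. (\<And>j. j < n \<Longrightarrow> v j \<in> {-1..1} \<and> v' j \<in> {-1..1} \<and> \<bar>v j - v' j\<bar> < d)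
        \<Longrightarrow> k < n \<Longrightarrow> \<bar>F v k - F v' k\<bar> < \<bar>F l i\<bar> / 2"
      using cont[OF e] by metis
    have "\<forall>\<^sub>F k in sequentially. \<forall>j\<in>{..<n}. \<bar>l j - v (r k) j\<bar> < d"
    proof (intro eventually_ball_finite ballI)
      fix j assume "j \<in> {..<n}"
      then have "\<forall>\<^sub>F k in sequentially. dist (v (r k) j) (l j) < d"
        using r(3)[of j] d(1) by (auto dest: tendstoD)
      then show "\<forall>\<^sub>F k in sequentially. \<bar>l j - v (r k) j\<bar> < d"
        by eventually_elim (simp add: dist_real_def abs_minus_commute)
    qed simp
    moreover have "\<forall>\<^sub>F k in sequentially. inverse (real (Suc k)) < \<bar>F l i\<bar> / 2"
      using LIMSEQ_inverse_real_of_nat e by (rule order_tendstoD)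
    ultimately have "\<forall>\<^sub>F k in sequentially. (\<forall>j\<in>{..<n}. \<bar>l j - v (r k) j\<bar> < d) \<and> inverse (real (Suc k)) < \<bar>F l i\<bar> / 2"
      by (rule eventually_conj)
    then have "\<exists>k. (\<forall>j\<in>{..<n}. \<bar>l j - v (r k) j\<bar> < d) \<and> inverse (real (Suc k)) < \<bar>F l i\<bar> / 2"
      by (rule eventually_happens'[OF sequentially_bot])
    then obtain k where k: "\<And>j. j < n \<Longrightarrow> \<bar>l j - v (r k) j\<bar> < d" "inverse (real (Suc k)) < \<bar>F l i\<bar> / 2"
      by blast
    have "\<bar>F l i - F (v (r k)) i\<bar> < \<bar>F l i\<bar> / 2"
      using d(2)[of l "v (r k)" i] k(1) r(2) v(1) i by blast
    moreover have "inverse (real (Suc (r k))) \<le> inverse (real (Suc k))"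
      using seq_suble[OF r(1), of k] by (simp add: field_simps)
    ultimately show False using v(2)[OF i, of "r k"] k(2) by linarith
  qed
  with r(2) that show ?thesis by blast
qed

text \<open>
  Complex form: a continuous map that stays within distance 1 of the identity on a product of squares of half
  width 1 has a zero there.
\<close>
lemma poincare_miranda_complex:
  fixes F :: "(nat \<Rightarrow> complex) \<Rightarrow> nat \<Rightarrow> complex" and N :: nat
  assumes Q_def: "Q = {z. \<forall>i\<in>{1..N}. Re (z i) \<in> {-1..1} \<and> Im (z i) \<in> {-1..1}}"
    and cont: "\<And>e. e > 0 \<Longrightarrow> \<exists>d>0. \<forall>z z'. z \<in> Q \<longrightarrow> z' \<in> Q \<longrightarrow> (\<forall>i\<in>{1..N}. cmod (z i - z' i) < d) \<longrightarrow>
      (\<forall>i\<in>{1..N}. cmod (F z i - F z' i) < e)"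
    and close: "\<And>z i. z \<in> Q \<Longrightarrow> i \<in> {1..N} \<Longrightarrow> cmod (F z i - z i) \<le> 1"
  obtains z where "z \<in> Q" "\<forall>i\<in>{1..N}. F z i = 0"
proof -
  \<comment> \<open>The components \<open>1, \<dots>, N\<close> correspond to the pairs of real coordinates \<open>(0, 1), (2, 3), \<dots>\<close>.\<close>
  define Z where "Z = (\<lambda>v :: nat \<Rightarrow> real. \<lambda>i. Complex (v (2 * (i - 1))) (v (2 * (i - 1) + 1)))"
  define H where "H = (\<lambda>v l. if even l then Re (F (Z v) (l div 2 + 1)) else Im (F (Z v) (l div 2 + 1)))"
  have ZQ: "Z v \<in> Q" if "\<forall>j<2 * N. v j \<in> {-1..1}" for v
  proof -
    have "2 * (i - 1) < 2 * N" "2 * (i - 1) + 1 < 2 * N" if "i \<in> {1..N}" for i using that by auto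
    then show ?thesis using that by (simp add: Z_def Q_def)
  qed
  have idx: "l div 2 + 1 \<in> {1..N}" if "l < 2 * N" for l using that by auto
  have comp: "v l = (if even l then Re (Z v (l div 2 + 1)) else Im (Z v (l div 2 + 1)))" for v l
    by (auto simp: Z_def elim!: oddE)
  have near: "\<bar>H v l - v l\<bar> \<le> 1" if "\<forall>j<2 * N. v j \<in> {-1..1}" "l < 2 * N" for v l
    using close[OF ZQ[OF that(1)] idx[OF that(2)]] comp[of v l]
      abs_Re_le_cmod[of "F (Z v) (l div 2 + 1) - Z v (l div 2 + 1)"]
      abs_Im_le_cmod[of "F (Z v) (l div 2 + 1) - Z v (l div 2 + 1)"]
    by (cases "even l") (auto simp: H_def)
  obtain v where v: "\<forall>j<2 * N. v j \<in> {-1..1}" "\<forall>i<2 * N. H v i = 0"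
  proof (rule poincare_miranda[of "2 * N" H])
    fix e :: real assume "e > 0"
    then obtain d where d: "d > 0" "\<And>z z' i. z \<in> Q \<Longrightarrow> z' \<in> Q \<Longrightarrow> (\<forall>i\<in>{1..N}. cmod (z i - z' i) < d) \<Longrightarrow>
      i \<in> {1..N} \<Longrightarrow> cmod (F z i - F z' i) < e"
      using cont by metis
    have "\<bar>H v i - H v' i\<bar> < e"
      if vv: "\<forall>j<2 * N. v j \<in> {-1..1} \<and> v' j \<in> {-1..1} \<and> \<bar>v j - v' j\<bar> < d / 2" and i: "i < 2 * N" for v v' i
    proof -
      have "cmod (Z v k - Z v' k) < d" if "k \<in> {1..N}" for k
      proof -
        have "cmod (Z v k - Z v' k) \<le> \<bar>v (2 * (k - 1)) - v' (2 * (k - 1))\<bar> + \<bar>v (2 * (k - 1) + 1) - v' (2 * (k - 1) + 1)\<bar>"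
          using cmod_le[of "Z v k - Z v' k"] by (simp add: Z_def)
        also have "\<dots> < d / 2 + d / 2"
          using that by (intro add_strict_mono) (use vv in auto)
        finally show ?thesis by simp
      qed
      then have "cmod (F (Z v) (i div 2 + 1) - F (Z v') (i div 2 + 1)) < e"
        using vv ZQ idx[OF i] by (intro d(2)) auto
      then show ?thesis
        using abs_Re_le_cmod[of "F (Z v) (i div 2 + 1) - F (Z v') (i div 2 + 1)"]
          abs_Im_le_cmod[of "F (Z v) (i div 2 + 1) - F (Z v') (i div 2 + 1)"]
        by (cases "even i") (auto simp: H_def)
    qed
    then show "\<exists>d>0. \<forall>v v'. (\<forall>j<2 * N. v j \<in> {-1..1} \<and> v' j \<in> {-1..1} \<and> \<bar>v j - v' j\<bar> < d) \<longrightarrow>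
        (\<forall>i<2 * N. \<bar>H v i - H v' i\<bar> < e)"
      using d(1) by (intro exI[of _ "d / 2"] conjI allI impI) simp_all
  next
    show "H v i \<le> 0" if "i < 2 * N" "\<forall>j<2 * N. v j \<in> {-1..1}" "v i = -1" for v i
      using near[OF that(2,1)] that(3) by linarith
    show "H v i \<ge> 0" if "i < 2 * N" "\<forall>j<2 * N. v j \<in> {-1..1}" "v i = 1" for v i
      using near[OF that(2,1)] that(3) by linarith
  qed
  show ?thesis
  proof (rule that[of "Z v"])
    show "Z v \<in> Q" by (rule ZQ[OF v(1)])
    show "\<forall>i\<in>{1..N}. F (Z v) i = 0"
    proof
      fix i assume i: "i \<in> {1..N}"
      then have "2 * (i - 1) < 2 * N" "2 * (i - 1) + 1 < 2 * N" by auto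
      then have "H v (2 * (i - 1)) = 0" "H v (2 * (i - 1) + 1) = 0" using v(2) by blast+
      then show "F (Z v) i = 0" using i by (simp add: H_def complex_eq_iff)
    qed
  qed
qed

section \<open>Mean values of a loop around one vortex\<close>

lemma finite_uniform_pos:
  fixes Q :: "'a \<Rightarrow> real \<Rightarrow> bool"
  assumes "finite A" "\<And>x. x \<in> A \<Longrightarrow> \<exists>e>0. Q x e"
    and mono: "\<And>x e e'. Q x e \<Longrightarrow> 0 < e' \<Longrightarrow> e' \<le> e \<Longrightarrow> Q x e'"
  shows "\<exists>e>0. \<forall>x\<in>A. Q x e"
  using assms(1,2)
proof (induction A)
  case empty
  then show ?case by (auto intro: exI[of _ 1])
next
  case (insert x A)
  then obtain e e' where "e > 0" "\<forall>x\<in>A. Q x e" "e' > 0" "Q x e'" by blast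
  then show ?case
    using mono[of _ e "min e e'"] mono[of _ e' "min e e'"] by (intro exI[of _ "min e e'"]) auto
qed

lemma has_integral_rescale:
  fixes f :: "real \<Rightarrow> 'a::real_normed_vector"
  assumes "(f has_integral I) {u..v}" "m > 0"
  shows "((\<lambda>s. f ((s - a) / m)) has_integral m *\<^sub>R I) {a + m * u..a + m * v}"
  using has_integral_affinity'[of f I u v "1 / m" "- a / m"] assms
  by (simp add: diff_divide_distrib algebra_simps)

text \<open>The unit circle, parametrised with period 1.\<close>
definition circ :: "real \<Rightarrow> complex" where
  "circ s = cis (2 * pi * s)"

lemma norm_circ [simp]: "norm (circ s) = 1"
  and circ_0 [simp]: "circ 0 = 1"
  and circ_1 [simp]: "circ 1 = 1"
  and circ_nonzero [simp]: "circ s \<noteq> 0"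
  by (simp_all add: circ_def)

lemma continuous_on_circ [continuous_intros]:
  "continuous_on S f \<Longrightarrow> continuous_on S (\<lambda>x. circ (f x))"
  unfolding circ_def by (intro continuous_intros)

lemma mean_value_circ:
  assumes "h holomorphic_on S" "open S" "cball 0 1 \<subseteq> S"
  shows "((\<lambda>s. h (circ s)) has_integral h 0) {0..1}"
proof -
  have "continuous_on (cball 0 1) h" "h holomorphic_on ball 0 1"
    using assms ball_subset_cball holomorphic_on_imp_continuous_on
    by (metis continuous_on_subset, metis holomorphic_on_subset subset_trans)
  then have "((\<lambda>u. h u / (u - 0)) has_contour_integral (2 * of_real pi * \<i> * h 0)) (circlepath 0 1)"
    by (intro Cauchy_integral_circlepath) auto
  then have "((\<lambda>x. h (circ x) / circ x * (2 * of_real pi * \<i> * circ x)) has_integral (2 * of_real pi * \<i> * h 0)) {0..1}"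
    by (simp add: has_contour_integral vector_derivative_circlepath)
      (simp add: circlepath circ_def cis_conv_exp algebra_simps)
  then have "((\<lambda>x. (1 / (2 * of_real pi * \<i>)) * (h (circ x) / circ x * (2 * of_real pi * \<i> * circ x)))
      has_integral (1 / (2 * of_real pi * \<i>)) * (2 * of_real pi * \<i> * h 0)) {0..1}"
    by (rule has_integral_mult_right)
  then show ?thesis by simp
qed

text \<open>
  For the vortex inside the loop the average is proportional to the coefficient \<open>b\<close>, because
  \<open>1 / (u + b u\<^sup>2) = 1 / u - b / (1 + b u)\<close>, and \<open>1 / u\<close> has mean value 0 on the unit circle.
\<close>
lemma loop_average_inside:
  assumes "cmod b \<le> 1/4" "r > 0"
  shows "((\<lambda>s. 1 / (c - (c + of_real r * (circ s + b * (circ s)\<^sup>2)))) has_integral b / of_real r) {0..1}"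
proof -
  have "((\<lambda>s. circ s) has_integral 0) {0..1}"
    using mean_value_circ[of "\<lambda>u. u" UNIV] by simp
  then have "((\<lambda>s. cnj (circ s)) has_integral cnj 0) {0..1}"
    by (subst (asm) has_integral_cnj[symmetric]) (simp add: o_def)
  then have 1: "((\<lambda>s. 1 / circ s) has_integral 0) {0..1}"
    by (simp add: circ_def divide_conv_cnj)
  have "1 + b * u \<noteq> 0" if "u \<in> ball 0 2" for u
  proof
    assume "1 + b * u = 0"
    then have "b * u = -1" by (simp add: add_eq_0_iff)
    then have "cmod b * cmod u = 1" by (metis norm_minus_cancel norm_mult norm_one)
    moreover have "cmod b * cmod u \<le> 1/4 * 2" using assms that by (intro mult_mono) auto
    ultimately show False by simp
  qed
  note nz = this
  have "((\<lambda>s. (\<lambda>u. b / (1 + b * u)) (circ s)) has_integral (\<lambda>u. b / (1 + b * u)) 0) {0..1}"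
    by (rule mean_value_circ[of _ "ball 0 2"]) (use nz in \<open>auto intro!: holomorphic_intros\<close>)
  then have 2: "((\<lambda>s. b / (1 + b * circ s)) has_integral b) {0..1}" by simp
  have "((\<lambda>s. (- (1 / of_real r)) * (1 / circ s - b / (1 + b * circ s))) has_integral
      (- (1 / of_real r)) * (0 - b)) {0..1}"
    by (intro has_integral_mult_right has_integral_diff 1 2)
  moreover have "(- (1 / of_real r)) * (1 / circ s - b / (1 + b * circ s))
      = 1 / (c - (c + of_real r * (circ s + b * (circ s)\<^sup>2)))" for s
  proof -
    have "c - (c + of_real r * (circ s + b * (circ s)\<^sup>2)) = - (of_real r * circ s * (1 + b * circ s))"
      by (simp add: algebra_simps power2_eq_square)
    then show ?thesis using nz[of "circ s"] assms(2) by (simp add: divide_simps)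
  qed
  ultimately show ?thesis by simp
qed

text \<open>
  For a vortex outside the loop the integrand is a holomorphic function of \<open>u\<close> on the closed unit disc; its
  average is the value at \<open>u = 0\<close>, as if the controlled vortex were at the centre of the loop.
\<close>
lemma loop_average_outside:
  assumes "cmod b \<le> 1/4" "r > 0" "cmod (c' - c) \<ge> 4 * r"
  shows "((\<lambda>s. 1 / (c' - (c + of_real r * (circ s + b * (circ s)\<^sup>2)))) has_integral 1 / (c' - c)) {0..1}"
proof -
  have "c' - (c + of_real r * (u + b * u\<^sup>2)) \<noteq> 0" if "u \<in> ball 0 (3/2)" for u
  proof
    assume "c' - (c + of_real r * (u + b * u\<^sup>2)) = 0"
    then have "c' - c = of_real r * (u + b * u\<^sup>2)" by (simp add: algebra_simps)
    then have "cmod (c' - c) = r * cmod (u + b * u\<^sup>2)" using assms(2) by (simp add: norm_mult)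
    also have "cmod (u + b * u\<^sup>2) \<le> cmod u + cmod b * (cmod u)\<^sup>2"
      by (metis norm_mult norm_power norm_triangle_ineq)
    also have "\<dots> \<le> 3/2 + 1/4 * (3/2)\<^sup>2"
      using assms that by (intro add_mono mult_mono power_mono) auto
    also have "\<dots> < 4" by (simp add: power2_eq_square)
    finally show False using assms(2,3) by (simp add: field_simps)
  qed
  then have "((\<lambda>s. (\<lambda>u. 1 / (c' - (c + of_real r * (u + b * u\<^sup>2)))) (circ s)) has_integral
      (\<lambda>u. 1 / (c' - (c + of_real r * (u + b * u\<^sup>2)))) 0) {0..1}"
    by (intro mean_value_circ[of _ "ball 0 (3/2)"]) (auto intro!: holomorphic_intros)
  then show ?thesis by simp
qed

text \<open>The projection of the real line onto the unit interval.\<close>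
definition clip :: "real \<Rightarrow> real" where
  "clip x = max 0 (min 1 x)"

lemma clip_bounds: "0 \<le> clip x" "clip x \<le> 1"
  and clip_eq_0 [simp]: "x \<le> 0 \<Longrightarrow> clip x = 0"
  and clip_eq_1 [simp]: "1 \<le> x \<Longrightarrow> clip x = 1"
  and clip_eq [simp]: "0 \<le> x \<Longrightarrow> x \<le> 1 \<Longrightarrow> clip x = x"
  by (simp_all add: clip_def)

lemma continuous_on_clip [continuous_intros]:
  "continuous_on S f \<Longrightarrow> continuous_on S (\<lambda>x. clip (f x))"
  unfolding clip_def by (intro continuous_intros)

text \<open>
  A closed curve \<open>A + b B\<close> that starts at the hub \<open>p 0\<close>, follows the transit path \<open>p\<close> to the loop around
  the vortex \<open>i\<close>, runs through this loop once, and goes back. The curve is affine in the coefficient \<open>b\<close>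
  of the loop. Only the fraction \<open>4 \<kappa>\<close> of the time is spent outside the loop.
\<close>
lemma single_vortex_loop:
  fixes c :: "nat \<Rightarrow> complex" and p :: "real \<Rightarrow> complex"
  assumes \<kappa>: "0 < \<kappa>" "\<kappa> \<le> 1/8" and "0 < \<rho>" "\<rho> \<le> r / 2" and i: "i \<in> I"
    and p: "continuous_on {0..1} p" "p 1 = c i + of_real r"
    and far: "\<And>s j. s \<in> {0..1} \<Longrightarrow> j \<in> I \<Longrightarrow> \<rho> \<le> cmod (p s - c j)"
    and sep: "\<And>j. j \<in> I \<Longrightarrow> j \<noteq> i \<Longrightarrow> 4 * r \<le> cmod (c j - c i)"
  shows "\<exists>A B :: real \<Rightarrow> complex. continuous_on {0..1} A \<and> continuous_on {0..1} B \<and>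
    A 0 = p 0 \<and> A 1 = p 0 \<and> B 0 = 0 \<and> B 1 = 0 \<and>
    (\<forall>b j. cmod b \<le> 1/4 \<longrightarrow> j \<in> I \<longrightarrow>
      (\<forall>s\<in>{0..1}. \<rho> \<le> cmod (A s + b * B s - c j)) \<and>
      cmod (integral {0..1} (\<lambda>s. 1 / (c j - (A s + b * B s)))
         - (if j = i then b / of_real r else 1 / (c j - c i))) \<le> 8 * \<kappa> / \<rho>)"
proof -
  \<comment> \<open>\<open>\<phi>\<close> runs along the transit path during the first and the last \<open>\<kappa>\<close> of the time; during the next \<open>\<kappa>\<close> at either
    end \<open>\<psi>\<close> moves \<open>y\<close> from \<open>c i + r\<close> to the starting point \<open>c i + r (1 + b)\<close> of the loop, which depends on \<open>b\<close>;
    in between \<open>U\<close> turns once around the unit circle.\<close>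
  define \<phi> where "\<phi> = (\<lambda>s. clip (min s (1 - s) / \<kappa>))"
  define \<psi> where "\<psi> = (\<lambda>s. clip (min s (1 - s) / \<kappa> - 1))"
  define U where "U = (\<lambda>s. circ (clip ((s - 2 * \<kappa>) / (1 - 4 * \<kappa>))))"
  define A where "A = (\<lambda>s. p (\<phi> s) + of_real r * (U s - 1))"
  define B where "B = (\<lambda>s. of_real r * (of_real (\<psi> s) + (U s)\<^sup>2 - 1))"
  have r: "r > 0" using assms by linarith
  have \<phi>01: "\<phi> s \<in> {0..1}" for s by (simp add: \<phi>_def clip_bounds)
  have c\<phi>: "continuous_on {0..1} \<phi>" unfolding \<phi>_def using \<kappa> by (intro continuous_intros) auto
  have cA: "continuous_on {0..1} A"
    unfolding A_def U_def using \<kappa> \<phi>01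
    by (intro continuous_intros continuous_on_compose2[OF p(1) c\<phi>]) auto
  have cB: "continuous_on {0..1} B"
    unfolding B_def U_def \<psi>_def using \<kappa> by (intro continuous_intros) auto
  have out: "U s = 1" if "s \<le> 2 * \<kappa> \<or> s \<ge> 1 - 2 * \<kappa>" for s
    using that
  proof
    assume "s \<le> 2 * \<kappa>"
    then have "(s - 2 * \<kappa>) / (1 - 4 * \<kappa>) \<le> 0" using \<kappa> by (intro divide_nonpos_pos) auto
    then show ?thesis by (simp add: U_def)
  next
    assume "s \<ge> 1 - 2 * \<kappa>"
    then have "(s - 2 * \<kappa>) / (1 - 4 * \<kappa>) \<ge> 1" using \<kappa> by (simp add: field_simps)
    then show ?thesis by (simp add: U_def)
  qed
  have transit: "A s + b * B s = p (\<phi> s)" if "s \<le> \<kappa> \<or> s \<ge> 1 - \<kappa>" for s b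
  proof -
    have "min s (1 - s) / \<kappa> - 1 \<le> 0" using that \<kappa> by (auto simp: field_simps)
    then show ?thesis using out[of s] that \<kappa> by (auto simp: A_def B_def \<psi>_def)
  qed
  have at1: "\<phi> s = 1" if "\<kappa> \<le> s" "s \<le> 1 - \<kappa>" for s
    using that \<kappa> by (auto simp: \<phi>_def field_simps intro!: clip_eq_1)
  have leg: "A s + b * B s = c i + of_real r * (1 + of_real (\<psi> s) * b)"
    if "\<kappa> \<le> s" "s \<le> 1 - \<kappa>" "s \<le> 2 * \<kappa> \<or> s \<ge> 1 - 2 * \<kappa>" for s b
    using that by (simp add: A_def B_def at1 out p algebra_simps)
  have turn: "A s + b * B s = c i + of_real r * (U s + b * (U s)\<^sup>2)"
    if "2 * \<kappa> \<le> s" "s \<le> 1 - 2 * \<kappa>" for s b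
  proof -
    have "min s (1 - s) / \<kappa> - 1 \<ge> 1" using that \<kappa> by (auto simp: field_simps)
    then have "\<psi> s = 1" by (simp add: \<psi>_def)
    then show ?thesis using that \<kappa> by (simp add: A_def B_def at1 p algebra_simps)
  qed
  have annulus: "\<rho> \<le> cmod (c i + of_real r * (u + q) - c j)"
    if "cmod u = 1" "cmod q \<le> 1/4" "j \<in> I" for u q j
  proof -
    have "cmod (u + q) \<ge> 3/4" "cmod (u + q) \<le> 5/4"
      using that norm_triangle_ineq[of u q] norm_triangle_ineq2[of u "-q"] by auto
    then have "cmod (of_real r * (u + q)) \<ge> r * (3/4)" "cmod (of_real r * (u + q)) \<le> r * (5/4)"
      using r by (simp_all add: norm_mult)
    moreover have "cmod (c j - c i) \<le> cmod (c i + of_real r * (u + q) - c j) + cmod (of_real r * (u + q))"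
      by (smt (verit) add_diff_cancel_left' add_diff_eq diff_add_cancel norm_minus_commute norm_triangle_ineq4)
    ultimately show ?thesis
      using sep[OF that(3)] \<open>\<rho> \<le> r / 2\<close> r by (cases "j = i") auto
  qed
  have dist: "\<rho> \<le> cmod (A s + b * B s - c j)" if "cmod b \<le> 1/4" "j \<in> I" for b s j
  proof -
    consider "s \<le> \<kappa> \<or> s \<ge> 1 - \<kappa>" | "\<kappa> \<le> s" "s \<le> 1 - \<kappa>" "s \<le> 2 * \<kappa> \<or> s \<ge> 1 - 2 * \<kappa>"
      | "2 * \<kappa> \<le> s" "s \<le> 1 - 2 * \<kappa>" by linarith
    then show ?thesis
    proof cases
      case 1
      then show ?thesis using transit far[OF \<phi>01 that(2)] by simp
    next
      case 2
      have "cmod (of_real (\<psi> s) * b) \<le> 1 * (1/4)"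
        unfolding norm_mult using that(1) by (intro mult_mono) (auto simp: \<psi>_def clip_bounds)
      with annulus[of 1 "of_real (\<psi> s) * b" j] that leg[OF 2] show ?thesis by simp
    next
      case 3
      have "cmod (b * (U s)\<^sup>2) \<le> 1/4"
        using that(1) by (simp add: norm_mult norm_power U_def)
      with annulus[of "U s" "b * (U s)\<^sup>2" j] that turn[OF 3] show ?thesis by (simp add: U_def)
    qed
  qed
  have avg: "cmod (integral {0..1} (\<lambda>s. 1 / (c j - (A s + b * B s)))
         - (if j = i then b / of_real r else 1 / (c j - c i))) \<le> 8 * \<kappa> / \<rho>"
    if b: "cmod b \<le> 1/4" and j: "j \<in> I" for b j
  proof -
    define a where "a = (if j = i then b / of_real r else 1 / (c j - c i))"
    define f where "f = (\<lambda>s. 1 / (c j - (A s + b * B s)))"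
    define g where "g = (\<lambda>s. 1 / (c j - (c i + of_real r * (circ s + b * (circ s)\<^sup>2))))"
    have ga: "(g has_integral a) {0..1}"
    proof (cases "j = i")
      case True
      then show ?thesis using loop_average_inside[OF b r, of "c i"] by (simp add: g_def a_def)
    next
      case False
      then show ?thesis using loop_average_outside[OF b r sep[OF j False]] by (simp add: g_def a_def)
    qed
    have nf: "cmod (f s) \<le> 1 / \<rho>" for s
    proof -
      have "\<rho> \<le> cmod (c j - (A s + b * B s))" using dist[OF b j, of s] by (simp add: norm_minus_commute)
      then show ?thesis using \<open>0 < \<rho>\<close> by (simp add: f_def norm_divide frac_le)
    qed
    have nz: "c j - (A s + b * B s) \<noteq> 0" for s
      using dist[OF b j, of s] \<open>0 < \<rho>\<close> by auto
    have cf: "continuous_on {0..1} f"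
      unfolding f_def using nz by (intro continuous_intros cA cB) simp
    have intf: "f integrable_on {u..v}" if "0 \<le> u" "v \<le> 1" for u v
      using that by (intro integrable_continuous_real continuous_on_subset[OF cf]) auto
    have nI: "cmod (integral {u..v} f) \<le> (v - u) / \<rho>" if "0 \<le> u" "u \<le> v" "v \<le> 1" for u v
      using integral_bound[of u v f "1 / \<rho>"] that continuous_on_subset[OF cf] nf by auto
    have "((\<lambda>s. g ((s - 2 * \<kappa>) / (1 - 4 * \<kappa>))) has_integral (1 - 4 * \<kappa>) *\<^sub>R a) {2 * \<kappa>..1 - 2 * \<kappa>}"
      using has_integral_rescale[OF ga, of "1 - 4 * \<kappa>" "2 * \<kappa>"] \<kappa> by simp
    moreover have "f s = g ((s - 2 * \<kappa>) / (1 - 4 * \<kappa>))" if "s \<in> {2 * \<kappa>..1 - 2 * \<kappa>}" for s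
    proof -
      have "clip ((s - 2 * \<kappa>) / (1 - 4 * \<kappa>)) = (s - 2 * \<kappa>) / (1 - 4 * \<kappa>)"
        using that \<kappa> by (intro clip_eq) (auto simp: field_simps)
      then show ?thesis using that turn[of s b] by (simp add: f_def g_def U_def)
    qed
    ultimately have "(f has_integral (1 - 4 * \<kappa>) *\<^sub>R a) {2 * \<kappa>..1 - 2 * \<kappa>}"
      by (subst has_integral_cong) auto
    then have mid: "integral {2 * \<kappa>..1 - 2 * \<kappa>} f = (1 - 4 * \<kappa>) *\<^sub>R a" by (rule integral_unique)
    have "integral {0..1} f = integral {0..2 * \<kappa>} f + integral {2 * \<kappa>..1 - 2 * \<kappa>} f + integral {1 - 2 * \<kappa>..1} f"
      using \<kappa> intf by (simp add: Henstock_Kurzweil_Integration.integral_combine)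
    then have "integral {0..1} f - a = integral {0..2 * \<kappa>} f - (4 * \<kappa>) *\<^sub>R a + integral {1 - 2 * \<kappa>..1} f"
      unfolding mid by (simp add: algebra_simps)
    also have "cmod \<dots> \<le> cmod (integral {0..2 * \<kappa>} f) + cmod ((4 * \<kappa>) *\<^sub>R a) + cmod (integral {1 - 2 * \<kappa>..1} f)"
      by (meson add_right_mono norm_triangle_ineq norm_triangle_ineq4 order_trans)
    also have "\<dots> \<le> 2 * \<kappa> / \<rho> + 4 * \<kappa> * (1 / \<rho>) + 2 * \<kappa> / \<rho>"
    proof (intro add_mono)
      show "cmod (integral {0..2 * \<kappa>} f) \<le> 2 * \<kappa> / \<rho>" using nI[of 0 "2 * \<kappa>"] \<kappa> by simp
      show "cmod (integral {1 - 2 * \<kappa>..1} f) \<le> 2 * \<kappa> / \<rho>" using nI[of "1 - 2 * \<kappa>" 1] \<kappa> by simp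
      have "cmod ((1 - 4 * \<kappa>) *\<^sub>R a) \<le> (1 - 4 * \<kappa>) * (1 / \<rho>)"
        using nI[of "2 * \<kappa>" "1 - 2 * \<kappa>"] \<kappa> mid by simp
      then have "(1 - 4 * \<kappa>) * cmod a \<le> (1 - 4 * \<kappa>) * (1 / \<rho>)" using \<kappa> by simp
      then have "cmod a \<le> 1 / \<rho>" by (rule mult_left_le_imp_le) (use \<kappa> in simp)
      then show "cmod ((4 * \<kappa>) *\<^sub>R a) \<le> 4 * \<kappa> * (1 / \<rho>)" using \<kappa> \<open>0 < \<rho>\<close> by (simp add: field_simps)
    qed
    finally show ?thesis using \<open>0 < \<rho>\<close> by (simp add: f_def a_def field_simps)
  qed
  show ?thesis
  proof (rule exI[of _ A], rule exI[of _ B], intro conjI allI impI ballI)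
    show "A 0 = p 0" "A 1 = p 0" using \<kappa> by (simp_all add: A_def \<phi>_def out)
    show "B 0 = 0" "B 1 = 0" using \<kappa> by (simp_all add: B_def \<psi>_def out)
  qed (use cA cB dist avg in blast)+
qed

section \<open>Families of controls and rounds of loops\<close>

text \<open>
  A curve for the controlled vortex that depends on complex parameters \<open>w 1, \<dots>, w N\<close> in an affine way.
\<close>
definition ctrl :: "nat \<Rightarrow> (real \<Rightarrow> complex) \<Rightarrow> (nat \<Rightarrow> real \<Rightarrow> complex) \<Rightarrow> (nat \<Rightarrow> complex) \<Rightarrow> real \<Rightarrow> complex" where
  "ctrl N Y B w t = Y t + (\<Sum>i\<in>{1..N}. w i * B i t)"

text \<open>
  On \<open>[a, b]\<close> the family \<open>ctrl N Y B\<close> consists of continuous curves from \<open>p\<close> to \<open>q\<close> (the end points do not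
  depend on the parameter). For every parameter in \<open>W\<close>, the curve keeps the distance \<open>\<rho>\<close> from all \<open>\<xi> j\<close>,
  and the integral of \<open>1 / (\<xi> j - y)\<close> agrees with the increment of the target \<open>F j w\<close> up to \<open>E2\<close> on all
  intervals \<open>[a, t]\<close> and up to \<open>E1\<close> on the whole of \<open>[a, b]\<close>. Keeping the two errors apart makes the notion
  well-behaved under concatenation: \<open>E1\<close> adds up, whereas \<open>E2\<close> is only increased by the earlier \<open>E1\<close>.
\<close>
definition control_family ::
  "nat \<Rightarrow> (nat \<Rightarrow> complex) set \<Rightarrow> (nat \<Rightarrow> real \<Rightarrow> complex) \<Rightarrow> (nat \<Rightarrow> (nat \<Rightarrow> complex) \<Rightarrow> real \<Rightarrow> complex) \<Rightarrow>
    real \<Rightarrow> real \<Rightarrow> real \<Rightarrow> complex \<Rightarrow> complex \<Rightarrow> (real \<Rightarrow> complex) \<Rightarrow> (nat \<Rightarrow> real \<Rightarrow> complex) \<Rightarrow>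
    real \<Rightarrow> real \<Rightarrow> bool" where
  "control_family N W \<xi> F \<rho> a b p q Y B E1 E2 \<longleftrightarrow>
    continuous_on {a..b} Y \<and> Y a = p \<and> Y b = q \<and>
    (\<forall>i\<in>{1..N}. continuous_on {a..b} (B i) \<and> B i a = 0 \<and> B i b = 0) \<and>
    (\<forall>w\<in>W. \<forall>j\<in>{1..N}.
      (\<forall>t\<in>{a..b}. \<rho> \<le> cmod (\<xi> j t - ctrl N Y B w t) \<and>
        cmod (integral {a..t} (\<lambda>s. 1 / (\<xi> j s - ctrl N Y B w s)) - (F j w t - F j w a)) \<le> E2) \<and>
      cmod (integral {a..b} (\<lambda>s. 1 / (\<xi> j s - ctrl N Y B w s)) - (F j w b - F j w a)) \<le> E1)"

lemma continuous_on_ctrl: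
  "continuous_on S Y \<Longrightarrow> (\<And>i. i \<in> {1..N} \<Longrightarrow> continuous_on S (B i)) \<Longrightarrow> continuous_on S (ctrl N Y B w)"
  unfolding ctrl_def by (intro continuous_intros) auto

lemma control_family_mono:
  assumes "control_family N W \<xi> F \<rho> a b p q Y B E1 E2" "E1 \<le> E1'" "E2 \<le> E2'"
  shows "control_family N W \<xi> F \<rho> a b p q Y B E1' E2'"
  using assms unfolding control_family_def by (meson order_trans)

lemma control_family_ends:
  assumes "control_family N W \<xi> F \<rho> a b p q Y B E1 E2"
  shows "ctrl N Y B w a = p" "ctrl N Y B w b = q"
  using assms by (simp_all add: control_family_def ctrl_def)

text \<open>Concatenation at time \<open>m\<close>.\<close>
definition join :: "real \<Rightarrow> (real \<Rightarrow> 'a) \<Rightarrow> (real \<Rightarrow> 'a) \<Rightarrow> real \<Rightarrow> 'a" where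
  "join m f g t = (if t \<le> m then f t else g t)"

lemma continuous_on_join:
  assumes "continuous_on {a..m} f" "continuous_on {m..b} g" "f m = g m"
  shows "continuous_on {a..b} (join m f g)"
  unfolding join_def
proof (rule continuous_on_cases_le)
  show "continuous_on {t \<in> {a..b}. t \<le> m} f" "continuous_on {t \<in> {a..b}. m \<le> t} g"
    by (auto intro: continuous_on_subset[OF assms(1)] continuous_on_subset[OF assms(2)])
qed (use assms in \<open>auto intro: continuous_intros\<close>)

lemma ctrl_join: "ctrl N (join m Y Y') (\<lambda>i. join m (B i) (B' i)) w t
    = join m (ctrl N Y B w) (ctrl N Y' B' w) t"
  by (simp add: ctrl_def join_def)

lemma control_family_join:
  assumes 1: "control_family N W \<xi> F \<rho> a m p q Y B E1 E2"
    and 2: "control_family N W \<xi> F \<rho> m b q r Y' B' E1' E2'"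
    and "a \<le> m" "m \<le> b" "\<rho> > 0"
    and \<xi>: "\<And>j. j \<in> {1..N} \<Longrightarrow> continuous_on {a..b} (\<xi> j)"
  shows "control_family N W \<xi> F \<rho> a b p r (join m Y Y') (\<lambda>i. join m (B i) (B' i))
    (E1 + E1') (max E2 (E1 + E2'))"
proof -
  let ?Y = "join m Y Y'" and ?B = "\<lambda>i. join m (B i) (B' i)"
  have cY: "continuous_on {a..b} ?Y" and cB: "\<And>i. i \<in> {1..N} \<Longrightarrow> continuous_on {a..b} (?B i)"
    using 1 2 unfolding control_family_def by (auto intro!: continuous_on_join)
  have ends: "?Y a = p" "?Y b = r" "\<And>i. i \<in> {1..N} \<Longrightarrow> ?B i a = 0 \<and> ?B i b = 0"
    using 1 2 \<open>a \<le> m\<close> \<open>m \<le> b\<close> unfolding control_family_def join_def by auto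
  have eq1: "ctrl N ?Y ?B w t = ctrl N Y B w t" if "t \<le> m" for w t
    using that by (simp add: ctrl_join join_def)
  have eq2: "ctrl N ?Y ?B w t = ctrl N Y' B' w t" if "m \<le> t" for w t
    using that control_family_ends[OF 1, of w] control_family_ends[OF 2, of w]
    by (cases "t = m") (auto simp: ctrl_join join_def)
  have main: "\<rho> \<le> cmod (\<xi> j t - ctrl N ?Y ?B w t)"
    "t \<le> m \<Longrightarrow> integral {a..t} (\<lambda>s. 1 / (\<xi> j s - ctrl N ?Y ?B w s))
       = integral {a..t} (\<lambda>s. 1 / (\<xi> j s - ctrl N Y B w s))"
    "m \<le> t \<Longrightarrow> integral {a..t} (\<lambda>s. 1 / (\<xi> j s - ctrl N ?Y ?B w s))
       = integral {a..m} (\<lambda>s. 1 / (\<xi> j s - ctrl N Y B w s))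
       + integral {m..t} (\<lambda>s. 1 / (\<xi> j s - ctrl N Y' B' w s))"
    if w: "w \<in> W" and j: "j \<in> {1..N}" and t: "t \<in> {a..b}" for w j t
  proof -
    have d: "\<rho> \<le> cmod (\<xi> j s - ctrl N ?Y ?B w s)" if "s \<in> {a..b}" for s
    proof (cases "s \<le> m")
      case True
      then have "s \<in> {a..m}" using that by auto
      then have "\<rho> \<le> cmod (\<xi> j s - ctrl N Y B w s)" using 1 w j unfolding control_family_def by blast
      with True show ?thesis by (simp add: eq1)
    next
      case False
      then have "s \<in> {m..b}" using that by auto
      then have "\<rho> \<le> cmod (\<xi> j s - ctrl N Y' B' w s)" using 2 w j unfolding control_family_def by blast
      with False show ?thesis by (simp add: eq2)
    qed
    then show "\<rho> \<le> cmod (\<xi> j t - ctrl N ?Y ?B w t)" using t .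
    have "continuous_on {a..b} (\<lambda>s. 1 / (\<xi> j s - ctrl N ?Y ?B w s))"
      using d \<open>\<rho> > 0\<close> by (intro continuous_intros \<xi> j continuous_on_ctrl cY cB) force+
    then have int: "(\<lambda>s. 1 / (\<xi> j s - ctrl N ?Y ?B w s)) integrable_on {a..t}"
      using t by (intro integrable_continuous_real) (auto elim: continuous_on_subset)
    show "integral {a..t} (\<lambda>s. 1 / (\<xi> j s - ctrl N ?Y ?B w s))
       = integral {a..t} (\<lambda>s. 1 / (\<xi> j s - ctrl N Y B w s))" if "t \<le> m"
      using that by (intro integral_cong) (simp add: eq1)
    assume "m \<le> t"
    then have "integral {a..t} (\<lambda>s. 1 / (\<xi> j s - ctrl N ?Y ?B w s))
       = integral {a..m} (\<lambda>s. 1 / (\<xi> j s - ctrl N ?Y ?B w s))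
       + integral {m..t} (\<lambda>s. 1 / (\<xi> j s - ctrl N ?Y ?B w s))"
      using int \<open>a \<le> m\<close> by (simp add: Henstock_Kurzweil_Integration.integral_combine)
    also have "integral {a..m} (\<lambda>s. 1 / (\<xi> j s - ctrl N ?Y ?B w s))
        = integral {a..m} (\<lambda>s. 1 / (\<xi> j s - ctrl N Y B w s))"
      by (intro integral_cong) (simp add: eq1)
    also have "integral {m..t} (\<lambda>s. 1 / (\<xi> j s - ctrl N ?Y ?B w s))
        = integral {m..t} (\<lambda>s. 1 / (\<xi> j s - ctrl N Y' B' w s))"
      by (intro integral_cong) (simp add: eq2)
    finally show "integral {a..t} (\<lambda>s. 1 / (\<xi> j s - ctrl N ?Y ?B w s))
       = integral {a..m} (\<lambda>s. 1 / (\<xi> j s - ctrl N Y B w s))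
       + integral {m..t} (\<lambda>s. 1 / (\<xi> j s - ctrl N Y' B' w s))" .
  qed
  have add: "cmod (x + y - (u - v)) \<le> E + E'"
    if "cmod (x - (z - v)) \<le> E" "cmod (y - (u - z)) \<le> E'" for x y u v z :: complex and E E'
    using norm_triangle_mono[OF that] by (simp add: algebra_simps)
  have t1: "cmod (integral {a..t} (\<lambda>s. 1 / (\<xi> j s - ctrl N Y B w s)) - (F j w t - F j w a)) \<le> E2"
    if "w \<in> W" "j \<in> {1..N}" "t \<in> {a..m}" for w j t using 1 that unfolding control_family_def by blast
  have t2: "cmod (integral {m..t} (\<lambda>s. 1 / (\<xi> j s - ctrl N Y' B' w s)) - (F j w t - F j w m)) \<le> E2'"
    if "w \<in> W" "j \<in> {1..N}" "t \<in> {m..b}" for w j t using 2 that unfolding control_family_def by blast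
  have T1: "cmod (integral {a..m} (\<lambda>s. 1 / (\<xi> j s - ctrl N Y B w s)) - (F j w m - F j w a)) \<le> E1"
    if "w \<in> W" "j \<in> {1..N}" for w j using 1 that unfolding control_family_def by blast
  have T2: "cmod (integral {m..b} (\<lambda>s. 1 / (\<xi> j s - ctrl N Y' B' w s)) - (F j w b - F j w m)) \<le> E1'"
    if "w \<in> W" "j \<in> {1..N}" for w j using 2 that unfolding control_family_def by blast
  have "cmod (integral {a..t} (\<lambda>s. 1 / (\<xi> j s - ctrl N ?Y ?B w s)) - (F j w t - F j w a)) \<le> max E2 (E1 + E2')"
    if w: "w \<in> W" and j: "j \<in> {1..N}" and t: "t \<in> {a..b}" for w j t
  proof (cases "t \<le> m")
    case True
    then show ?thesis using t1[OF w j, of t] t unfolding main(2)[OF w j t True] by auto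
  next
    case False
    then have "m \<le> t" by simp
    have "cmod (integral {m..t} (\<lambda>s. 1 / (\<xi> j s - ctrl N Y' B' w s)) - (F j w t - F j w m)) \<le> E2'"
      using t2[OF w j] t False by auto
    from add[OF T1[OF w j] this] show ?thesis
      unfolding main(3)[OF w j t \<open>m \<le> t\<close>] by simp
  qed
  moreover have "cmod (integral {a..b} (\<lambda>s. 1 / (\<xi> j s - ctrl N ?Y ?B w s)) - (F j w b - F j w a)) \<le> E1 + E1'"
    if w: "w \<in> W" and j: "j \<in> {1..N}" for w j
  proof -
    have b: "b \<in> {a..b}" using \<open>a \<le> m\<close> \<open>m \<le> b\<close> by simp
    show ?thesis using add[OF T1[OF w j] T2[OF w j]] unfolding main(3)[OF w j b \<open>m \<le> b\<close>] by simp
  qed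
  ultimately show ?thesis
    using cY cB ends main(1) unfolding control_family_def by blast
qed

text \<open>
  One round: a loop around each vortex in turn, all starting and ending at the hub \<open>P\<close>, with independent
  coefficients \<open>b i\<close>. The average felt by the vortex \<open>j\<close> is affine in \<open>b j\<close> and independent of the other coefficients.
\<close>
lemma round_of_loops:
  fixes c :: "nat \<Rightarrow> complex"
  assumes \<kappa>: "0 < \<kappa>" "\<kappa> \<le> 1/8" and \<rho>: "0 < \<rho>" "\<rho> \<le> r / 2" and "N \<ge> 1"
    and sep: "\<And>i j. i \<in> {1..N} \<Longrightarrow> j \<in> {1..N} \<Longrightarrow> j \<noteq> i \<Longrightarrow> 4 * r \<le> cmod (c j - c i)"
    and P: "\<And>i. i \<in> {1..N} \<Longrightarrow> \<exists>p :: real \<Rightarrow> complex. continuous_on {0..1} p \<and> p 0 = P \<and> p 1 = c i + of_real r \<and>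
        (\<forall>s\<in>{0..1}. \<forall>j\<in>{1..N}. \<rho> \<le> cmod (p s - c j))"
  obtains Y :: "real \<Rightarrow> complex" and B :: "nat \<Rightarrow> real \<Rightarrow> complex" where
    "continuous_on {0..1} Y" "Y 0 = P" "Y 1 = P"
    "\<And>i. i \<in> {1..N} \<Longrightarrow> continuous_on {0..1} (B i) \<and> B i 0 = 0 \<and> B i 1 = 0"
    "\<And>b j. \<forall>i\<in>{1..N}. cmod (b i) \<le> 1/4 \<Longrightarrow> j \<in> {1..N} \<Longrightarrow>
      (\<forall>t\<in>{0..1}. \<rho> \<le> cmod (c j - ctrl N Y B b t)) \<and>
      cmod (integral {0..1} (\<lambda>s. 1 / (c j - ctrl N Y B b s))
        - (\<Sum>i\<in>{1..N}. if j = i then b i / of_real r else 1 / (c j - c i)) / of_nat N) \<le> 8 * \<kappa> / \<rho>"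
proof -
  define avg where "avg = (\<lambda>b i j. if j = i then b i / of_real r else 1 / (c j - c i))"
  define W where "W = {b. \<forall>i\<in>{1..N}. cmod (b i) \<le> 1/4}"
  \<comment> \<open>The round takes the time interval \<open>[0, N]\<close>, and the target jumps after each loop; finally time is rescaled to \<open>[0, 1]\<close>.\<close>
  define F where "F = (\<lambda>j b (t::real). \<Sum>i\<in>{1..nat \<lfloor>t\<rfloor>}. avg b i j)"
  define E where "E = 8 * \<kappa> / \<rho>"
  have E: "0 \<le> E" "E \<le> 1 / \<rho>" using \<kappa> \<rho> by (simp_all add: E_def field_simps)
  have ind: "\<exists>Y B. control_family N W (\<lambda>j t. c j) F \<rho> 0 (real k) P P Y B (real k * E) (3 / \<rho> + real k * E)"
    if "k \<le> N" for k
    using that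
  proof (induction k)
    case 0
    have "\<rho> \<le> cmod (c j - P)" if j: "j \<in> {1..N}" for j
    proof -
      obtain p where "p 0 = P" "\<forall>s\<in>{0..1::real}. \<forall>j\<in>{1..N}. \<rho> \<le> cmod (p s - c j)"
        using P[OF j] by blast
      then have "\<rho> \<le> cmod (p 0 - c j)" using j by force
      then show ?thesis using \<open>p 0 = P\<close> by (simp add: norm_minus_commute)
    qed
    then have "control_family N W (\<lambda>j t. c j) F \<rho> 0 (real 0) P P (\<lambda>_. P) (\<lambda>_ _. 0) (real 0 * E) (3 / \<rho> + real 0 * E)"
      using \<rho> by (auto simp: control_family_def ctrl_def)
    then show ?case by blast
  next
    case (Suc k)
    then obtain Y B where YB: "control_family N W (\<lambda>j t. c j) F \<rho> 0 (real k) P P Y B (real k * E) (3 / \<rho> + real k * E)"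
      by auto
    define i where "i = Suc k"
    have i: "i \<in> {1..N}" using Suc.prems by (simp add: i_def)
    obtain p :: "real \<Rightarrow> complex" where p: "continuous_on {0..1} p" "p 0 = P" "p 1 = c i + of_real r"
      "\<And>s j. s \<in> {0..1} \<Longrightarrow> j \<in> {1..N} \<Longrightarrow> \<rho> \<le> cmod (p s - c j)" using P[OF i] by blast
    have "\<exists>A D :: real \<Rightarrow> complex. continuous_on {0..1} A \<and> continuous_on {0..1} D \<and>
      A 0 = p 0 \<and> A 1 = p 0 \<and> D 0 = 0 \<and> D 1 = 0 \<and>
      (\<forall>b j. cmod b \<le> 1/4 \<longrightarrow> j \<in> {1..N} \<longrightarrow>
        (\<forall>s\<in>{0..1}. \<rho> \<le> cmod (A s + b * D s - c j)) \<and>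
        cmod (integral {0..1} (\<lambda>s. 1 / (c j - (A s + b * D s)))
          - (if j = i then b / of_real r else 1 / (c j - c i))) \<le> 8 * \<kappa> / \<rho>)"
      by (rule single_vortex_loop[where c = c and p = p and I = "{1..N}", OF \<kappa> \<rho> i p(1,3)]) (use p(4) sep[OF i] in auto)
    then obtain A D :: "real \<Rightarrow> complex" where AD: "continuous_on {0..1} A" "continuous_on {0..1} D"
      "A 0 = p 0" "A 1 = p 0" "D 0 = 0" "D 1 = 0"
      "\<And>b s j. cmod b \<le> 1/4 \<Longrightarrow> s \<in> {0..1} \<Longrightarrow> j \<in> {1..N} \<Longrightarrow> \<rho> \<le> cmod (A s + b * D s - c j)"
      "\<And>b j. cmod b \<le> 1/4 \<Longrightarrow> j \<in> {1..N} \<Longrightarrow>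
       cmod (integral {0..1} (\<lambda>s. 1 / (c j - (A s + b * D s)))
         - (if j = i then b / of_real r else 1 / (c j - c i))) \<le> 8 * \<kappa> / \<rho>"
      by blast
    define Y' where "Y' = (\<lambda>t. A (t - real k))"
    define B' where "B' = (\<lambda>n t. if n = i then D (t - real k) else 0)"
    have ct: "ctrl N Y' B' b t = A (t - real k) + b i * D (t - real k)" for b t
      using i by (simp add: ctrl_def Y'_def B'_def if_distrib sum.delta cong: if_cong)
    have cAk: "continuous_on {real k..real (Suc k)} (\<lambda>t. A (t - real k))"
      and cDk: "continuous_on {real k..real (Suc k)} (\<lambda>t. D (t - real k))"
      by (auto intro!: continuous_intros continuous_on_compose2[OF AD(1)] continuous_on_compose2[OF AD(2)])
    have new: "control_family N W (\<lambda>j t. c j) F \<rho> (real k) (real (Suc k)) P P Y' B' E (3 / \<rho>)"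
      unfolding control_family_def
    proof (intro conjI ballI)
      show "continuous_on {real k..real (Suc k)} Y'" unfolding Y'_def by (rule cAk)
      show "Y' (real k) = P" "Y' (real (Suc k)) = P" using AD p by (simp_all add: Y'_def)
      show "continuous_on {real k..real (Suc k)} (B' n)" for n
        unfolding B'_def using cDk by (cases "n = i") auto
      show "B' n (real k) = 0" "B' n (real (Suc k)) = 0" for n using AD by (simp_all add: B'_def)
      fix b j assume b: "b \<in> W" and j: "j \<in> {1..N}"
      then have bi: "cmod (b i) \<le> 1/4" using i by (auto simp: W_def)
      have dist: "\<rho> \<le> cmod (c j - ctrl N Y' B' b t)" if "t \<in> {real k..real (Suc k)}" for t
        using AD(7)[OF bi _ j, of "t - real k"] that by (simp add: ct norm_minus_commute)
      have nz: "A (t - real k) + b i * D (t - real k) \<noteq> c j" if "t \<in> {real k..real (Suc k)}" for t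
        using dist[OF that] \<rho> by (auto simp: ct)
      have cont: "continuous_on {real k..real (Suc k)} (\<lambda>s. 1 / (c j - ctrl N Y' B' b s))"
        unfolding ct using nz by (intro continuous_intros cAk cDk) (metis eq_iff_diff_eq_0)
      define g where "g = (\<lambda>s. 1 / (c j - (A s + b i * D s)))"
      have "continuous_on {0..1} g"
        unfolding g_def using AD(7)[OF bi _ j] \<rho>
        by (intro continuous_intros AD) force
      then have "(g has_integral integral {0..1} g) {0..1}"
        by (intro integrable_integral integrable_continuous_real)
      from has_integral_rescale[OF this, of 1 "real k"]
      have "((\<lambda>s. 1 / (c j - ctrl N Y' B' b s)) has_integral integral {0..1} g) {real k..real (Suc k)}"
        by (simp add: g_def ct add.commute)
      then have I: "integral {real k..real (Suc k)} (\<lambda>s. 1 / (c j - ctrl N Y' B' b s)) = integral {0..1} g"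
        by (rule integral_unique)
      have FS: "F j b (real (Suc k)) - F j b (real k) = avg b i j"
      proof -
        have "nat \<lfloor>real (Suc k)\<rfloor> = Suc k" "nat \<lfloor>real k\<rfloor> = k" by linarith+
        then show ?thesis by (simp only: F_def) (simp add: i_def)
      qed
      have e: "cmod (integral {0..1} g - avg b i j) \<le> E"
        using AD(8)[OF bi j] by (simp add: g_def avg_def E_def)
      then show tot: "cmod (integral {real k..real (Suc k)} (\<lambda>s. 1 / (c j - ctrl N Y' B' b s))
          - (F j b (real (Suc k)) - F j b (real k))) \<le> E"
        by (simp only: I FS)
      fix t assume t: "t \<in> {real k..real (Suc k)}"
      show "\<rho> \<le> cmod (c j - ctrl N Y' B' b t)" using dist[OF t] .
      show "cmod (integral {real k..t} (\<lambda>s. 1 / (c j - ctrl N Y' B' b s)) - (F j b t - F j b (real k))) \<le> 3 / \<rho>"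
      proof (cases "t = real (Suc k)")
        case True
        then show ?thesis using tot E \<rho> by (simp add: order_trans[OF _ divide_right_mono[of 1 3]])
      next
        case False
        then have "\<lfloor>t\<rfloor> = int k" using t by (auto simp: floor_eq_iff)
        then have "F j b t = F j b (real k)" by (simp add: F_def)
        moreover have "cmod (integral {real k..t} (\<lambda>s. 1 / (c j - ctrl N Y' B' b s))) \<le> 1 / \<rho> * (t - real k)"
          using t dist \<rho> by (intro integral_bound continuous_on_subset[OF cont])
            (auto simp: norm_divide intro!: frac_le)
        moreover have "1 / \<rho> * (t - real k) \<le> 1 / \<rho> * 3"
          using t \<rho> by (intro mult_left_mono) auto
        ultimately show ?thesis by simp
      qed
    qed
    have "control_family N W (\<lambda>j t. c j) F \<rho> 0 (real (Suc k)) P P (join (real k) Y Y') (\<lambda>i. join (real k) (B i) (B' i))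
        (real k * E + E) (max (3 / \<rho> + real k * E) (real k * E + 3 / \<rho>))"
      using \<rho> by (intro control_family_join[OF YB new]) auto
    then have "control_family N W (\<lambda>j t. c j) F \<rho> 0 (real (Suc k)) P P (join (real k) Y Y') (\<lambda>i. join (real k) (B i) (B' i))
        (real (Suc k) * E) (3 / \<rho> + real (Suc k) * E)"
      by (rule control_family_mono) (use E in \<open>simp_all add: algebra_simps\<close>)
    then show ?case by blast
  qed
  then obtain Y B where YB: "control_family N W (\<lambda>j t. c j) F \<rho> 0 (real N) P P Y B (real N * E) (3 / \<rho> + real N * E)"
    by blast
  have Npos: "real N > 0" using \<open>N \<ge> 1\<close> by simp
  define Y' where "Y' = (\<lambda>s. Y (real N * s))"
  define B' where "B' = (\<lambda>i s. B i (real N * s))"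
  have ct: "ctrl N Y' B' b s = ctrl N Y B b (real N * s)" for b s by (simp add: ctrl_def Y'_def B'_def)
  have comp: "continuous_on {0..1} (\<lambda>s. f (real N * s))" if "continuous_on {0..real N} f" for f :: "real \<Rightarrow> complex"
    using Npos by (intro continuous_on_compose2[OF that]) (auto intro!: continuous_intros mult_left_le)
  show ?thesis
  proof (rule that[of Y' B'])
    show "continuous_on {0..1} Y'" "Y' 0 = P" "Y' 1 = P"
      using YB comp[of Y] by (simp_all add: control_family_def Y'_def)
    show "continuous_on {0..1} (B' i) \<and> B' i 0 = 0 \<and> B' i 1 = 0" if "i \<in> {1..N}" for i
      using YB comp[of "B i"] that by (simp add: control_family_def B'_def)
    fix b j assume b: "\<forall>i\<in>{1..N}. cmod (b i) \<le> 1/4" and j: "j \<in> {1..N}"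
    have bW: "b \<in> W" using b by (simp add: W_def)
    have dist: "\<rho> \<le> cmod (c j - ctrl N Y B b t)" if "t \<in> {0..real N}" for t
      using YB bW j that unfolding control_family_def by blast
    have "continuous_on {0..real N} (\<lambda>s. 1 / (c j - ctrl N Y B b s))"
      using YB dist \<rho> unfolding control_family_def
      by (intro continuous_intros continuous_on_ctrl) force+
    then have "((\<lambda>s. 1 / (c j - ctrl N Y B b s)) has_integral integral {0..real N} (\<lambda>s. 1 / (c j - ctrl N Y B b s))) {0..real N}"
      by (intro integrable_integral integrable_continuous_real)
    from has_integral_rescale[OF this, of "1 / real N" 0]
    have I: "integral {0..1} (\<lambda>s. 1 / (c j - ctrl N Y' B' b s))
       = integral {0..real N} (\<lambda>s. 1 / (c j - ctrl N Y B b s)) / of_nat N"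
      using Npos by (intro integral_unique) (simp add: ct mult.commute scaleR_conv_of_real)
    have "cmod (integral {0..real N} (\<lambda>s. 1 / (c j - ctrl N Y B b s)) - (F j b (real N) - F j b 0)) \<le> real N * E"
      using YB bW j unfolding control_family_def by blast
    moreover have "F j b (real N) - F j b 0 = (\<Sum>i\<in>{1..N}. avg b i j)" by (simp add: F_def)
    ultimately have "cmod ((integral {0..real N} (\<lambda>s. 1 / (c j - ctrl N Y B b s)) - (\<Sum>i\<in>{1..N}. avg b i j)) / of_nat N) \<le> E"
      using Npos by (simp add: norm_divide field_simps)
    then have "cmod (integral {0..1} (\<lambda>s. 1 / (c j - ctrl N Y' B' b s)) - (\<Sum>i\<in>{1..N}. avg b i j) / of_nat N) \<le> E"
      by (simp add: I diff_divide_distrib)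
    moreover have "\<forall>t\<in>{0..1}. \<rho> \<le> cmod (c j - ctrl N Y' B' b t)"
      using dist Npos by (auto simp: ct mult_left_le)
    ultimately show "(\<forall>t\<in>{0..1}. \<rho> \<le> cmod (c j - ctrl N Y' B' b t)) \<and>
      cmod (integral {0..1} (\<lambda>s. 1 / (c j - ctrl N Y' B' b s))
        - (\<Sum>i\<in>{1..N}. if j = i then b i / of_real r else 1 / (c j - c i)) / of_nat N) \<le> 8 * \<kappa> / \<rho>"
      by (simp add: avg_def E_def)
  qed
qed

section \<open>Steering by many short rounds\<close>

lemma path_avoiding_finite:
  fixes a b :: complex
  assumes "finite S" "a \<notin> S" "b \<notin> S"
  shows "\<exists>\<rho>>0. \<exists>p :: real \<Rightarrow> complex. continuous_on {0..1} p \<and> p 0 = a \<and> p 1 = b \<and> (\<forall>s\<in>{0..1}. \<forall>z\<in>S. \<rho> \<le> cmod (p s - z))"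
proof -
  have "path_connected (- S)"
    using \<open>finite S\<close> by (intro path_connected_complement_countable) (auto intro: countable_finite)
  then obtain g where g: "path g" "path_image g \<subseteq> - S" "pathstart g = a" "pathfinish g = b"
    using assms unfolding path_connected_def by blast
  obtain \<rho> where \<rho>: "\<rho> > 0" "\<forall>x\<in>path_image g. \<forall>y\<in>S. \<rho> \<le> dist x y"
    using separate_compact_closed[of "path_image g" S] g \<open>finite S\<close> compact_path_image finite_imp_closed by blast
  then show ?thesis
    using g by (intro exI[of _ \<rho>] conjI exI[of _ g])
      (auto simp: path_def pathstart_def pathfinish_def path_image_def dist_norm)
qed

lemma finite_near:
  fixes f :: "'b \<Rightarrow> real \<Rightarrow> complex"
  assumes "finite A" "\<And>j. j \<in> A \<Longrightarrow> continuous_on S (f j)" "x \<in> S" "e > 0"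
  shows "\<exists>d>0. \<forall>j\<in>A. \<forall>t\<in>S. \<bar>t - x\<bar> < d \<longrightarrow> cmod (f j t - f j x) < e"
proof (rule finite_uniform_pos[OF \<open>finite A\<close>])
  fix j assume "j \<in> A"
  then show "\<exists>d>0. \<forall>t\<in>S. \<bar>t - x\<bar> < d \<longrightarrow> cmod (f j t - f j x) < e"
    using assms unfolding continuous_on_iff by (simp add: dist_norm)
qed fastforce

text \<open>
  Paths from the hub \<open>P\<close> to the loops, whose distance from the vortices is bounded below by the same \<open>\<rho>\<close> at
  all times. At a fixed time they exist since the complement of a finite set in the plane is path-connected;
  a path can be deformed along with the configuration for a short time, and compactness does the rest.
\<close>
lemma uniform_transit:
  fixes \<xi> :: "nat \<Rightarrow> real \<Rightarrow> complex"
  assumes "0 \<le> T" and \<xi>: "\<And>j. j \<in> {1..N} \<Longrightarrow> continuous_on {0..T} (\<xi> j)" and "r > 0"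
    and sep: "\<And>t i j. t \<in> {0..T} \<Longrightarrow> i \<in> {1..N} \<Longrightarrow> j \<in> {1..N} \<Longrightarrow> j \<noteq> i \<Longrightarrow> 4 * r \<le> cmod (\<xi> j t - \<xi> i t)"
    and hub: "\<And>t j. t \<in> {0..T} \<Longrightarrow> j \<in> {1..N} \<Longrightarrow> \<xi> j t \<noteq> P"
  shows "\<exists>\<rho>>0. \<forall>t\<in>{0..T}. \<forall>i\<in>{1..N}. \<exists>p :: real \<Rightarrow> complex. continuous_on {0..1} p \<and> p 0 = P \<and> p 1 = \<xi> i t + of_real r \<and>
    (\<forall>s\<in>{0..1}. \<forall>j\<in>{1..N}. \<rho> \<le> cmod (p s - \<xi> j t))"
proof -
  define Q where "Q = (\<lambda>t i \<rho>. \<exists>p :: real \<Rightarrow> complex. continuous_on {0..1} p \<and> p 0 = P \<and> p 1 = \<xi> i t + of_real r \<and>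
    (\<forall>s\<in>{0..1}. \<forall>j\<in>{1..N}. \<rho> \<le> cmod (p s - \<xi> j t)))"
  have Qmono: "Q t i \<rho>'" if Q: "Q t i \<rho>" and le: "\<rho>' \<le> \<rho>" for t i \<rho> \<rho>'
  proof -
    obtain p :: "real \<Rightarrow> complex" where p: "continuous_on {0..1} p" "p 0 = P" "p 1 = \<xi> i t + of_real r"
      "\<forall>s\<in>{0..1}. \<forall>j\<in>{1..N}. \<rho> \<le> cmod (p s - \<xi> j t)" using Q unfolding Q_def by blast
    then have "\<forall>s\<in>{0..1}. \<forall>j\<in>{1..N}. \<rho>' \<le> cmod (p s - \<xi> j t)" using le by (meson order_trans)
    with p show ?thesis unfolding Q_def by blast
  qed
  obtain u v :: real where uv: "u = 0" "v = T" by blast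
  then have "u \<le> v" using \<open>0 \<le> T\<close> by simp
  then have "{u..v} \<subseteq> {0..T} \<longrightarrow> (\<exists>\<rho>>0. \<forall>t\<in>{u..v}. \<forall>i\<in>{1..N}. Q t i \<rho>)"
  proof (induction rule: Bolzano)
    case (trans a b c)
    show ?case
    proof
      assume "{a..c} \<subseteq> {0..T}"
      then have "{a..b} \<subseteq> {0..T}" "{b..c} \<subseteq> {0..T}" using trans by auto
      then obtain \<rho> \<rho>' where \<rho>: "\<rho> > 0" "\<And>t i. t \<in> {a..b} \<Longrightarrow> i \<in> {1..N} \<Longrightarrow> Q t i \<rho>"
        "\<rho>' > 0" "\<And>t i. t \<in> {b..c} \<Longrightarrow> i \<in> {1..N} \<Longrightarrow> Q t i \<rho>'"
        using trans by blast
      have "Q t i (min \<rho> \<rho>')" if "t \<in> {a..c}" "i \<in> {1..N}" for t i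
        using \<rho>(2)[of t i] \<rho>(4)[of t i] that Qmono[of t i \<rho> "min \<rho> \<rho>'"] Qmono[of t i \<rho>' "min \<rho> \<rho>'"]
        by (cases "t \<le> b") auto
      then show "\<exists>\<rho>>0. \<forall>t\<in>{a..c}. \<forall>i\<in>{1..N}. Q t i \<rho>"
        using \<rho> by (intro exI[of _ "min \<rho> \<rho>'"]) auto
    qed
  next
    case (local x)
    then have x: "x \<in> {0..T}" by (simp add: uv)
    have "\<exists>\<rho>>0. \<forall>i\<in>{1..N}. Q x i \<rho>"
    proof (rule finite_uniform_pos)
      fix i assume i: "i \<in> {1..N}"
      define S where "S = (\<lambda>j. \<xi> j x) ` {1..N}"
      have "P \<notin> S" using hub[OF x] by (metis S_def imageE)
      moreover have "\<xi> i x + of_real r \<notin> S"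
      proof
        assume "\<xi> i x + of_real r \<in> S"
        then obtain j where j0: "j \<in> {1..N}" "\<xi> i x + of_real r = \<xi> j x" unfolding S_def by blast
        then have j: "j \<in> {1..N}" "\<xi> j x - \<xi> i x = of_real r" by (simp_all flip: j0(2))
        then have "j \<noteq> i" using \<open>r > 0\<close> by auto
        then have "4 * r \<le> cmod (of_real r)" using sep[OF x i j(1)] j(2) by simp
        then show False using \<open>r > 0\<close> by simp
      qed
      moreover have "finite S" by (simp add: S_def)
      ultimately show "\<exists>\<rho>>0. Q x i \<rho>"
        using path_avoiding_finite[of S P "\<xi> i x + of_real r"] by (fastforce simp: Q_def S_def)
    qed (use Qmono in auto)
    then obtain \<rho> where \<rho>: "\<rho> > 0" "\<And>i. i \<in> {1..N} \<Longrightarrow> Q x i \<rho>" by blast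
    obtain d where d: "d > 0" "\<And>j t. j \<in> {1..N} \<Longrightarrow> t \<in> {0..T} \<Longrightarrow> \<bar>t - x\<bar> < d \<Longrightarrow> cmod (\<xi> j t - \<xi> j x) < \<rho> / 4"
      using finite_near[where A = "{1..N}" and f = \<xi>, OF _ \<xi> x, of "\<rho> / 4"] \<rho>(1) by auto
    have "Q t i (\<rho> / 2)" if t: "t \<in> {0..T}" "\<bar>t - x\<bar> < d" and i: "i \<in> {1..N}" for t i
    proof -
      obtain p :: "real \<Rightarrow> complex" where p: "continuous_on {0..1} p" "p 0 = P" "p 1 = \<xi> i x + of_real r"
        "\<And>s j. s \<in> {0..1} \<Longrightarrow> j \<in> {1..N} \<Longrightarrow> \<rho> \<le> cmod (p s - \<xi> j x)"
        using \<rho>(2)[OF i] unfolding Q_def by blast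
      define p' where "p' = (\<lambda>s. p s + of_real s * (\<xi> i t - \<xi> i x))"
      have "\<rho> / 2 \<le> cmod (p' s - \<xi> j t)" if s: "s \<in> {0..1}" and j: "j \<in> {1..N}" for s j
      proof -
        have "\<rho> \<le> cmod (p s - \<xi> j x)" by (rule p(4)[OF s j])
        also have "p s - \<xi> j x = (p' s - \<xi> j t) - of_real s * (\<xi> i t - \<xi> i x) + (\<xi> j t - \<xi> j x)"
          by (simp add: p'_def)
        also have "cmod \<dots> \<le> cmod (p' s - \<xi> j t) + cmod (of_real s * (\<xi> i t - \<xi> i x)) + cmod (\<xi> j t - \<xi> j x)"
          by (meson add_right_mono norm_triangle_ineq norm_triangle_ineq4 order_trans)
        also have "cmod (of_real s * (\<xi> i t - \<xi> i x)) \<le> 1 * (\<rho> / 4)"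
          unfolding norm_mult using s d(2)[OF i t] by (intro mult_mono) auto
        finally show ?thesis using d(2)[OF j t] by linarith
      qed
      moreover have "continuous_on {0..1} p'" unfolding p'_def by (intro continuous_intros p)
      moreover have "p' 0 = P" "p' 1 = \<xi> i t + of_real r" by (simp_all add: p'_def p)
      ultimately show ?thesis unfolding Q_def by blast
    qed
    moreover have "\<bar>t - x\<bar> < d" if "a \<le> x" "x \<le> b" "b - a < d" "t \<in> {a..b}" for a b t using that by auto
    ultimately show ?case
      using d(1) \<rho>(1) by (intro exI[of _ d] conjI allI impI exI[of _ "\<rho> / 2"]) (auto simp: subset_iff)
  qed
  then show ?thesis by (simp add: Q_def uv)
qed

text \<open>
  On every time interval the averages can be made to follow the target \<open>G j + \<sigma> w j\<close> with an arbitrarily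
  small error. It is essential that the distance \<open>\<rho>\<close> is chosen before \<open>\<sigma>\<close> and the errors. On a short interval around
  \<open>x\<close> a single round is used, made for the configuration and the target frozen at time \<open>x\<close>; errors of the
  form \<open>e (b - a)\<close> add up correctly when intervals are concatenated.
\<close>
lemma hub_steering:
  fixes \<xi> G :: "nat \<Rightarrow> real \<Rightarrow> complex"
  assumes "0 \<le> T" "N \<ge> 1"
    and \<xi>: "\<And>j. j \<in> {1..N} \<Longrightarrow> continuous_on {0..T} (\<xi> j)"
    and G: "\<And>j. j \<in> {1..N} \<Longrightarrow> continuous_on {0..T} (G j)"
    and M: "\<And>t j. t \<in> {0..T} \<Longrightarrow> j \<in> {1..N} \<Longrightarrow> cmod (G j t) \<le> M"
    and "D > 0"
    and sep: "\<And>t i j. t \<in> {0..T} \<Longrightarrow> i \<in> {1..N} \<Longrightarrow> j \<in> {1..N} \<Longrightarrow> j \<noteq> i \<Longrightarrow> D \<le> cmod (\<xi> j t - \<xi> i t)"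
    and hub: "\<And>t j. t \<in> {0..T} \<Longrightarrow> j \<in> {1..N} \<Longrightarrow> \<xi> j t \<noteq> P"
  shows "\<exists>\<rho>>0. \<forall>\<sigma> e \<eta>. continuous_on {0..T} \<sigma> \<longrightarrow> (\<forall>t\<in>{0..T}. \<sigma> t \<in> {0..1}) \<longrightarrow> 0 < e \<longrightarrow> 0 < \<eta> \<longrightarrow>
    (\<forall>a b. 0 \<le> a \<longrightarrow> a \<le> b \<longrightarrow> b \<le> T \<longrightarrow>
      (\<exists>Y B. control_family N {w. \<forall>i\<in>{1..N}. cmod (w i) \<le> 2} \<xi>
        (\<lambda>j w t. integral {0..t} (\<lambda>s. G j s + of_real (\<sigma> s) * w j)) \<rho> a b P P Y B (e * (b - a)) (e * (b - a) + \<eta>)))"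
proof -
  have "M \<ge> 0" using M[of 0 1] \<open>0 \<le> T\<close> \<open>N \<ge> 1\<close> order_trans[OF norm_ge_zero] by fastforce
  define K where "K = real N * (M + 2) + real N / D"
  \<comment> \<open>The loops are so small that the coefficients needed below are at most 1/4.\<close>
  define r where "r = min (D / 4) (1 / (4 * K))"
  have Npos: "real N > 0" using \<open>N \<ge> 1\<close> by simp
  have pos: "K > 0" using \<open>M \<ge> 0\<close> \<open>D > 0\<close> Npos by (simp add: K_def add_pos_pos)
  have r: "r > 0" "4 * r \<le> D" using \<open>D > 0\<close> pos by (auto simp: r_def)
  have "r \<le> 1 / (4 * K)" by (simp add: r_def)
  then have "r * K \<le> 1/4" using pos by (simp add: field_simps)
  then have rb: "r * (real N * (M + 2) + real N / D) \<le> 1/4" by (simp add: K_def)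
  have sep': "4 * r \<le> cmod (\<xi> j t - \<xi> i t)" if "t \<in> {0..T}" "i \<in> {1..N}" "j \<in> {1..N}" "j \<noteq> i" for t i j
    using sep[OF that] r by linarith
  obtain \<rho>0 where \<rho>0: "\<rho>0 > 0" "\<And>t i. t \<in> {0..T} \<Longrightarrow> i \<in> {1..N} \<Longrightarrow> \<exists>p :: real \<Rightarrow> complex. continuous_on {0..1} p \<and> p 0 = P \<and>
    p 1 = \<xi> i t + of_real r \<and> (\<forall>s\<in>{0..1}. \<forall>j\<in>{1..N}. \<rho>0 \<le> cmod (p s - \<xi> j t))"
    using uniform_transit[where \<xi> = \<xi> and N = N and P = P and r = r, OF \<open>0 \<le> T\<close> \<xi> r(1) sep' hub] by blast
  define \<rho>1 where "\<rho>1 = min \<rho>0 (r / 2)"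
  have \<rho>1: "0 < \<rho>1" "\<rho>1 \<le> r / 2" using \<rho>0 r by (auto simp: \<rho>1_def)
  have transit: "\<exists>p :: real \<Rightarrow> complex. continuous_on {0..1} p \<and> p 0 = P \<and>
    p 1 = \<xi> i t + of_real r \<and> (\<forall>s\<in>{0..1}. \<forall>j\<in>{1..N}. \<rho>1 \<le> cmod (p s - \<xi> j t))" if ti: "t \<in> {0..T}" "i \<in> {1..N}" for t i
  proof -
    obtain p :: "real \<Rightarrow> complex" where p: "continuous_on {0..1} p" "p 0 = P" "p 1 = \<xi> i t + of_real r"
      "\<forall>s\<in>{0..1}. \<forall>j\<in>{1..N}. \<rho>0 \<le> cmod (p s - \<xi> j t)" using \<rho>0(2)[OF ti] by blast
    have "\<rho>1 \<le> \<rho>0" by (simp add: \<rho>1_def)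
    then have "\<forall>s\<in>{0..1}. \<forall>j\<in>{1..N}. \<rho>1 \<le> cmod (p s - \<xi> j t)" using p(4) by (meson order_trans)
    with p show ?thesis by blast
  qed
  define W where "W = {w :: nat \<Rightarrow> complex. \<forall>i\<in>{1..N}. cmod (w i) \<le> 2}"
  show ?thesis
    unfolding W_def[symmetric]
  proof (intro exI[of _ "\<rho>1 / 2"] conjI allI impI)
    show "\<rho>1 / 2 > 0" using \<rho>1 by simp
    fix \<sigma> :: "real \<Rightarrow> real" and e \<eta> a0 b0 :: real
    assume \<sigma>: "continuous_on {0..T} \<sigma>" and \<sigma>01: "\<forall>t\<in>{0..T}. \<sigma> t \<in> {0..1}" and "0 < e" "0 < \<eta>"
      and ab: "0 \<le> a0" "a0 \<le> b0" "b0 \<le> T"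
    define H where "H = (\<lambda>j w s. G j s + of_real (\<sigma> s) * w j)"
    have cH: "continuous_on {0..T} (H j w)" if "j \<in> {1..N}" for j w
      unfolding H_def by (intro continuous_intros G that \<sigma>)
    define F where "F = (\<lambda>j w t. integral {0..t} (H j w))"
    have F: "F j w t - F j w a = integral {a..t} (H j w)" if "0 \<le> a" "a \<le> t" "t \<le> T" "j \<in> {1..N}" for j w a t
    proof -
      have "H j w integrable_on {0..t}"
        using that by (intro integrable_continuous_real continuous_on_subset[OF cH[OF that(4)]]) auto
      from Henstock_Kurzweil_Integration.integral_combine[OF that(1,2) this] show ?thesis
        by (simp add: F_def algebra_simps)
    qed
    have nH: "cmod (H j w s) \<le> M + 2" if "w \<in> W" "j \<in> {1..N}" "s \<in> {0..T}" for j w s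
    proof -
      have "cmod (of_real (\<sigma> s) * w j) \<le> 1 * 2"
        unfolding norm_mult using that \<sigma>01 by (intro mult_mono) (auto simp: W_def)
      then show ?thesis unfolding H_def using M[OF that(3,2)] norm_triangle_ineq[of "G j s" "of_real (\<sigma> s) * w j"] by linarith
    qed
    have "{a0..b0} \<subseteq> {0..T} \<longrightarrow> (\<exists>Y B. control_family N W \<xi> F (\<rho>1 / 2) a0 b0 P P Y B (e * (b0 - a0)) (e * (b0 - a0) + \<eta>))"
      using ab(2)
    proof (induction rule: Bolzano)
      case (trans a b c)
      show ?case
      proof
        assume sub: "{a..c} \<subseteq> {0..T}"
        then have "{a..b} \<subseteq> {0..T}" "{b..c} \<subseteq> {0..T}" using trans by auto
        then obtain Y B Y' B' where
          "control_family N W \<xi> F (\<rho>1 / 2) a b P P Y B (e * (b - a)) (e * (b - a) + \<eta>)"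
          "control_family N W \<xi> F (\<rho>1 / 2) b c P P Y' B' (e * (c - b)) (e * (c - b) + \<eta>)"
          using trans by blast
        from control_family_join[OF this] have
          "control_family N W \<xi> F (\<rho>1 / 2) a c P P (join b Y Y') (\<lambda>i. join b (B i) (B' i))
            (e * (b - a) + e * (c - b)) (max (e * (b - a) + \<eta>) (e * (b - a) + (e * (c - b) + \<eta>)))"
          using trans \<rho>1 continuous_on_subset[OF \<xi> sub] by auto
        moreover have "e * (b - a) \<le> e * (c - a)" using trans \<open>0 < e\<close> by simp
        ultimately have "control_family N W \<xi> F (\<rho>1 / 2) a c P P (join b Y Y') (\<lambda>i. join b (B i) (B' i))
            (e * (c - a)) (e * (c - a) + \<eta>)"
          by (elim control_family_mono) (auto simp: algebra_simps)
        then show "\<exists>Y B. control_family N W \<xi> F (\<rho>1 / 2) a c P P Y B (e * (c - a)) (e * (c - a) + \<eta>)" by blast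
      qed
    next
      case (local x)
      then have x: "x \<in> {0..T}" using ab by auto
      define c where "c = (\<lambda>j. \<xi> j x)"
      define \<kappa> where "\<kappa> = min (1/8) (e * \<rho>1 / 32)"
      have \<kappa>: "0 < \<kappa>" "\<kappa> \<le> 1/8" "8 * \<kappa> / \<rho>1 \<le> e / 4" using \<rho>1 \<open>0 < e\<close> by (auto simp: \<kappa>_def field_simps)
      obtain Y0 B0 where Y0: "continuous_on {0..1} Y0" "Y0 0 = P" "Y0 1 = P"
        and B0: "\<And>i. i \<in> {1..N} \<Longrightarrow> continuous_on {0..1} (B0 i) \<and> B0 i 0 = 0 \<and> B0 i 1 = 0"
        and YB0: "\<And>b j. \<forall>i\<in>{1..N}. cmod (b i) \<le> 1/4 \<Longrightarrow> j \<in> {1..N} \<Longrightarrow>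
          (\<forall>t\<in>{0..1}. \<rho>1 \<le> cmod (c j - ctrl N Y0 B0 b t)) \<and>
          cmod (integral {0..1} (\<lambda>s. 1 / (c j - ctrl N Y0 B0 b s))
            - (\<Sum>i\<in>{1..N}. if j = i then b i / of_real r else 1 / (c j - c i)) / of_nat N) \<le> 8 * \<kappa> / \<rho>1"
      proof (rule round_of_loops[where c = c and P = P and N = N, OF \<kappa>(1,2) \<rho>1 \<open>N \<ge> 1\<close>])
        show "4 * r \<le> cmod (c j - c i)" if "i \<in> {1..N}" "j \<in> {1..N}" "j \<noteq> i" for i j
          using sep'[OF x that] by (simp add: c_def)
        show "\<exists>p :: real \<Rightarrow> complex. continuous_on {0..1} p \<and> p 0 = P \<and> p 1 = c i + of_real r \<and>
          (\<forall>s\<in>{0..1}. \<forall>j\<in>{1..N}. \<rho>1 \<le> cmod (p s - c j))" if "i \<in> {1..N}" for i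
          using transit[OF x that] by (simp add: c_def)
        fix Y :: "real \<Rightarrow> complex" and B
        assume YB: "continuous_on {0..1} Y" "Y 0 = P" "Y 1 = P"
          "\<And>i. i \<in> {1..N} \<Longrightarrow> continuous_on {0..1} (B i) \<and> B i 0 = 0 \<and> B i 1 = 0"
          "\<And>b j. \<forall>i\<in>{1..N}. cmod (b i) \<le> 1/4 \<Longrightarrow> j \<in> {1..N} \<Longrightarrow>
            (\<forall>t\<in>{0..1}. \<rho>1 \<le> cmod (c j - ctrl N Y B b t)) \<and>
            cmod (integral {0..1} (\<lambda>s. 1 / (c j - ctrl N Y B b s))
              - (\<Sum>i\<in>{1..N}. if j = i then b i / of_real r else 1 / (c j - c i)) / of_nat N) \<le> 8 * \<kappa> / \<rho>1"
        show thesis by (rule that[of Y B]) (use YB in blast)+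
      qed
      define S where "S = (\<lambda>j. \<Sum>i\<in>{1..N} - {j}. 1 / (c j - c i))"
      \<comment> \<open>The solution of the equations for the averages, affine in \<open>w\<close>; the factor \<open>N\<close> compensates that each loop takes only the fraction \<open>1 / N\<close> of the round.\<close>
      define bb where "bb = (\<lambda>w j. of_real r * (of_nat N * H j w x - S j))"
      have bb: "cmod (bb w j) \<le> 1/4" if "w \<in> W" "j \<in> {1..N}" for w j
      proof -
        have "cmod (S j) \<le> (\<Sum>i\<in>{1..N} - {j}. 1 / D)"
          unfolding S_def
        proof (rule sum_norm_le)
          fix i assume "i \<in> {1..N} - {j}"
          then have "D \<le> cmod (c j - c i)" using sep[OF x, of i j] that by (auto simp: c_def)
          then show "cmod (1 / (c j - c i)) \<le> 1 / D" using \<open>D > 0\<close> by (simp add: norm_divide frac_le)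
        qed
        also have "\<dots> \<le> real N / D"
          using \<open>D > 0\<close> that by (simp add: divide_right_mono card_Diff_singleton)
        finally have "cmod (S j) \<le> real N / D" .
        moreover have "cmod (of_nat N * H j w x) \<le> real N * (M + 2)"
          unfolding norm_mult using nH[OF that x] by (simp add: mult_left_mono)
        ultimately have "cmod (of_nat N * H j w x - S j) \<le> real N * (M + 2) + real N / D"
          using norm_triangle_ineq4[of "of_nat N * H j w x" "S j"] by linarith
        then have "cmod (bb w j) \<le> r * (real N * (M + 2) + real N / D)"
          unfolding bb_def norm_mult using r by simp
        then show ?thesis using rb by linarith
      qed
      have avg: "(\<Sum>i\<in>{1..N}. if j = i then bb w i / of_real r else 1 / (c j - c i)) / of_nat N = H j w x"
        if "j \<in> {1..N}" for w j
      proof -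
        have "(\<Sum>i\<in>{1..N}. if j = i then bb w i / of_real r else 1 / (c j - c i))
            = bb w j / of_real r + (\<Sum>i\<in>{1..N} - {j}. if j = i then bb w i / of_real r else 1 / (c j - c i))"
          using that by (subst sum.remove[of _ j]) auto
        also have "(\<Sum>i\<in>{1..N} - {j}. if j = i then bb w i / of_real r else 1 / (c j - c i)) = S j"
          unfolding S_def by (intro sum.cong) auto
        finally show ?thesis using r Npos by (simp add: bb_def)
      qed
      define \<mu> where "\<mu> = min (\<rho>1 / 2) (e * \<rho>1\<^sup>2 / 8)"
      have \<mu>: "\<mu> > 0" "\<mu> \<le> \<rho>1 / 2" "\<mu> / (\<rho>1 / 2 * \<rho>1) \<le> e / 4"
        using \<rho>1 \<open>0 < e\<close> by (auto simp: \<mu>_def field_simps power2_eq_square)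
      define C where "C = 2 / \<rho>1 + (M + 2)"
      have C: "C > 0" using \<rho>1 \<open>M \<ge> 0\<close> by (simp add: C_def add_pos_pos)
      obtain d1 where d1: "d1 > 0" "\<And>j t. j \<in> {1..N} \<Longrightarrow> t \<in> {0..T} \<Longrightarrow> \<bar>t - x\<bar> < d1 \<Longrightarrow> cmod (\<xi> j t - \<xi> j x) < \<mu>"
        using finite_near[where A = "{1..N}" and f = \<xi>, OF _ \<xi> x \<mu>(1)] by auto
      obtain d2 where d2: "d2 > 0" "\<And>j t. j \<in> {1..N} \<Longrightarrow> t \<in> {0..T} \<Longrightarrow> \<bar>t - x\<bar> < d2 \<Longrightarrow> cmod (G j t - G j x) < e / 4"
        using finite_near[where A = "{1..N}" and f = G, OF _ G x, of "e / 4"] \<open>0 < e\<close> by auto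
      obtain d3 where d3: "d3 > 0" "\<And>t. t \<in> {0..T} \<Longrightarrow> \<bar>t - x\<bar> < d3 \<Longrightarrow> \<bar>\<sigma> t - \<sigma> x\<bar> < e / 8"
        using \<sigma> x \<open>0 < e\<close> unfolding continuous_on_iff dist_real_def
        by (metis divide_pos_pos zero_less_numeral)
      define d where "d = min (min d1 d2) (min d3 (\<eta> / C))"
      have d: "d > 0" "d \<le> d1" "d \<le> d2" "d \<le> d3" "d \<le> \<eta> / C"
        using d1 d2 d3 C \<open>0 < \<eta>\<close> by (auto simp: d_def)
      show ?case
      proof (intro exI[of _ d] conjI allI impI)
        show "d > 0" by fact
        fix a b assume abx: "a \<le> x \<and> x \<le> b \<and> b - a < d" and sub: "{a..b} \<subseteq> {0..T}"
        have near: "t \<in> {0..T}" "\<bar>t - x\<bar> < d" if "t \<in> {a..b}" for t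
          using that abx sub by auto
        have a0: "0 \<le> a" "b \<le> T" using sub abx by auto
        show "\<exists>Y B. control_family N W \<xi> F (\<rho>1 / 2) a b P P Y B (e * (b - a)) (e * (b - a) + \<eta>)"
        proof (cases "a = b")
          case True
          have "\<rho>1 / 2 \<le> cmod (\<xi> j x - P)" if j: "j \<in> {1..N}" for j
          proof -
            obtain p where "p 0 = P" "\<forall>s\<in>{0..1::real}. \<forall>j\<in>{1..N}. \<rho>1 \<le> cmod (p s - \<xi> j x)"
              using transit[OF x j] by blast
            then have "\<rho>1 \<le> cmod (p 0 - \<xi> j x)" using j by force
            then show ?thesis using \<open>p 0 = P\<close> \<rho>1 by (simp add: norm_minus_commute)
          qed
          moreover have "a = x" "b = x" using True abx by auto
          ultimately have "control_family N W \<xi> F (\<rho>1 / 2) a b P P (\<lambda>_. P) (\<lambda>_ _. 0) (e * (b - a)) (e * (b - a) + \<eta>)"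
            using \<open>0 < \<eta>\<close> by (auto simp: control_family_def ctrl_def)
          then show ?thesis by blast
        next
          case False
          then have "a < b" using abx by auto
          define \<tau> where "\<tau> = (\<lambda>t. (t - a) / (b - a))"
          have \<tau>: "\<tau> t \<in> {0..1}" if "t \<in> {a..b}" for t using that \<open>a < b\<close> by (auto simp: \<tau>_def)
          have c\<tau>: "continuous_on {a..b} \<tau>" unfolding \<tau>_def using \<open>a < b\<close> by (intro continuous_intros) auto
          have \<tau>ab: "\<tau> a = 0" "\<tau> b = 1" using \<open>a < b\<close> by (auto simp: \<tau>_def)
          define Y where "Y = (\<lambda>t. Y0 (\<tau> t) + (\<Sum>i\<in>{1..N}. of_real r * (of_nat N * G i x - S i) * B0 i (\<tau> t)))"
          define B where "B = (\<lambda>i t. of_real r * of_nat N * of_real (\<sigma> x) * B0 i (\<tau> t))"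
          have ct: "ctrl N Y B w t = ctrl N Y0 B0 (bb w) (\<tau> t)" for w t
          proof -
            have "ctrl N Y B w t = Y0 (\<tau> t) + (\<Sum>i\<in>{1..N}. of_real r * (of_nat N * G i x - S i) * B0 i (\<tau> t)
               + w i * (of_real r * of_nat N * of_real (\<sigma> x) * B0 i (\<tau> t)))"
              by (simp add: ctrl_def Y_def B_def sum.distrib)
            also have "\<dots> = ctrl N Y0 B0 (bb w) (\<tau> t)"
              unfolding ctrl_def by (intro arg_cong2[of _ _ _ _ "(+)"] sum.cong) (auto simp: bb_def H_def algebra_simps)
            finally show ?thesis .
          qed
          have cB0: "continuous_on {a..b} (\<lambda>t. B0 i (\<tau> t))" if "i \<in> {1..N}" for i
            using B0[OF that] \<tau> by (intro continuous_on_compose2[OF _ c\<tau>, of "{0..1}" "B0 i"]) auto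
          have cY: "continuous_on {a..b} Y"
            unfolding Y_def using \<tau> by (intro continuous_intros cB0 continuous_on_compose2[OF Y0(1) c\<tau>]) auto
          have cB: "continuous_on {a..b} (B i)" if "i \<in> {1..N}" for i
            unfolding B_def by (intro continuous_intros cB0 that)
          have est: "(\<forall>t\<in>{a..b}. \<rho>1 / 2 \<le> cmod (\<xi> j t - ctrl N Y B w t) \<and>
              cmod (integral {a..t} (\<lambda>s. 1 / (\<xi> j s - ctrl N Y B w s)) - (F j w t - F j w a)) \<le> e * (b - a) + \<eta>) \<and>
              cmod (integral {a..b} (\<lambda>s. 1 / (\<xi> j s - ctrl N Y B w s)) - (F j w b - F j w a)) \<le> e * (b - a)"
            if w: "w \<in> W" and j: "j \<in> {1..N}" for w j
          proof -
            let ?y = "ctrl N Y B w"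
            have bbw: "\<forall>i\<in>{1..N}. cmod (bb w i) \<le> 1/4" using bb[OF w] by blast
            note L = YB0[OF bbw j, unfolded avg[OF j]]
            have dc: "\<rho>1 \<le> cmod (c j - ?y t)" if "t \<in> {a..b}" for t using L \<tau>[OF that] ct by auto
            have dx: "\<rho>1 / 2 \<le> cmod (\<xi> j t - ?y t)" if "t \<in> {a..b}" for t
            proof -
              have "c j - ?y t = (\<xi> j t - ?y t) - (\<xi> j t - \<xi> j x)" by (simp add: c_def)
              then have "cmod (c j - ?y t) \<le> cmod (\<xi> j t - ?y t) + cmod (\<xi> j t - \<xi> j x)"
                by (metis norm_triangle_ineq4)
              moreover have "cmod (\<xi> j t - \<xi> j x) < \<mu>" using d1(2)[OF j] near[OF that] d by auto
              ultimately show ?thesis using dc[OF that] \<mu> by linarith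
            qed
            have cy: "continuous_on {a..b} ?y" by (intro continuous_on_ctrl cY cB)
            have c\<xi>: "continuous_on {a..b} (\<xi> j)" using \<xi>[OF j] sub by (rule continuous_on_subset)
            have cHj: "continuous_on {a..b} (H j w)" using cH[OF j] sub by (rule continuous_on_subset)
            have nzc: "c j - ?y t \<noteq> 0" "\<xi> j t - ?y t \<noteq> 0" if "t \<in> {a..b}" for t
              using dc[OF that] dx[OF that] \<rho>1 by auto
            have c1: "continuous_on {a..b} (\<lambda>s. 1 / (\<xi> j s - ?y s))"
              and c2: "continuous_on {a..b} (\<lambda>s. 1 / (c j - ?y s))"
              using nzc by (auto intro!: continuous_intros cy c\<xi>)
            have intg: "f integrable_on {a..t}" if "continuous_on {a..b} f" "t \<in> {a..b}" for f :: "real \<Rightarrow> complex" and t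
              using that by (intro integrable_continuous_real continuous_on_subset[OF that(1)]) auto
            have diff: "integral {a..t} (\<lambda>s. 1 / (\<xi> j s - ?y s)) - (F j w t - F j w a)
                = integral {a..t} (\<lambda>s. 1 / (\<xi> j s - ?y s) - H j w s)" if t: "t \<in> {a..b}" for t
              using F[of a t j w] t a0 j intg[OF c1 t] intg[OF cHj t] by (simp add: integral_diff)
            have part: "cmod (integral {a..t} (\<lambda>s. 1 / (\<xi> j s - ?y s) - H j w s)) \<le> e * (b - a) + \<eta>"
              if t: "t \<in> {a..b}" for t
            proof -
              have "cmod (integral {a..t} (\<lambda>s. 1 / (\<xi> j s - ?y s) - H j w s)) \<le> C * (t - a)"
              proof (rule integral_bound)
                show "a \<le> t" using t by simp
                show "continuous_on {a..t} (\<lambda>s. 1 / (\<xi> j s - ?y s) - H j w s)"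
                  using t by (intro continuous_on_subset[OF continuous_on_diff[OF c1 cHj]]) auto
                fix s assume "s \<in> {a..t}"
                then have s: "s \<in> {a..b}" using t by auto
                have "cmod (1 / (\<xi> j s - ?y s)) \<le> 1 / (\<rho>1 / 2)"
                  unfolding norm_divide norm_one using dx[OF s] \<rho>1 by (intro frac_le) auto
                then show "cmod (1 / (\<xi> j s - ?y s) - H j w s) \<le> C"
                  using nH[OF w j near(1)[OF s]] norm_triangle_ineq4[of "1 / (\<xi> j s - ?y s)" "H j w s"]
                  by (simp add: C_def)
              qed
              also have "\<dots> \<le> C * d" using t abx C by (intro mult_left_mono) auto
              also have "\<dots> \<le> \<eta>" using d(5) C by (simp add: field_simps)
              finally have "cmod (integral {a..t} (\<lambda>s. 1 / (\<xi> j s - ?y s) - H j w s)) \<le> \<eta>" .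
              moreover have "0 < e * (b - a)" using \<open>a < b\<close> \<open>0 < e\<close> by simp
              ultimately show ?thesis by linarith
            qed
            have "((\<lambda>s. 1 / (c j - ctrl N Y0 B0 (bb w) s)) has_integral
                integral {0..1} (\<lambda>s. 1 / (c j - ctrl N Y0 B0 (bb w) s))) {0..1}"
            proof (intro integrable_integral integrable_continuous_real continuous_intros continuous_on_ctrl Y0)
              show "\<And>i. i \<in> {1..N} \<Longrightarrow> continuous_on {0..1} (B0 i)" using B0 by blast
              show "\<forall>s\<in>{0..1}. c j - ctrl N Y0 B0 (bb w) s \<noteq> 0"
                using L \<rho>1 by force
            qed
            from has_integral_rescale[OF this, of "b - a" a]
            have I2: "integral {a..b} (\<lambda>s. 1 / (c j - ?y s))
                = (b - a) *\<^sub>R integral {0..1} (\<lambda>s. 1 / (c j - ctrl N Y0 B0 (bb w) s))"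
              using \<open>a < b\<close> by (intro integral_unique) (simp add: ct \<tau>_def)
            have bab: "b \<in> {a..b}" using \<open>a < b\<close> by simp
            have small: "cmod (1 / (\<xi> j s - ?y s) - 1 / (c j - ?y s) - (H j w s - H j w x)) \<le> 3/4 * e"
              if s: "s \<in> {a..b}" for s
            proof -
              have ns: "s \<in> {0..T}" "\<bar>s - x\<bar> < d1" "\<bar>s - x\<bar> < d2" "\<bar>s - x\<bar> < d3" using near[OF s] d by auto
              have "1 / (\<xi> j s - ?y s) - 1 / (c j - ?y s) = - (\<xi> j s - \<xi> j x) / ((\<xi> j s - ?y s) * (c j - ?y s))"
                using nzc[OF s] by (simp add: divide_simps c_def)
              also have "cmod \<dots> \<le> \<mu> / (\<rho>1 / 2 * \<rho>1)"
                unfolding norm_divide norm_mult norm_minus_cancel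
                using d1(2)[OF j ns(1,2)] dx[OF s] dc[OF s] \<rho>1 \<mu> by (intro frac_le mult_mono mult_pos_pos) auto
              finally have 1: "cmod (1 / (\<xi> j s - ?y s) - 1 / (c j - ?y s)) \<le> e / 4" using \<mu> by linarith
              have "H j w s - H j w x = (G j s - G j x) + of_real (\<sigma> s - \<sigma> x) * w j"
                by (simp add: H_def algebra_simps)
              also have "cmod \<dots> \<le> cmod (G j s - G j x) + cmod (of_real (\<sigma> s - \<sigma> x) * w j)"
                by (rule norm_triangle_ineq)
              also have "cmod (of_real (\<sigma> s - \<sigma> x) * w j) \<le> e / 8 * 2"
                unfolding norm_mult norm_of_real using d3(2)[OF ns(1,4)] w j \<open>0 < e\<close>
                by (intro mult_mono) (auto simp: W_def)
              finally have "cmod (H j w s - H j w x) \<le> e / 2" using d2(2)[OF j ns(1,3)] by simp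
              then show ?thesis
                using 1 norm_triangle_ineq4[of "1 / (\<xi> j s - ?y s) - 1 / (c j - ?y s)" "H j w s - H j w x"]
                by linarith
            qed
            have "integral {a..b} (\<lambda>s. 1 / (\<xi> j s - ?y s) - H j w s)
              = integral {a..b} (\<lambda>s. (1 / (\<xi> j s - ?y s) - 1 / (c j - ?y s) - (H j w s - H j w x))
                  + (1 / (c j - ?y s) - H j w x))"
              by simp
            also have "\<dots> = integral {a..b} (\<lambda>s. 1 / (\<xi> j s - ?y s) - 1 / (c j - ?y s) - (H j w s - H j w x))
                + integral {a..b} (\<lambda>s. 1 / (c j - ?y s) - H j w x)"
              by (intro integral_add integrable_continuous_real continuous_intros c1 c2 cHj
                  continuous_on_diff[OF c1 c2])
            also have "cmod \<dots> \<le> 3/4 * e * (b - a) + e / 4 * (b - a)"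
            proof (rule norm_triangle_mono)
              show "cmod (integral {a..b} (\<lambda>s. 1 / (\<xi> j s - ?y s) - 1 / (c j - ?y s) - (H j w s - H j w x)))
                  \<le> 3/4 * e * (b - a)"
                using small \<open>a < b\<close>
                by (intro integral_bound continuous_on_diff[OF continuous_on_diff[OF c1 c2]] continuous_intros cHj) auto
              have "integral {a..b} (\<lambda>s. 1 / (c j - ?y s) - H j w x)
                  = integral {a..b} (\<lambda>s. 1 / (c j - ?y s)) - (b - a) *\<^sub>R H j w x"
                using intg[OF c2 bab] \<open>a < b\<close> by (subst integral_diff) auto
              also have "\<dots> = (b - a) *\<^sub>R (integral {0..1} (\<lambda>s. 1 / (c j - ctrl N Y0 B0 (bb w) s)) - H j w x)"
                by (simp add: I2 scaleR_diff_right)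
              also have "cmod \<dots> \<le> (b - a) * (e / 4)"
                unfolding norm_scaleR using L \<kappa>(3) \<open>a < b\<close> by (intro mult_mono) auto
              finally show "cmod (integral {a..b} (\<lambda>s. 1 / (c j - ?y s) - H j w x)) \<le> e / 4 * (b - a)"
                by (simp add: mult.commute)
            qed
            also have "\<dots> = e * (b - a)" by (simp add: field_simps)
            finally have "cmod (integral {a..b} (\<lambda>s. 1 / (\<xi> j s - ?y s) - H j w s)) \<le> e * (b - a)" .
            then show ?thesis using dx part diff bab by simp
          qed
          have "control_family N W \<xi> F (\<rho>1 / 2) a b P P Y B (e * (b - a)) (e * (b - a) + \<eta>)"
            unfolding control_family_def
          proof (intro conjI)
            show "continuous_on {a..b} Y" by fact
            show "Y a = P" "Y b = P" using Y0 B0 by (auto simp: Y_def \<tau>ab)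
            show "\<forall>i\<in>{1..N}. continuous_on {a..b} (B i) \<and> B i a = 0 \<and> B i b = 0"
              using cB B0 by (auto simp: B_def \<tau>ab)
          qed (use est in blast)
          then show ?thesis by blast
        qed
      qed
    qed
    then show "\<exists>Y B. control_family N W \<xi> (\<lambda>j w t. integral {0..t} (\<lambda>s. G j s + of_real (\<sigma> s) * w j)) (\<rho>1 / 2) a0 b0 P P Y B
        (e * (b0 - a0)) (e * (b0 - a0) + \<eta>)"
      using ab by (simp add: F_def H_def atLeastatMost_subset_iff)
  qed
qed

lemma finite_continuous_bounded:
  fixes f :: "'b \<Rightarrow> real \<Rightarrow> complex"
  assumes "finite A" "\<And>j. j \<in> A \<Longrightarrow> continuous_on {a..b} (f j)"
  obtains M where "M > 0" "\<And>j t. j \<in> A \<Longrightarrow> t \<in> {a..b} \<Longrightarrow> cmod (f j t) \<le> M"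
proof -
  have "\<exists>e>0. \<forall>j\<in>A. \<forall>t\<in>{a..b}. cmod (f j t) \<le> 1 / e"
  proof (rule finite_uniform_pos[OF \<open>finite A\<close>])
    fix j assume "j \<in> A"
    then have "bounded (f j ` {a..b})"
      using assms(2) by (intro compact_imp_bounded compact_continuous_image) auto
    then obtain M where "M > 0" "\<forall>x\<in>f j ` {a..b}. cmod x \<le> M" by (auto simp: bounded_pos)
    then show "\<exists>e>0. \<forall>t\<in>{a..b}. cmod (f j t) \<le> 1 / e" by (intro exI[of _ "1 / M"]) auto
  next
    fix j and e e' :: real assume h: "\<forall>t\<in>{a..b}. cmod (f j t) \<le> 1 / e" "0 < e'" "e' \<le> e"
    then have "1 / e \<le> 1 / e'" by (intro divide_left_mono) auto
    with h show "\<forall>t\<in>{a..b}. cmod (f j t) \<le> 1 / e'" by force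
  qed
  then obtain e where "e > 0" "\<forall>j\<in>A. \<forall>t\<in>{a..b}. cmod (f j t) \<le> 1 / e" by blast
  then show ?thesis by (intro that[of "1 / e"]) auto
qed

lemma finite_continuous_bounded_below:
  fixes f :: "'b \<Rightarrow> real \<Rightarrow> complex"
  assumes "finite A" "\<And>j. j \<in> A \<Longrightarrow> continuous_on {a..b} (f j)"
    and nz: "\<And>j t. j \<in> A \<Longrightarrow> t \<in> {a..b} \<Longrightarrow> f j t \<noteq> 0"
  obtains D where "D > 0" "\<And>j t. j \<in> A \<Longrightarrow> t \<in> {a..b} \<Longrightarrow> D \<le> cmod (f j t)"
proof -
  obtain M where M: "M > 0" "\<And>j t. j \<in> A \<Longrightarrow> t \<in> {a..b} \<Longrightarrow> cmod (inverse (f j t)) \<le> M"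
    using finite_continuous_bounded[where f = "\<lambda>j t. inverse (f j t)" and a = a and b = b, OF \<open>finite A\<close>]
      continuous_on_inverse assms(2) nz by metis
  show ?thesis
  proof (rule that[of "1 / M"])
    fix j t assume "j \<in> A" "t \<in> {a..b}"
    then have "inverse (cmod (f j t)) \<le> M" "cmod (f j t) > 0"
      using M(2)[of j t] nz[of j t] by (simp_all add: norm_inverse)
    then show "1 / M \<le> cmod (f j t)" using M(1) by (simp add: field_simps)
  qed (use M in simp)
qed

lemma uniformly_separated:
  fixes \<xi> :: "nat \<Rightarrow> real \<Rightarrow> complex"
  assumes \<xi>: "\<And>j. j \<in> {1..N} \<Longrightarrow> continuous_on {a..b} (\<xi> j)"
    and sep: "\<And>t i j. t \<in> {a..b} \<Longrightarrow> i \<in> {1..N} \<Longrightarrow> j \<in> {1..N} \<Longrightarrow> j \<noteq> i \<Longrightarrow> \<xi> j t \<noteq> \<xi> i t"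
  shows "\<exists>D>0. \<forall>t\<in>{a..b}. \<forall>i\<in>{1..N}. \<forall>j\<in>{1..N}. j \<noteq> i \<longrightarrow> D \<le> cmod (\<xi> j t - \<xi> i t)"
proof -
  define A where "A = {(i, j). i \<in> {1..N} \<and> j \<in> {1..N} \<and> j \<noteq> i}"
  have "finite A" by (rule finite_subset[of _ "{1..N} \<times> {1..N}"]) (auto simp: A_def)
  moreover have "continuous_on {a..b} (\<lambda>t. \<xi> (snd p) t - \<xi> (fst p) t)" if "p \<in> A" for p
    using that by (intro continuous_intros \<xi>) (auto simp: A_def)
  moreover have "\<xi> (snd p) t - \<xi> (fst p) t \<noteq> 0" if "p \<in> A" "t \<in> {a..b}" for p t
    using sep[OF that(2), of "fst p" "snd p"] that by (auto simp: A_def)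
  ultimately obtain D where D: "D > 0" "\<And>p t. p \<in> A \<Longrightarrow> t \<in> {a..b} \<Longrightarrow> D \<le> cmod (\<xi> (snd p) t - \<xi> (fst p) t)"
    using finite_continuous_bounded_below[of A a b "\<lambda>p t. \<xi> (snd p) t - \<xi> (fst p) t"] by blast
  have "D \<le> cmod (\<xi> j t - \<xi> i t)" if "t \<in> {a..b}" "i \<in> {1..N}" "j \<in> {1..N}" "j \<noteq> i" for t i j
    using D(2)[of "(i, j)" t] that by (simp add: A_def)
  with D(1) show ?thesis by blast
qed

text \<open>A curve without parameters, on an interval so short that nothing needs to be averaged.\<close>
lemma control_family_single:
  assumes "a \<le> b" "\<rho> > 0" and q: "continuous_on {a..b} q"
    and \<xi>: "\<And>j. j \<in> {1..N} \<Longrightarrow> continuous_on {a..b} (\<xi> j)"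
    and far: "\<And>j t. j \<in> {1..N} \<Longrightarrow> t \<in> {a..b} \<Longrightarrow> \<rho> \<le> cmod (\<xi> j t - q t)"
    and F: "\<And>w j t. w \<in> W \<Longrightarrow> j \<in> {1..N} \<Longrightarrow> t \<in> {a..b} \<Longrightarrow> cmod (F j w t - F j w a) \<le> K * (t - a)"
    and "K \<ge> 0"
  shows "control_family N W \<xi> F \<rho> a b (q a) (q b) q (\<lambda>_ _. 0) ((1 / \<rho> + K) * (b - a)) ((1 / \<rho> + K) * (b - a))"
proof -
  have "cmod (integral {a..t} (\<lambda>s. 1 / (\<xi> j s - q s)) - (F j w t - F j w a)) \<le> (1 / \<rho> + K) * (b - a)"
    if w: "w \<in> W" and j: "j \<in> {1..N}" and t: "t \<in> {a..b}" for w j t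
  proof -
    have nz: "\<xi> j s - q s \<noteq> 0" if "s \<in> {a..b}" for s using far[OF j that] \<open>\<rho> > 0\<close> by auto
    have "continuous_on {a..b} (\<lambda>s. 1 / (\<xi> j s - q s))"
      using nz by (intro continuous_intros \<xi> j q) auto
    then have "continuous_on {a..t} (\<lambda>s. 1 / (\<xi> j s - q s))"
      by (rule continuous_on_subset) (use t in auto)
    then have "cmod (integral {a..t} (\<lambda>s. 1 / (\<xi> j s - q s))) \<le> (1 / \<rho>) * (t - a)"
      using t far[OF j] \<open>\<rho> > 0\<close> by (intro integral_bound) (auto simp: norm_divide intro!: frac_le)
    then have "cmod (integral {a..t} (\<lambda>s. 1 / (\<xi> j s - q s)) - (F j w t - F j w a)) \<le> (1 / \<rho>) * (t - a) + K * (t - a)"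
      using F[OF w j t] norm_triangle_ineq4[of "integral {a..t} (\<lambda>s. 1 / (\<xi> j s - q s))" "F j w t - F j w a"]
      by linarith
    also have "\<dots> = (1 / \<rho> + K) * (t - a)" by (simp add: algebra_simps)
    also have "\<dots> \<le> (1 / \<rho> + K) * (b - a)" using t \<open>\<rho> > 0\<close> \<open>K \<ge> 0\<close> by (intro mult_left_mono) auto
    finally show ?thesis .
  qed
  then show ?thesis
    using q far \<open>a \<le> b\<close> by (simp add: control_family_def ctrl_def)
qed

text \<open>
  The previous result with arbitrary end points \<open>y0\<close> and \<open>yf\<close>: the controlled vortex first goes to the hub, and
  at the end it leaves the hub, within a short time \<open>\<tau>\<close> each.
\<close>
lemma steering:
  fixes \<xi> G :: "nat \<Rightarrow> real \<Rightarrow> complex"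
  assumes "0 < T" "N \<ge> 1"
    and \<xi>: "\<And>j. j \<in> {1..N} \<Longrightarrow> continuous_on {0..T} (\<xi> j)"
    and G: "\<And>j. j \<in> {1..N} \<Longrightarrow> continuous_on {0..T} (G j)"
    and sep: "\<And>t i j. t \<in> {0..T} \<Longrightarrow> i \<in> {1..N} \<Longrightarrow> j \<in> {1..N} \<Longrightarrow> j \<noteq> i \<Longrightarrow> \<xi> j t \<noteq> \<xi> i t"
    and y0: "\<And>j. j \<in> {1..N} \<Longrightarrow> \<xi> j 0 \<noteq> y0"
    and yf: "\<And>j. j \<in> {1..N} \<Longrightarrow> \<xi> j T \<noteq> yf"
  shows "\<exists>\<rho>>0. \<forall>\<sigma> \<epsilon>. continuous_on {0..T} \<sigma> \<longrightarrow> (\<forall>t\<in>{0..T}. \<sigma> t \<in> {0..1}) \<longrightarrow> 0 < \<epsilon> \<longrightarrow>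
      (\<exists>Y B. control_family N {w. \<forall>i\<in>{1..N}. cmod (w i) \<le> 2} \<xi>
        (\<lambda>j w t. integral {0..t} (\<lambda>s. G j s + of_real (\<sigma> s) * w j)) \<rho> 0 T y0 yf Y B \<epsilon> \<epsilon>)"
proof -
  obtain M where M: "M > 0" "\<And>j t. j \<in> {1..N} \<Longrightarrow> t \<in> {0..T} \<Longrightarrow> cmod (G j t) \<le> M"
    using finite_continuous_bounded[of "{1..N}" 0 T G] G by auto
  obtain R where R: "R > 0" "\<And>j t. j \<in> {1..N} \<Longrightarrow> t \<in> {0..T} \<Longrightarrow> cmod (\<xi> j t) \<le> R"
    using finite_continuous_bounded[of "{1..N}" 0 T \<xi>] \<xi> by auto
  define P where "P = complex_of_real (R + 1)"
  have hub: "\<xi> j t \<noteq> P" if "t \<in> {0..T}" "j \<in> {1..N}" for t j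
    using R(2)[OF that(2,1)] R(1) by (auto simp: P_def)
  obtain D where D: "D > 0" "\<forall>t\<in>{0..T}. \<forall>i\<in>{1..N}. \<forall>j\<in>{1..N}. j \<noteq> i \<longrightarrow> D \<le> cmod (\<xi> j t - \<xi> i t)"
  proof -
    have "\<exists>D>0. \<forall>t\<in>{0..T}. \<forall>i\<in>{1..N}. \<forall>j\<in>{1..N}. j \<noteq> i \<longrightarrow> D \<le> cmod (\<xi> j t - \<xi> i t)"
      by (rule uniformly_separated[OF \<xi> sep])
    then show thesis using that by blast
  qed
  then have sepD: "D \<le> cmod (\<xi> j t - \<xi> i t)" if "t \<in> {0..T}" "i \<in> {1..N}" "j \<in> {1..N}" "j \<noteq> i" for t i j
    using that by blast
  define W where "W = {w :: nat \<Rightarrow> complex. \<forall>i\<in>{1..N}. cmod (w i) \<le> 2}"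
  define F where "F = (\<lambda>\<sigma> j w t. integral {0..t} (\<lambda>s. G j s + of_real (\<sigma> s) * w j))"
  have "\<exists>\<rho>>0. \<forall>\<sigma> e \<eta>. continuous_on {0..T} \<sigma> \<longrightarrow> (\<forall>t\<in>{0..T}. \<sigma> t \<in> {0..1}) \<longrightarrow> 0 < e \<longrightarrow> 0 < \<eta> \<longrightarrow>
    (\<forall>a b. 0 \<le> a \<longrightarrow> a \<le> b \<longrightarrow> b \<le> T \<longrightarrow>
      (\<exists>Y B. control_family N W \<xi> (F \<sigma>) \<rho> a b P P Y B (e * (b - a)) (e * (b - a) + \<eta>)))"
    unfolding F_def W_def
    by (rule hub_steering[where \<xi> = \<xi> and G = G and N = N and T = T and P = P and M = M and D = D,
      OF less_imp_le[OF \<open>0 < T\<close>] \<open>N \<ge> 1\<close> \<xi> G M(2) D(1) sepD hub])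
  then obtain \<rho>1 where \<rho>1: "\<rho>1 > 0" and "\<forall>\<sigma> e \<eta>. continuous_on {0..T} \<sigma> \<longrightarrow> (\<forall>t\<in>{0..T}. \<sigma> t \<in> {0..1}) \<longrightarrow> 0 < e \<longrightarrow> 0 < \<eta> \<longrightarrow>
    (\<forall>a b. 0 \<le> a \<longrightarrow> a \<le> b \<longrightarrow> b \<le> T \<longrightarrow>
      (\<exists>Y B. control_family N W \<xi> (F \<sigma>) \<rho>1 a b P P Y B (e * (b - a)) (e * (b - a) + \<eta>)))"
    by (elim exE conjE)
  note mid = this(2)[rule_format]
  have T: "0 \<in> {0..T}" "T \<in> {0..T}" using \<open>0 < T\<close> by auto
  obtain \<rho>2 :: "real" and q0 :: "real \<Rightarrow> complex" where q0: "\<rho>2 > 0" "continuous_on {0..1} q0" "q0 0 = y0" "q0 1 = P"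
    "\<And>s j. s \<in> {0..1} \<Longrightarrow> j \<in> {1..N} \<Longrightarrow> \<rho>2 \<le> cmod (q0 s - \<xi> j 0)"
  proof -
    have "y0 \<notin> (\<lambda>j. \<xi> j 0) ` {1..N}" "P \<notin> (\<lambda>j. \<xi> j 0) ` {1..N}" using y0 hub[OF T(1)] by (metis imageE)+
    from path_avoiding_finite[OF finite_imageI[OF finite_atLeastAtMost] this] show thesis using that by blast
  qed
  obtain \<rho>3 :: "real" and qf :: "real \<Rightarrow> complex" where qf: "\<rho>3 > 0" "continuous_on {0..1} qf" "qf 0 = P" "qf 1 = yf"
    "\<And>s j. s \<in> {0..1} \<Longrightarrow> j \<in> {1..N} \<Longrightarrow> \<rho>3 \<le> cmod (qf s - \<xi> j T)"
  proof -
    have "yf \<notin> (\<lambda>j. \<xi> j T) ` {1..N}" "P \<notin> (\<lambda>j. \<xi> j T) ` {1..N}" using yf hub[OF T(2)] by (metis imageE)+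
    from path_avoiding_finite[OF finite_imageI[OF finite_atLeastAtMost] this(2,1)] show thesis using that by blast
  qed
  define \<rho> where "\<rho> = min \<rho>1 (min (\<rho>2 / 2) (\<rho>3 / 2))"
  have \<rho>: "\<rho> > 0" "\<rho> \<le> \<rho>1" "\<rho> \<le> \<rho>2 / 2" "\<rho> \<le> \<rho>3 / 2" using \<rho>1 q0 qf by (auto simp: \<rho>_def)
  obtain d0 where d0: "d0 > 0" "\<And>j t. j \<in> {1..N} \<Longrightarrow> t \<in> {0..T} \<Longrightarrow> \<bar>t - 0\<bar> < d0 \<Longrightarrow> cmod (\<xi> j t - \<xi> j 0) < \<rho>"
    using finite_near[where A = "{1..N}" and f = \<xi>, OF _ \<xi> T(1) \<rho>(1)] by auto
  obtain d1 where d1: "d1 > 0" "\<And>j t. j \<in> {1..N} \<Longrightarrow> t \<in> {0..T} \<Longrightarrow> \<bar>t - T\<bar> < d1 \<Longrightarrow> cmod (\<xi> j t - \<xi> j T) < \<rho>"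
    using finite_near[where A = "{1..N}" and f = \<xi>, OF _ \<xi> T(2) \<rho>(1)] by auto
  define C where "C = 1 / \<rho> + (M + 2)"
  have C: "C > 0" using \<rho> M by (simp add: C_def add_pos_pos)
  show ?thesis
    unfolding W_def[symmetric]
  proof (intro exI[of _ \<rho>] conjI allI impI)
    show "\<rho> > 0" by (fact \<rho>(1))
    fix \<sigma> :: "real \<Rightarrow> real" and \<epsilon> :: real
    assume \<sigma>: "continuous_on {0..T} \<sigma>" "\<forall>t\<in>{0..T}. \<sigma> t \<in> {0..1}" and "0 < \<epsilon>"
    define \<tau> where "\<tau> = min (T / 3) (min (min (d0 / 2) (d1 / 2)) (\<epsilon> / (4 * C)))"
    have \<tau>: "\<tau> > 0" "\<tau> \<le> T / 3" "\<tau> < d0" "\<tau> < d1" "C * \<tau> \<le> \<epsilon> / 4"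
    proof -
      show "\<tau> > 0" "\<tau> \<le> T / 3" "\<tau> < d0" "\<tau> < d1" using \<open>0 < T\<close> d0 d1 \<open>0 < \<epsilon>\<close> C by (auto simp: \<tau>_def)
      have "\<tau> \<le> \<epsilon> / (4 * C)" by (simp add: \<tau>_def)
      then show "C * \<tau> \<le> \<epsilon> / 4" using C by (simp add: field_simps)
    qed
    have Fb: "cmod (F \<sigma> j w t - F \<sigma> j w a) \<le> (M + 2) * (t - a)"
      if w: "w \<in> W" and j: "j \<in> {1..N}" and "0 \<le> a" "a \<le> t" "t \<le> T" for w j a t
    proof -
      let ?H = "\<lambda>s. G j s + of_real (\<sigma> s) * w j"
      have cH: "continuous_on {0..T} ?H" by (intro continuous_intros G j \<sigma>)
      have "?H integrable_on {0..t}"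
        using that by (intro integrable_continuous_real continuous_on_subset[OF cH]) auto
      from Henstock_Kurzweil_Integration.integral_combine[OF \<open>0 \<le> a\<close> \<open>a \<le> t\<close> this]
      have "F \<sigma> j w t - F \<sigma> j w a = integral {a..t} ?H" by (simp add: F_def algebra_simps)
      also have "cmod \<dots> \<le> (M + 2) * (t - a)"
      proof (rule integral_bound)
        show "continuous_on {a..t} ?H" using that by (intro continuous_on_subset[OF cH]) auto
        fix s assume "s \<in> {a..t}"
        then have s: "s \<in> {0..T}" using that by auto
        have "cmod (of_real (\<sigma> s) * w j) \<le> 1 * 2"
          unfolding norm_mult using w j \<sigma>(2) s by (intro mult_mono) (auto simp: W_def)
        then show "cmod (?H s) \<le> M + 2" using M(2)[OF j s] norm_triangle_ineq[of "G j s" "of_real (\<sigma> s) * w j"] by linarith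
      qed (use that in auto)
      finally show ?thesis .
    qed
    have c\<xi>: "continuous_on {a..b} (\<xi> j)" if "0 \<le> a" "b \<le> T" "j \<in> {1..N}" for a b j
      using that by (intro continuous_on_subset[OF \<xi>]) auto
    have "control_family N W \<xi> (F \<sigma>) \<rho> 0 \<tau> (q0 (0 / \<tau>)) (q0 (\<tau> / \<tau>)) (\<lambda>t. q0 (t / \<tau>)) (\<lambda>_ _. 0)
       ((1 / \<rho> + (M + 2)) * (\<tau> - 0)) ((1 / \<rho> + (M + 2)) * (\<tau> - 0))"
    proof (rule control_family_single)
      show "continuous_on {0..\<tau>} (\<lambda>t. q0 (t / \<tau>))"
        using \<tau> by (intro continuous_on_compose2[OF q0(2)]) (auto intro!: continuous_intros)
      show "cmod (F \<sigma> j w t - F \<sigma> j w 0) \<le> (M + 2) * (t - 0)"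
        if "w \<in> W" "j \<in> {1..N}" "t \<in> {0..\<tau>}" for w j t
        using that \<tau> \<open>0 < T\<close> by (intro Fb) auto
      fix j t assume j: "j \<in> {1..N}" and t: "t \<in> {0..\<tau>}"
      have "\<rho>2 \<le> cmod (q0 (t / \<tau>) - \<xi> j 0)" using t \<tau> by (intro q0(5) j) auto
      also have "q0 (t / \<tau>) - \<xi> j 0 = (\<xi> j t - \<xi> j 0) - (\<xi> j t - q0 (t / \<tau>))" by simp
      also have "cmod \<dots> \<le> cmod (\<xi> j t - \<xi> j 0) + cmod (\<xi> j t - q0 (t / \<tau>))" by (rule norm_triangle_ineq4)
      also have "cmod (\<xi> j t - \<xi> j 0) < \<rho>" using t \<tau> \<open>0 < T\<close> by (intro d0(2) j) auto
      finally show "\<rho> \<le> cmod (\<xi> j t - q0 (t / \<tau>))" using \<rho> by simp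
    qed (use \<tau> \<rho> M c\<xi> \<open>0 < T\<close> in auto)
    then have 1: "control_family N W \<xi> (F \<sigma>) \<rho> 0 \<tau> y0 P (\<lambda>t. q0 (t / \<tau>)) (\<lambda>_ _. 0) (\<epsilon> / 4) (\<epsilon> / 4)"
      using \<tau> q0 by (intro control_family_mono[OF _ \<tau>(5) \<tau>(5)]) (simp flip: C_def)
    have "control_family N W \<xi> (F \<sigma>) \<rho> (T - \<tau>) T (qf ((T - \<tau> - (T - \<tau>)) / \<tau>)) (qf ((T - (T - \<tau>)) / \<tau>))
       (\<lambda>t. qf ((t - (T - \<tau>)) / \<tau>)) (\<lambda>_ _. 0)
       ((1 / \<rho> + (M + 2)) * (T - (T - \<tau>))) ((1 / \<rho> + (M + 2)) * (T - (T - \<tau>)))"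
    proof (rule control_family_single)
      show "continuous_on {T - \<tau>..T} (\<lambda>t. qf ((t - (T - \<tau>)) / \<tau>))"
        using \<tau> by (intro continuous_on_compose2[OF qf(2)]) (auto intro!: continuous_intros simp: field_simps)
      show "cmod (F \<sigma> j w t - F \<sigma> j w (T - \<tau>)) \<le> (M + 2) * (t - (T - \<tau>))"
        if "w \<in> W" "j \<in> {1..N}" "t \<in> {T - \<tau>..T}" for w j t
        using that \<tau> \<open>0 < T\<close> by (intro Fb) auto
      fix j t assume j: "j \<in> {1..N}" and t: "t \<in> {T - \<tau>..T}"
      have "\<rho>3 \<le> cmod (qf ((t - (T - \<tau>)) / \<tau>) - \<xi> j T)" using t \<tau> by (intro qf(5) j) (auto simp: field_simps)
      also have "qf ((t - (T - \<tau>)) / \<tau>) - \<xi> j T = (\<xi> j t - \<xi> j T) - (\<xi> j t - qf ((t - (T - \<tau>)) / \<tau>))" by simp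
      also have "cmod \<dots> \<le> cmod (\<xi> j t - \<xi> j T) + cmod (\<xi> j t - qf ((t - (T - \<tau>)) / \<tau>))" by (rule norm_triangle_ineq4)
      also have "cmod (\<xi> j t - \<xi> j T) < \<rho>" using t \<tau> \<open>0 < T\<close> by (intro d1(2) j) auto
      finally show "\<rho> \<le> cmod (\<xi> j t - qf ((t - (T - \<tau>)) / \<tau>))" using \<rho> by simp
    qed (use \<tau> \<rho> M c\<xi> \<open>0 < T\<close> in auto)
    then have 3: "control_family N W \<xi> (F \<sigma>) \<rho> (T - \<tau>) T P yf (\<lambda>t. qf ((t - (T - \<tau>)) / \<tau>)) (\<lambda>_ _. 0) (\<epsilon> / 4) (\<epsilon> / 4)"
      using \<tau> qf by (intro control_family_mono[OF _ \<tau>(5) \<tau>(5)]) (simp flip: C_def)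
    define e where "e = \<epsilon> / (4 * T)"
    have e: "e > 0" "e * (T - \<tau> - \<tau>) \<le> \<epsilon> / 4"
    proof -
      show "e > 0" using \<open>0 < \<epsilon>\<close> \<open>0 < T\<close> by (simp add: e_def)
      then have "e * (T - \<tau> - \<tau>) \<le> e * T" using \<tau> by (intro mult_left_mono) auto
      then show "e * (T - \<tau> - \<tau>) \<le> \<epsilon> / 4" using \<open>0 < T\<close> by (simp add: e_def)
    qed
    have "\<exists>Y B. control_family N W \<xi> (F \<sigma>) \<rho>1 \<tau> (T - \<tau>) P P Y B (e * (T - \<tau> - \<tau>)) (e * (T - \<tau> - \<tau>) + \<epsilon> / 4)"
      by (rule mid[of \<sigma>]) (use \<tau> e \<open>0 < \<epsilon>\<close> \<sigma> in auto)
    then obtain Y B where "control_family N W \<xi> (F \<sigma>) \<rho>1 \<tau> (T - \<tau>) P P Y B (e * (T - \<tau> - \<tau>)) (e * (T - \<tau> - \<tau>) + \<epsilon> / 4)" by blast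
    then have "control_family N W \<xi> (F \<sigma>) \<rho>1 \<tau> (T - \<tau>) P P Y B (\<epsilon> / 4) (\<epsilon> / 2)"
      by (rule control_family_mono) (use e in auto)
    then have 2: "control_family N W \<xi> (F \<sigma>) \<rho> \<tau> (T - \<tau>) P P Y B (\<epsilon> / 4) (\<epsilon> / 2)"
      using \<rho>(2) unfolding control_family_def by (meson order_trans)
    have 12: "control_family N W \<xi> (F \<sigma>) \<rho> 0 (T - \<tau>) y0 P (join \<tau> (\<lambda>t. q0 (t / \<tau>)) Y) (\<lambda>i. join \<tau> ((\<lambda>_ _. 0) i) (B i))
        (\<epsilon> / 4 + \<epsilon> / 4) (max (\<epsilon> / 4) (\<epsilon> / 4 + \<epsilon> / 2))"
      using \<tau> \<rho> c\<xi> \<open>0 < T\<close> by (intro control_family_join[OF 1 2]) auto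
    have "control_family N W \<xi> (F \<sigma>) \<rho> 0 T y0 yf (join (T - \<tau>) (join \<tau> (\<lambda>t. q0 (t / \<tau>)) Y) (\<lambda>t. qf ((t - (T - \<tau>)) / \<tau>)))
        (\<lambda>i. join (T - \<tau>) ((\<lambda>i. join \<tau> ((\<lambda>_ _. 0) i) (B i)) i) ((\<lambda>_ _. 0) i))
        (\<epsilon> / 4 + \<epsilon> / 4 + \<epsilon> / 4) (max (max (\<epsilon> / 4) (\<epsilon> / 4 + \<epsilon> / 2)) (\<epsilon> / 4 + \<epsilon> / 4 + \<epsilon> / 4))"
      using \<tau> \<rho> c\<xi> \<open>0 < T\<close> by (intro control_family_join[OF 12 3]) auto
    then have "control_family N W \<xi> (F \<sigma>) \<rho> 0 T y0 yf (join (T - \<tau>) (join \<tau> (\<lambda>t. q0 (t / \<tau>)) Y) (\<lambda>t. qf ((t - (T - \<tau>)) / \<tau>)))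
        (\<lambda>i. join (T - \<tau>) ((\<lambda>i. join \<tau> ((\<lambda>_ _. 0) i) (B i)) i) ((\<lambda>_ _. 0) i)) \<epsilon> \<epsilon>"
      by (rule control_family_mono) (use \<open>0 < \<epsilon>\<close> in auto)
    then show "\<exists>Y B. control_family N W \<xi> (\<lambda>j w t. integral {0..t} (\<lambda>s. G j s + of_real (\<sigma> s) * w j)) \<rho> 0 T y0 yf Y B \<epsilon> \<epsilon>"
      unfolding F_def by blast
  qed
qed

section \<open>Polynomial controls\<close>

text \<open>A curve in the plane whose two real components are polynomial functions of time.\<close>
definition polynomial_curve :: "(real \<Rightarrow> complex) \<Rightarrow> bool" where
  "polynomial_curve f \<longleftrightarrow> (\<exists>p q :: real poly. \<forall>t. f t = Complex (poly p t) (poly q t))"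

lemma polynomial_curve_add:
  assumes "polynomial_curve f" "polynomial_curve g"
  shows "polynomial_curve (\<lambda>t. f t + g t)"
proof -
  obtain p q p' q' where "\<And>t. f t = Complex (poly p t) (poly q t)" "\<And>t. g t = Complex (poly p' t) (poly q' t)"
    using assms unfolding polynomial_curve_def by blast
  then have "\<forall>t. f t + g t = Complex (poly (p + p') t) (poly (q + q') t)" by (simp add: complex_eq_iff)
  then show ?thesis unfolding polynomial_curve_def by blast
qed

lemma polynomial_curve_cmult:
  assumes "polynomial_curve f"
  shows "polynomial_curve (\<lambda>t. c * f t)"
proof -
  obtain p q where "\<And>t. f t = Complex (poly p t) (poly q t)"
    using assms unfolding polynomial_curve_def by blast
  then have "\<forall>t. c * f t = Complex (poly (smult (Re c) p - smult (Im c) q) t) (poly (smult (Re c) q + smult (Im c) p) t)"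
    by (simp add: complex_eq_iff)
  then show ?thesis unfolding polynomial_curve_def by blast
qed

lemma polynomial_curve_ctrl:
  assumes "polynomial_curve Y" "\<And>i. i \<in> {1..N} \<Longrightarrow> polynomial_curve (B i)"
  shows "polynomial_curve (ctrl N Y B w)"
proof -
  have "polynomial_curve (\<lambda>t. \<Sum>i\<in>{1..k}. w i * B i t)" if "k \<le> N" for k
    using that
  proof (induction k)
    case 0
    show ?case unfolding polynomial_curve_def by (intro exI[of _ 0]) (simp add: complex_eq_iff)
  next
    case (Suc k)
    then show ?case using polynomial_curve_add polynomial_curve_cmult assms(2)[of "Suc k"] by simp
  qed
  then show ?thesis using polynomial_curve_add assms(1) unfolding ctrl_def by blast
qed

lemma continuous_on_polynomial_curve:
  "polynomial_curve f \<Longrightarrow> continuous_on S f"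
proof -
  assume "polynomial_curve f"
  then obtain p q where "f = (\<lambda>t. Complex (poly p t) (poly q t))" unfolding polynomial_curve_def by blast
  then show ?thesis by (auto intro!: continuous_intros)
qed

lemma bernstein_approximation:
  fixes g :: "real \<Rightarrow> real"
  assumes "T > 0" and g: "continuous_on {0..T} g" and "\<epsilon> > 0"
  obtains p :: "real poly" where "poly p 0 = g 0" "poly p T = g T" "\<And>t. t \<in> {0..T} \<Longrightarrow> \<bar>g t - poly p t\<bar> < \<epsilon>"
proof -
  define h where "h = (\<lambda>s. g (T * s))"
  have "continuous_on {0..1} h"
    unfolding h_def using \<open>T > 0\<close> by (intro continuous_on_compose2[OF g]) (auto intro!: continuous_intros mult_left_le)
  from Bernstein_Weierstrass[OF this \<open>\<epsilon> > 0\<close>] obtain n0 where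
    n0: "\<And>n x. n0 \<le> n \<Longrightarrow> x \<in> {0..1} \<Longrightarrow> \<bar>h x - (\<Sum>k\<le>n. h (k / n) * Bernstein n k x)\<bar> < \<epsilon>" by blast
  define n where "n = Suc n0"
  define q :: "real poly" where "q = (\<Sum>k\<le>n. smult (h (k / n) * of_nat (n choose k)) ([:0, 1:] ^ k * [:1, -1:] ^ (n - k)))"
  have q: "poly q x = (\<Sum>k\<le>n. h (k / n) * Bernstein n k x)" for x
    by (simp add: q_def poly_sum Bernstein_def mult.assoc)
  have "poly q 0 = (\<Sum>k\<le>n. if k = 0 then h 0 else 0)"
    unfolding q by (intro sum.cong) (auto simp: Bernstein_def power_0_left)
  then have q0: "poly q 0 = h 0" by simp
  have "poly q 1 = (\<Sum>k\<le>n. if k = n then h 1 else 0)"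
    unfolding q by (intro sum.cong) (auto simp: Bernstein_def power_0_left n_def)
  then have q1: "poly q 1 = h 1" by simp
  show ?thesis
  proof (rule that[of "pcompose q [:0, 1 / T:]"])
    show "poly (pcompose q [:0, 1 / T:]) 0 = g 0" using q0 by (simp add: poly_pcompose h_def)
    show "poly (pcompose q [:0, 1 / T:]) T = g T" using q1 \<open>T > 0\<close> by (simp add: poly_pcompose h_def)
    fix t assume "t \<in> {0..T}"
    then show "\<bar>g t - poly (pcompose q [:0, 1 / T:]) t\<bar> < \<epsilon>"
      using n0[of n "t / T"] \<open>T > 0\<close> by (simp add: poly_pcompose q n_def h_def)
  qed
qed

lemma polynomial_curve_approximation:
  fixes f :: "real \<Rightarrow> complex"
  assumes "T > 0" and f: "continuous_on {0..T} f" and "\<epsilon> > 0"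
  shows "\<exists>g. polynomial_curve g \<and> g 0 = f 0 \<and> g T = f T \<and> (\<forall>t\<in>{0..T}. cmod (f t - g t) < \<epsilon>)"
proof -
  obtain p where p: "poly p 0 = Re (f 0)" "poly p T = Re (f T)" "\<And>t. t \<in> {0..T} \<Longrightarrow> \<bar>Re (f t) - poly p t\<bar> < \<epsilon> / 2"
    using bernstein_approximation[of T "\<lambda>t. Re (f t)" "\<epsilon> / 2"] assms by (auto intro: continuous_intros)
  obtain q where q: "poly q 0 = Im (f 0)" "poly q T = Im (f T)" "\<And>t. t \<in> {0..T} \<Longrightarrow> \<bar>Im (f t) - poly q t\<bar> < \<epsilon> / 2"
    using bernstein_approximation[of T "\<lambda>t. Im (f t)" "\<epsilon> / 2"] assms by (auto intro: continuous_intros)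
  show ?thesis
  proof (intro exI[of _ "\<lambda>t. Complex (poly p t) (poly q t)"] conjI ballI)
    show "polynomial_curve (\<lambda>t. Complex (poly p t) (poly q t))" unfolding polynomial_curve_def by blast
    fix t assume t: "t \<in> {0..T}"
    have "cmod (f t - Complex (poly p t) (poly q t)) \<le> \<bar>Re (f t) - poly p t\<bar> + \<bar>Im (f t) - poly q t\<bar>"
      using cmod_le[of "f t - Complex (poly p t) (poly q t)"] by simp
    then show "cmod (f t - Complex (poly p t) (poly q t)) < \<epsilon>" using p(3)[OF t] q(3)[OF t] by linarith
  qed (simp_all add: p q complex_eq_iff)
qed

lemma control_family_polynomial:
  assumes "T > 0" "\<rho> > 0" "\<epsilon> > 0"
    and \<xi>: "\<And>j. j \<in> {1..N} \<Longrightarrow> continuous_on {0..T} (\<xi> j)"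
    and fam: "control_family N {w. \<forall>i\<in>{1..N}. cmod (w i) \<le> 2} \<xi> F (2 * \<rho>) 0 T p q Y B E E"
  shows "\<exists>Y' B'. polynomial_curve Y' \<and> (\<forall>i\<in>{1..N}. polynomial_curve (B' i)) \<and>
    control_family N {w. \<forall>i\<in>{1..N}. cmod (w i) \<le> 2} \<xi> F \<rho> 0 T p q Y' B' (E + \<epsilon>) (E + \<epsilon>)"
proof -
  define W where "W = {w :: nat \<Rightarrow> complex. \<forall>i\<in>{1..N}. cmod (w i) \<le> 2}"
  note fam = fam[folded W_def]
  define \<delta> where "\<delta> = min \<rho> (\<epsilon> * (\<rho> * (2 * \<rho>)) / T)"
  have \<delta>: "\<delta> > 0" "\<delta> \<le> \<rho>" "\<delta> / (\<rho> * (2 * \<rho>)) \<le> \<epsilon> / T"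
  proof -
    show "\<delta> > 0" "\<delta> \<le> \<rho>" using assms(1-3) by (auto simp: \<delta>_def)
    have "\<delta> \<le> \<epsilon> / T * (\<rho> * (2 * \<rho>))" by (simp add: \<delta>_def)
    then show "\<delta> / (\<rho> * (2 * \<rho>)) \<le> \<epsilon> / T" using \<open>\<rho> > 0\<close> by (simp add: pos_divide_le_eq)
  qed
  define d where "d = \<delta> / (1 + 2 * real N)"
  have "d * (1 + 2 * real N) = \<delta>" by (simp add: d_def add_nonneg_eq_0_iff)
  then have d: "d + 2 * real N * d = \<delta>" by (simp add: algebra_simps)
  have "d > 0" using \<delta> by (simp add: d_def)
  have cY: "continuous_on {0..T} Y" "\<And>i. i \<in> {1..N} \<Longrightarrow> continuous_on {0..T} (B i)"
    using fam by (auto simp: control_family_def)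
  obtain Y' where Y': "polynomial_curve Y'" "Y' 0 = Y 0" "Y' T = Y T" "\<And>t. t \<in> {0..T} \<Longrightarrow> cmod (Y t - Y' t) < d"
    using polynomial_curve_approximation[OF \<open>T > 0\<close> cY(1) \<open>d > 0\<close>] by blast
  have "\<forall>i\<in>{1..N}. \<exists>g. polynomial_curve g \<and> g 0 = B i 0 \<and> g T = B i T \<and> (\<forall>t\<in>{0..T}. cmod (B i t - g t) < d)"
    using polynomial_curve_approximation[OF \<open>T > 0\<close> cY(2) \<open>d > 0\<close>] by blast
  then obtain B' where B': "\<And>i. i \<in> {1..N} \<Longrightarrow> polynomial_curve (B' i) \<and> B' i 0 = B i 0 \<and> B' i T = B i T \<and>
      (\<forall>t\<in>{0..T}. cmod (B i t - B' i t) < d)"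
    by metis
  have close: "cmod (ctrl N Y B w t - ctrl N Y' B' w t) \<le> \<delta>" if w: "w \<in> W" and t: "t \<in> {0..T}" for w t
  proof -
    have "ctrl N Y B w t - ctrl N Y' B' w t = (Y t - Y' t) + (\<Sum>i\<in>{1..N}. w i * (B i t - B' i t))"
      by (simp add: ctrl_def right_diff_distrib sum_subtractf)
    also have "cmod \<dots> \<le> d + (\<Sum>i\<in>{1..N}. 2 * d)"
    proof (rule norm_triangle_mono)
      show "cmod (Y t - Y' t) \<le> d" using Y'(4)[OF t] by simp
      show "cmod (\<Sum>i\<in>{1..N}. w i * (B i t - B' i t)) \<le> (\<Sum>i\<in>{1..N}. 2 * d)"
      proof (rule sum_norm_le)
        fix i assume i: "i \<in> {1..N}"
        then show "cmod (w i * (B i t - B' i t)) \<le> 2 * d"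
          unfolding norm_mult using w B'[OF i] t by (intro mult_mono) (auto simp: W_def less_imp_le)
      qed
    qed
    also have "\<dots> = \<delta>" using d by (simp add: algebra_simps)
    finally show ?thesis .
  qed
  have est: "\<rho> \<le> cmod (\<xi> j t - ctrl N Y' B' w t) \<and>
      cmod (integral {0..t} (\<lambda>s. 1 / (\<xi> j s - ctrl N Y' B' w s)) - (F j w t - F j w 0)) \<le> E + \<epsilon>"
    if w: "w \<in> W" and j: "j \<in> {1..N}" and t: "t \<in> {0..T}" for w j t
  proof -
    let ?y = "ctrl N Y B w" and ?y' = "ctrl N Y' B' w"
    have far: "2 * \<rho> \<le> cmod (\<xi> j s - ?y s)" if "s \<in> {0..T}" for s
      using fam w j that unfolding control_family_def by blast
    have far': "\<rho> \<le> cmod (\<xi> j s - ?y' s)" if "s \<in> {0..T}" for s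
    proof -
      have "cmod (\<xi> j s - ?y s) \<le> cmod (\<xi> j s - ?y' s) + cmod (?y s - ?y' s)"
        using norm_triangle_ineq4[of "\<xi> j s - ?y' s" "?y s - ?y' s"] by simp
      then show ?thesis using far[OF that] close[OF w that] \<delta> by linarith
    qed
    have nz: "\<xi> j s - ?y s \<noteq> 0" "\<xi> j s - ?y' s \<noteq> 0" if "s \<in> {0..T}" for s
      using far[OF that] far'[OF that] \<open>\<rho> > 0\<close> by auto
    have cy: "continuous_on {0..T} ?y" "continuous_on {0..T} ?y'"
    proof -
      show "continuous_on {0..T} ?y" by (intro continuous_on_ctrl cY)
      have "polynomial_curve ?y'" by (intro polynomial_curve_ctrl) (use Y'(1) B' in auto)
      then show "continuous_on {0..T} ?y'" by (rule continuous_on_polynomial_curve)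
    qed
    have c: "continuous_on {0..T} (\<lambda>s. 1 / (\<xi> j s - ?y s))" "continuous_on {0..T} (\<lambda>s. 1 / (\<xi> j s - ?y' s))"
      using nz by (auto intro!: continuous_intros cy \<xi> j)
    have sub: "{0..t} \<subseteq> {0..T}" using t by auto
    note ct = c[THEN continuous_on_subset, OF sub]
    have "integral {0..t} (\<lambda>s. 1 / (\<xi> j s - ?y' s)) - (F j w t - F j w 0)
        = (integral {0..t} (\<lambda>s. 1 / (\<xi> j s - ?y s)) - (F j w t - F j w 0))
        + integral {0..t} (\<lambda>s. 1 / (\<xi> j s - ?y' s) - 1 / (\<xi> j s - ?y s))"
      using ct[THEN integrable_continuous_real] by (simp add: integral_diff)
    also have "cmod \<dots> \<le> E + \<epsilon>"
    proof (rule norm_triangle_mono)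
      show "cmod (integral {0..t} (\<lambda>s. 1 / (\<xi> j s - ?y s)) - (F j w t - F j w 0)) \<le> E"
        using fam w j t unfolding control_family_def by blast
      have "cmod (integral {0..t} (\<lambda>s. 1 / (\<xi> j s - ?y' s) - 1 / (\<xi> j s - ?y s))) \<le> \<epsilon> / T * (t - 0)"
      proof (rule integral_bound)
        show "continuous_on {0..t} (\<lambda>s. 1 / (\<xi> j s - ?y' s) - 1 / (\<xi> j s - ?y s))"
          by (intro continuous_on_diff ct)
        fix s assume "s \<in> {0..t}"
        then have s: "s \<in> {0..T}" using sub by auto
        have "1 / (\<xi> j s - ?y' s) - 1 / (\<xi> j s - ?y s) = - (?y s - ?y' s) / ((\<xi> j s - ?y' s) * (\<xi> j s - ?y s))"
          using nz[OF s] by (simp add: divide_simps)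
        also have "cmod \<dots> \<le> \<delta> / (\<rho> * (2 * \<rho>))"
          unfolding norm_divide norm_mult norm_minus_cancel
          using close[OF w s] far[OF s] far'[OF s] \<delta>(1) \<open>\<rho> > 0\<close> by (intro frac_le mult_mono mult_pos_pos) auto
        finally show "cmod (1 / (\<xi> j s - ?y' s) - 1 / (\<xi> j s - ?y s)) \<le> \<epsilon> / T" using \<delta> by linarith
      qed (use t in auto)
      also have "\<epsilon> / T * (t - 0) \<le> \<epsilon> / T * T" using t \<open>\<epsilon> > 0\<close> \<open>T > 0\<close> by (intro mult_left_mono) auto
      finally show "cmod (integral {0..t} (\<lambda>s. 1 / (\<xi> j s - ?y' s) - 1 / (\<xi> j s - ?y s))) \<le> \<epsilon>"
        using \<open>T > 0\<close> by simp
    qed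
    finally show ?thesis using far'[OF t] by blast
  qed
  have "control_family N W \<xi> F \<rho> 0 T p q Y' B' (E + \<epsilon>) (E + \<epsilon>)"
    unfolding control_family_def
  proof (intro conjI ballI)
    show "continuous_on {0..T} Y'" by (rule continuous_on_polynomial_curve[OF Y'(1)])
    show "Y' 0 = p" "Y' T = q" using Y' fam by (auto simp: control_family_def)
    fix i assume i: "i \<in> {1..N}"
    show "continuous_on {0..T} (B' i)" using B'[OF i] by (blast intro: continuous_on_polynomial_curve)
    show "B' i 0 = 0" "B' i T = 0" using B'[OF i] fam i by (auto simp: control_family_def)
  qed (use est \<open>T > 0\<close> in auto)
  then show ?thesis using Y'(1) B' unfolding W_def by blast
qed

section \<open>A collision-free reference motion\<close>

text \<open>
  The segment from \<open>a\<close> to \<open>b\<close>, bent sideways by \<open>\<theta>\<close>, avoids 0 for all but at most one \<open>\<theta>\<close>. Applied to the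
  differences of positions of two vortices, this shows that a generic bend avoids all collisions.
\<close>
lemma finite_bad_bends:
  fixes a b :: complex
  assumes "a \<noteq> 0" "b \<noteq> 0"
  shows "finite {\<theta>. \<exists>s\<in>{0..1}. of_real (1 - s) * a + of_real s * b + of_real (\<theta> * s * (1 - s)) * (\<i> * b) = 0}"
proof -
  define c where "c = a / b"
  have "c \<noteq> 0" using assms by (simp add: c_def)
  have "\<theta> = Im c * (1 - Re c) / Re c"
    if s: "s \<in> {0..1}" and eq: "of_real (1 - s) * a + of_real s * b + of_real (\<theta> * s * (1 - s)) * (\<i> * b) = 0" for \<theta> s
  proof -
    have "b * (of_real (1 - s) * c + of_real s + of_real (\<theta> * s * (1 - s)) * \<i>) = 0"
      using eq \<open>b \<noteq> 0\<close> by (simp add: c_def field_simps)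
    then have "of_real (1 - s) * c + of_real s + of_real (\<theta> * s * (1 - s)) * \<i> = 0"
      using \<open>b \<noteq> 0\<close> by simp
    then have re: "(1 - s) * Re c + s = 0" and im: "(1 - s) * Im c + \<theta> * s * (1 - s) = 0"
      by (simp_all add: complex_eq_iff)
    have "s \<noteq> 1" using re by auto
    have "s \<noteq> 0"
    proof
      assume "s = 0"
      then have "Re c = 0" "Im c = 0" using re im by auto
      then show False using \<open>c \<noteq> 0\<close> by (simp add: complex_eq_iff)
    qed
    have "(1 - s) * (Im c + \<theta> * s) = (1 - s) * Im c + \<theta> * s * (1 - s)" by (simp add: algebra_simps)
    then have "(1 - s) * (Im c + \<theta> * s) = 0" using im by simp
    then have 1: "Im c + \<theta> * s = 0" using \<open>s \<noteq> 1\<close> by simp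
    have 2: "s * (1 - Re c) = - Re c" using re by (simp add: algebra_simps)
    then have "Re c \<noteq> 0" using \<open>s \<noteq> 0\<close> by auto
    have "\<theta> * Re c = - (\<theta> * s) * (1 - Re c)" using 2 by (simp add: mult.assoc)
    also have "\<dots> = Im c * (1 - Re c)" using 1 by (simp add: add_eq_0_iff2)
    finally show ?thesis using \<open>Re c \<noteq> 0\<close> by (simp add: field_simps)
  qed
  then have "{\<theta>. \<exists>s\<in>{0..1}. of_real (1 - s) * a + of_real s * b + of_real (\<theta> * s * (1 - s)) * (\<i> * b) = 0}
      \<subseteq> {Im c * (1 - Re c) / Re c}" by blast
  then show ?thesis by (rule finite_subset) simp
qed

lemma collision_free_motion:
  fixes x0 xf :: "nat \<Rightarrow> complex"
  assumes "T > 0"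
    and "\<And>i j. i \<in> {1..N} \<Longrightarrow> j \<in> {1..N} \<Longrightarrow> i \<noteq> j \<Longrightarrow> x0 i \<noteq> x0 j"
    and "\<And>i j. i \<in> {1..N} \<Longrightarrow> j \<in> {1..N} \<Longrightarrow> i \<noteq> j \<Longrightarrow> xf i \<noteq> xf j"
  shows "\<exists>\<xi> \<xi>' :: nat \<Rightarrow> real \<Rightarrow> complex. (\<forall>i. \<xi> i 0 = x0 i \<and> \<xi> i T = xf i) \<and>
    (\<forall>i t S. (\<xi> i has_vector_derivative \<xi>' i t) (at t within S)) \<and> (\<forall>i S. continuous_on S (\<xi>' i)) \<and>
    (\<forall>t\<in>{0..T}. \<forall>i\<in>{1..N}. \<forall>j\<in>{1..N}. j \<noteq> i \<longrightarrow> \<xi> j t \<noteq> \<xi> i t)"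
proof -
  define bad where "bad = (\<lambda>a b. {\<theta>. \<exists>s\<in>{0..1}. of_real (1 - s) * a + of_real s * b
      + of_real (\<theta> * s * (1 - s)) * (\<i> * b) = (0::complex)})"
  define A where "A = {(i, j). i \<in> {1..N} \<and> j \<in> {1..N} \<and> i \<noteq> j}"
  have "finite A" by (rule finite_subset[of _ "{1..N} \<times> {1..N}"]) (auto simp: A_def)
  moreover have "finite (bad (x0 (fst p) - x0 (snd p)) (xf (fst p) - xf (snd p)))" if "p \<in> A" for p
    unfolding bad_def by (rule finite_bad_bends) (use that assms(2,3) in \<open>auto simp: A_def\<close>)
  ultimately have "finite (\<Union>(i, j)\<in>A. bad (x0 i - x0 j) (xf i - xf j))"
    by (auto simp: case_prod_beta)
  then obtain \<theta> :: real where \<theta>: "\<theta> \<notin> (\<Union>(i, j)\<in>A. bad (x0 i - x0 j) (xf i - xf j))"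
    using ex_new_if_finite[OF infinite_UNIV_char_0] by blast
  define \<xi> where "\<xi> = (\<lambda>i t. of_real (1 - t / T) * x0 i + of_real (t / T) * xf i
      + of_real (\<theta> * (t / T) * (1 - t / T)) * (\<i> * xf i))"
  define \<xi>' where "\<xi>' = (\<lambda>i t. of_real (- 1 / T) * x0 i + of_real (1 / T) * xf i
      + of_real (\<theta> * (1 / T - 2 * t / T\<^sup>2)) * (\<i> * xf i))"
  have "\<xi> j t \<noteq> \<xi> i t" if t: "t \<in> {0..T}" and ij: "i \<in> {1..N}" "j \<in> {1..N}" "j \<noteq> i" for i j t
  proof
    assume "\<xi> j t = \<xi> i t"
    have alg: "p * a + q * b + r * (\<i> * b) - (p * a' + q * b' + r * (\<i> * b'))
        = p * (a - a') + q * (b - b') + r * (\<i> * (b - b'))" for p q r a b a' b' :: complex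
      by (simp add: algebra_simps)
    have "of_real (1 - t / T) * (x0 j - x0 i) + of_real (t / T) * (xf j - xf i)
      + of_real (\<theta> * (t / T) * (1 - t / T)) * (\<i> * (xf j - xf i)) = \<xi> j t - \<xi> i t"
      unfolding \<xi>_def alg ..
    also have "\<dots> = 0" using \<open>\<xi> j t = \<xi> i t\<close> by simp
    finally have "of_real (1 - t / T) * (x0 j - x0 i) + of_real (t / T) * (xf j - xf i)
      + of_real (\<theta> * (t / T) * (1 - t / T)) * (\<i> * (xf j - xf i)) = 0" .
    moreover have "t / T \<in> {0..1}" using t \<open>T > 0\<close> by simp
    ultimately have "\<theta> \<in> bad (x0 j - x0 i) (xf j - xf i)" unfolding bad_def by blast
    then show False using \<theta> ij by (auto simp: A_def)
  qed
  moreover have "(\<xi> i has_vector_derivative \<xi>' i t) (at t within S)" for i t S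
  proof -
    have of: "((\<lambda>t. of_real (f t) * c) has_vector_derivative of_real f' * c) (at t within S)"
      if "(f has_real_derivative f') (at t within S)" for f f' and c :: complex
      using that by (intro has_vector_derivative_mult_left has_vector_derivative_of_real)
        (simp add: has_real_derivative_iff_has_vector_derivative)
    have "((\<lambda>t. 1 - t / T) has_real_derivative - 1 / T) (at t within S)"
      "((\<lambda>t. t / T) has_real_derivative 1 / T) (at t within S)"
      "((\<lambda>t. \<theta> * (t / T) * (1 - t / T)) has_real_derivative \<theta> * (1 / T - 2 * t / T\<^sup>2)) (at t within S)"
      using \<open>T > 0\<close> by (auto intro!: derivative_eq_intros simp: field_simps power2_eq_square)
    then show ?thesis unfolding \<xi>_def \<xi>'_def by (intro has_vector_derivative_add of)
  qed
  moreover have "continuous_on S (\<xi>' i)" for S i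
    unfolding \<xi>'_def using \<open>T > 0\<close> by (intro continuous_intros) auto
  moreover have "\<xi> i 0 = x0 i" "\<xi> i T = xf i" for i using \<open>T > 0\<close> by (simp_all add: \<xi>_def)
  ultimately show ?thesis by blast
qed

section \<open>The regularised vortex system\<close>

text \<open>
  Configurations are modelled by bounded sequences of complex numbers with the supremum norm, supported in \<open>{1..N}\<close>.
  The index set is a copy of the natural numbers that carries the discrete metric. This is a Banach space in which the number \<open>N\<close> of vortices can vary.
\<close>
instance bcontfun :: (metric_space, banach) banach ..

text \<open>The sequence with the entry \<open>z\<close> at position \<open>i\<close> and 0 elsewhere.\<close>
definition unit_vec :: "nat \<Rightarrow> complex \<Rightarrow> nat discrete \<Rightarrow>\<^sub>C complex" where
  "unit_vec i z = Bcontfun (\<lambda>k. if k = discrete i then z else 0)"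

text \<open>The entry at position \<open>i\<close>.\<close>
definition coord :: "(nat discrete \<Rightarrow>\<^sub>C complex) \<Rightarrow> nat \<Rightarrow> complex" where
  "coord x i = apply_bcontfun x (discrete i)"

text \<open>The sequence with the entries \<open>x 1, \<dots>, x N\<close>; all other entries, in particular the one at 0, vanish.\<close>
definition emb :: "nat \<Rightarrow> (nat \<Rightarrow> complex) \<Rightarrow> nat discrete \<Rightarrow>\<^sub>C complex" where
  "emb N x = (\<Sum>i\<in>{1..N}. unit_vec i (x i))"

lemma coord_eqI: "(\<And>i. coord x i = coord y i) \<Longrightarrow> x = y"
  unfolding coord_def by (rule bcontfun_eqI) (metis discrete_cases)

lemma norm_coord_le: "cmod (coord x i) \<le> norm x"
  unfolding coord_def by (rule norm_bounded)

lemma norm_le_coordI: "(\<And>i. cmod (coord x i) \<le> K) \<Longrightarrow> norm x \<le> K"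
  unfolding coord_def by (rule norm_bound) (metis discrete_cases)

lemma coord_unit_vec: "coord (unit_vec i z) k = (if k = i then z else 0)"
proof -
  have "(\<lambda>k. if k = discrete i then z else 0) \<in> bcontfun"
    by (rule bcontfun_normI[of _ "cmod z"]) (auto simp: continuous_on_open_invariant intro: open_discrete)
  then show ?thesis by (simp add: unit_vec_def coord_def Bcontfun_inverse discrete_inject)
qed

lemma bounded_linear_coord: "bounded_linear (\<lambda>x. coord x k)"
  by (rule bounded_linear_intro[where K = 1]) (auto simp: norm_coord_le, auto simp: coord_def)

lemma coord_diff: "coord (x - y) k = coord x k - coord y k"
  and coord_add: "coord (x + y) k = coord x k + coord y k"
  and coord_scaleR: "coord (r *\<^sub>R x) k = r *\<^sub>R coord x k"
  by (simp_all add: coord_def)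

lemma bounded_linear_unit_vec: "bounded_linear (unit_vec i)"
proof (rule bounded_linear_intro[where K = 1])
  show "norm (unit_vec i z) \<le> norm z * 1" for z
    by (rule norm_le_coordI) (simp add: coord_unit_vec)
  show "unit_vec i (x + y) = unit_vec i x + unit_vec i y" for x y
    by (rule coord_eqI) (simp add: coord_unit_vec coord_add)
  show "unit_vec i (r *\<^sub>R x) = r *\<^sub>R unit_vec i x" for r x
    by (rule coord_eqI) (simp add: coord_unit_vec coord_scaleR)
qed

lemma coord_emb: "coord (emb N x) k = (if k \<in> {1..N} then x k else 0)"
proof -
  have "coord (emb N x) k = (\<Sum>i\<in>{1..N}. coord (unit_vec i (x i)) k)"
    unfolding emb_def by (rule linear_sum[OF bounded_linear.linear[OF bounded_linear_coord]])
  also have "\<dots> = (\<Sum>i\<in>{1..N}. if k = i then x k else 0)"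
    by (intro sum.cong) (auto simp: coord_unit_vec)
  finally show ?thesis by simp
qed

lemma norm_emb_le:
  assumes "\<And>i. i \<in> {1..N} \<Longrightarrow> cmod (x i) \<le> K" "K \<ge> 0"
  shows "norm (emb N x) \<le> K"
  using assms by (intro norm_le_coordI) (simp add: coord_emb)

lemma emb_diff: "emb N x - emb N x' = emb N (\<lambda>i. x i - x' i)"
  by (rule coord_eqI) (simp add: coord_emb coord_diff)

lemma has_vector_derivative_emb:
  assumes "\<And>i. i \<in> {1..N} \<Longrightarrow> (x i has_vector_derivative x' i) (at t within S)"
  shows "((\<lambda>t. emb N (\<lambda>i. x i t)) has_vector_derivative emb N x') (at t within S)"
  unfolding emb_def
  by (intro has_vector_derivative_sum bounded_linear.has_vector_derivative[OF bounded_linear_unit_vec] assms)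

lemma continuous_on_emb:
  assumes "\<And>i. i \<in> {1..N} \<Longrightarrow> continuous_on S (\<lambda>t. x t i)"
  shows "continuous_on S (\<lambda>t. emb N (x t))"
  unfolding emb_def by (intro continuous_on_sum bounded_linear.continuous_on[OF bounded_linear_unit_vec] assms)

text \<open>
  The velocity field \<open>\<i> / cnj v\<close> of a vortex, replaced by a linear field on the disc of radius \<open>\<rho>\<close>, which makes it
  globally Lipschitz.
\<close>
definition vortex_kernel :: "real \<Rightarrow> complex \<Rightarrow> complex" where
  "vortex_kernel \<rho> v = \<i> * v / of_real ((max (cmod v) \<rho>)\<^sup>2)"

lemma vortex_kernel_eq:
  assumes "\<rho> \<le> cmod v" "\<rho> > 0"
  shows "vortex_kernel \<rho> v = \<i> / cnj v"
proof -
  have "v \<noteq> 0" using assms by auto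
  have "vortex_kernel \<rho> v = \<i> * v / (v * cnj v)"
    using assms by (simp only: vortex_kernel_def max_absorb1 complex_norm_square)
  then show ?thesis using \<open>v \<noteq> 0\<close> by simp
qed

lemma vortex_kernel_lipschitz:
  assumes "\<rho> > 0"
  shows "cmod (vortex_kernel \<rho> u - vortex_kernel \<rho> v) \<le> 3 / \<rho>\<^sup>2 * cmod (u - v)"
proof -
  define p q where "p = max (cmod u) \<rho>" and "q = max (cmod v) \<rho>"
  have pq: "p \<ge> \<rho>" "q \<ge> \<rho>" "p \<ge> cmod u" "q \<ge> cmod v" "p > 0" "q > 0"
    using assms by (auto simp: p_def q_def)
  have "\<bar>cmod u - cmod v\<bar> \<le> cmod (u - v)" by (rule norm_triangle_ineq3)
  then have d: "\<bar>q - p\<bar> \<le> cmod (u - v)" by (auto simp: p_def q_def max_def)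
  have "vortex_kernel \<rho> u - vortex_kernel \<rho> v = \<i> * ((u - v) / of_real (p\<^sup>2) + v * of_real (1 / p\<^sup>2 - 1 / q\<^sup>2))"
    by (simp add: vortex_kernel_def p_def[symmetric] q_def[symmetric] diff_divide_distrib right_diff_distrib distrib_left)
  also have "cmod \<dots> = cmod ((u - v) / of_real (p\<^sup>2) + v * of_real (1 / p\<^sup>2 - 1 / q\<^sup>2))"
    by (simp add: norm_mult)
  also have "\<dots> \<le> cmod (u - v) / p\<^sup>2 + cmod v * \<bar>1 / p\<^sup>2 - 1 / q\<^sup>2\<bar>"
  proof -
    have "cmod (of_real (p\<^sup>2)) = p\<^sup>2" "cmod (of_real (1 / p\<^sup>2 - 1 / q\<^sup>2)) = \<bar>1 / p\<^sup>2 - 1 / q\<^sup>2\<bar>"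
      by (simp_all only: norm_of_real abs_power2 power2_abs)
    then show ?thesis
      using norm_triangle_ineq[of "(u - v) / of_real (p\<^sup>2)" "v * of_real (1 / p\<^sup>2 - 1 / q\<^sup>2)"]
      by (simp only: norm_mult norm_divide)
  qed
  also have "\<bar>1 / p\<^sup>2 - 1 / q\<^sup>2\<bar> = \<bar>q - p\<bar> * (q + p) / (p\<^sup>2 * q\<^sup>2)"
  proof -
    have "1 / p\<^sup>2 - 1 / q\<^sup>2 = (q - p) * (q + p) / (p\<^sup>2 * q\<^sup>2)"
      using pq by (simp add: divide_simps) (simp add: algebra_simps power2_eq_square)
    then show ?thesis using pq by (simp add: abs_mult)
  qed
  also have "cmod v * (\<bar>q - p\<bar> * (q + p) / (p\<^sup>2 * q\<^sup>2)) \<le> q * (cmod (u - v) * (q + p) / (p\<^sup>2 * q\<^sup>2))"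
    using pq d by (intro mult_mono divide_right_mono mult_right_mono) auto
  also have "q * (cmod (u - v) * (q + p) / (p\<^sup>2 * q\<^sup>2)) = cmod (u - v) * (1 / p\<^sup>2 + 1 / (p * q))"
    using pq by (simp add: divide_simps) (simp add: algebra_simps power2_eq_square)
  also have "cmod (u - v) / p\<^sup>2 + cmod (u - v) * (1 / p\<^sup>2 + 1 / (p * q)) = cmod (u - v) * (1 / p\<^sup>2 + 1 / p\<^sup>2 + 1 / (p * q))"
    by (simp add: algebra_simps)
  also have "\<dots> \<le> cmod (u - v) * (1 / \<rho>\<^sup>2 + 1 / \<rho>\<^sup>2 + 1 / \<rho>\<^sup>2)"
  proof (intro mult_left_mono add_mono)
    show "1 / p\<^sup>2 \<le> 1 / \<rho>\<^sup>2" using pq assms by (intro divide_left_mono power_mono) auto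
    then show "1 / p\<^sup>2 \<le> 1 / \<rho>\<^sup>2" .
    show "1 / (p * q) \<le> 1 / \<rho>\<^sup>2" unfolding power2_eq_square
      using pq assms by (intro divide_left_mono mult_mono) auto
  qed simp
  finally show ?thesis by (simp add: mult.commute)
qed

text \<open>
  The right-hand side of the regularised system, for a controlled vortex of strength \<open>cc\<close> at \<open>q\<close>. The strengths
  \<open>c\<close> and \<open>cc\<close> include the factor \<open>1 / (2 * pi)\<close>.
\<close>
definition vortex_field :: "nat \<Rightarrow> (nat \<Rightarrow> real) \<Rightarrow> real \<Rightarrow> real \<Rightarrow> complex \<Rightarrow> (nat discrete \<Rightarrow>\<^sub>C complex) \<Rightarrow> nat discrete \<Rightarrow>\<^sub>C complex" where
  "vortex_field N c cc \<rho> q x = emb N (\<lambda>i. (\<Sum>j\<in>{1..N} - {i}. of_real (c j) * vortex_kernel \<rho> (coord x i - coord x j))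
    + of_real cc * vortex_kernel \<rho> (coord x i - q))"

lemma vortex_field_lipschitz:
  assumes "\<rho> > 0"
  shows "norm (vortex_field N c cc \<rho> q x - vortex_field N c cc \<rho> q' x')
    \<le> (((\<Sum>j\<in>{1..N}. \<bar>c j\<bar>) + \<bar>cc\<bar>) * (6 / \<rho>\<^sup>2)) * (norm (x - x') + cmod (q - q'))"
  unfolding vortex_field_def emb_diff
proof (rule norm_emb_le)
  have coord: "cmod (coord x i - coord x' i) \<le> norm (x - x')" for i
    using norm_coord_le[of "x - x'" i] by (simp add: coord_diff)
  let ?d = "norm (x - x') + cmod (q - q')"
  have K: "cmod (vortex_kernel \<rho> (a - b) - vortex_kernel \<rho> (a' - b')) \<le> 6 / \<rho>\<^sup>2 * ?d"
    if "cmod (a - a') \<le> ?d" "cmod (b - b') \<le> ?d" for a a' b b'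
  proof -
    have "cmod (a - b - (a' - b')) \<le> cmod (a - a') + cmod (b - b')"
      using norm_triangle_ineq4[of "a - a'" "b - b'"] by (simp add: algebra_simps)
    also have "\<dots> \<le> 2 * ?d" using that by simp
    finally have "cmod (vortex_kernel \<rho> (a - b) - vortex_kernel \<rho> (a' - b')) \<le> 3 / \<rho>\<^sup>2 * (2 * ?d)"
      using vortex_kernel_lipschitz[OF assms, of "a - b" "a' - b'"] by (meson mult_left_mono order_trans divide_nonneg_nonneg zero_le_power2 zero_le_numeral)
    then show ?thesis by simp
  qed
  have le: "cmod (coord x i - coord x' i) \<le> ?d" "cmod (q - q') \<le> ?d" for i
    using coord[of i] norm_ge_zero[of "q - q'"] norm_ge_zero[of "x - x'"] by linarith+
  fix i assume i: "i \<in> {1..N}"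
  have "(\<Sum>j\<in>{1..N} - {i}. of_real (c j) * vortex_kernel \<rho> (coord x i - coord x j)) + of_real cc * vortex_kernel \<rho> (coord x i - q)
      - ((\<Sum>j\<in>{1..N} - {i}. of_real (c j) * vortex_kernel \<rho> (coord x' i - coord x' j)) + of_real cc * vortex_kernel \<rho> (coord x' i - q'))
      = (\<Sum>j\<in>{1..N} - {i}. of_real (c j) * (vortex_kernel \<rho> (coord x i - coord x j) - vortex_kernel \<rho> (coord x' i - coord x' j)))
        + of_real cc * (vortex_kernel \<rho> (coord x i - q) - vortex_kernel \<rho> (coord x' i - q'))"
    by (simp add: right_diff_distrib sum_subtractf)
  also have "cmod \<dots> \<le> (\<Sum>j\<in>{1..N} - {i}. \<bar>c j\<bar> * (6 / \<rho>\<^sup>2 * ?d)) + \<bar>cc\<bar> * (6 / \<rho>\<^sup>2 * ?d)"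
  proof (intro norm_triangle_mono sum_norm_le)
    show "cmod (of_real (c j) * (vortex_kernel \<rho> (coord x i - coord x j) - vortex_kernel \<rho> (coord x' i - coord x' j))) \<le> \<bar>c j\<bar> * (6 / \<rho>\<^sup>2 * ?d)" for j
      unfolding norm_mult norm_of_real by (intro mult_left_mono K le) simp
    show "cmod (of_real cc * (vortex_kernel \<rho> (coord x i - q) - vortex_kernel \<rho> (coord x' i - q'))) \<le> \<bar>cc\<bar> * (6 / \<rho>\<^sup>2 * ?d)"
      unfolding norm_mult norm_of_real by (intro mult_left_mono K le) simp
  qed
  also have "(\<Sum>j\<in>{1..N} - {i}. \<bar>c j\<bar> * (6 / \<rho>\<^sup>2 * ?d)) \<le> (\<Sum>j\<in>{1..N}. \<bar>c j\<bar> * (6 / \<rho>\<^sup>2 * ?d))"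
    by (intro sum_mono2) auto
  also have "(\<Sum>j\<in>{1..N}. \<bar>c j\<bar> * (6 / \<rho>\<^sup>2 * ?d)) + \<bar>cc\<bar> * (6 / \<rho>\<^sup>2 * ?d)
      = (((\<Sum>j\<in>{1..N}. \<bar>c j\<bar>) + \<bar>cc\<bar>) * (6 / \<rho>\<^sup>2)) * ?d"
    by (simp only: sum_distrib_right[symmetric] distrib_right mult.assoc)
  finally show "cmod ((\<Sum>j\<in>{1..N} - {i}. of_real (c j) * vortex_kernel \<rho> (coord x i - coord x j)) + of_real cc * vortex_kernel \<rho> (coord x i - q)
      - ((\<Sum>j\<in>{1..N} - {i}. of_real (c j) * vortex_kernel \<rho> (coord x' i - coord x' j)) + of_real cc * vortex_kernel \<rho> (coord x' i - q')))
      \<le> (((\<Sum>j\<in>{1..N}. \<bar>c j\<bar>) + \<bar>cc\<bar>) * (6 / \<rho>\<^sup>2)) * ?d" by simp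
qed (simp add: sum_nonneg)

lemma continuous_on_vortex_kernel [continuous_intros]:
  assumes "\<rho> > 0" "continuous_on S f"
  shows "continuous_on S (\<lambda>x. vortex_kernel \<rho> (f x))"
  unfolding vortex_kernel_def using assms by (intro continuous_intros) (auto simp: max_def)

lemma continuous_on_vortex_field:
  assumes "\<rho> > 0" "continuous_on S q" "continuous_on S x"
  shows "continuous_on S (\<lambda>t. vortex_field N c cc \<rho> (q t) (x t))"
  unfolding vortex_field_def
  by (intro continuous_on_emb continuous_intros assms bounded_linear.continuous_on[OF bounded_linear_coord])

text \<open>Continuous dependence of the solutions of the regularised system on the path of the controlled vortex.\<close>
lemma vortex_field_dependence:
  fixes x x' :: "real \<Rightarrow> nat discrete \<Rightarrow>\<^sub>C complex"
  assumes "\<rho> > 0" and L_def: "L = ((\<Sum>j\<in>{1..N}. \<bar>c j\<bar>) + \<bar>cc\<bar>) * (6 / \<rho>\<^sup>2)"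
    and cy: "continuous_on {0..T} y" "continuous_on {0..T} y'"
    and dx: "\<And>t. t \<in> {0..T} \<Longrightarrow> (x has_vector_derivative vortex_field N c cc \<rho> (y t) (x t)) (at t within {0..T})"
    and dx': "\<And>t. t \<in> {0..T} \<Longrightarrow> (x' has_vector_derivative vortex_field N c cc \<rho> (y' t) (x' t)) (at t within {0..T})"
    and "x 0 = x' 0" and \<delta>: "\<And>t. t \<in> {0..T} \<Longrightarrow> cmod (y' t - y t) \<le> \<delta>"
    and t: "t \<in> {0..T}"
  shows "norm (x t - x' t) \<le> (L * \<delta> * T) * exp (L * t)"
proof -
  have L: "L \<ge> 0" unfolding L_def by (intro mult_nonneg_nonneg add_nonneg_nonneg sum_nonneg) auto
  have lip: "norm (vortex_field N c cc \<rho> q h - vortex_field N c cc \<rho> q' h') \<le> L * (norm (h - h') + cmod (q - q'))" for q q' h h'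
    unfolding L_def by (rule vortex_field_lipschitz[OF \<open>\<rho> > 0\<close>])
  have cx: "continuous_on {0..T} x" "continuous_on {0..T} x'"
    using dx dx' by (meson continuous_on_eq_continuous_within has_vector_derivative_continuous)+
  have cf: "continuous_on {0..T} (\<lambda>t. vortex_field N c cc \<rho> (y t) (x t))"
    "continuous_on {0..T} (\<lambda>t. vortex_field N c cc \<rho> (y t) (x' t))"
    "continuous_on {0..T} (\<lambda>t. vortex_field N c cc \<rho> (y' t) (x' t))"
    using continuous_on_vortex_field[OF \<open>\<rho> > 0\<close>] cx cy by blast+
  show ?thesis
  proof (rule ode_difference[where f = "\<lambda>t. vortex_field N c cc \<rho> (y t)", OF dx cf(1,2) cx(2) _ _ L t])
    show "norm (vortex_field N c cc \<rho> (y t) (x t) - vortex_field N c cc \<rho> (y t) (x' t)) \<le> L * norm (x t - x' t)" for t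
      using lip[of "y t" "x t" "y t" "x' t"] by simp
    show "norm (x' t - x 0 - integral {0..t} (\<lambda>s. vortex_field N c cc \<rho> (y s) (x' s))) \<le> L * \<delta> * T"
      if t: "t \<in> {0..T}" for t
    proof -
      have sub: "{0..t} \<subseteq> {0..T}" using t by auto
      let ?f = "\<lambda>y s. vortex_field N c cc \<rho> (y s) (x' s)"
      have cft: "continuous_on {0..t} (?f y)" "continuous_on {0..t} (?f y')"
        using cf(2,3) sub by (auto elim: continuous_on_subset)
      have "(?f y' has_integral (x' t - x' 0)) {0..t}"
        using t by (intro fundamental_theorem_of_calculus has_vector_derivative_within_subset[OF dx' sub]) auto
      then have "x' t - x 0 - integral {0..t} (?f y) = integral {0..t} (\<lambda>s. ?f y' s - ?f y s)"
        using cft by (simp add: integral_diff integrable_continuous_real integral_unique \<open>x 0 = x' 0\<close>)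
      also have "norm \<dots> \<le> L * \<delta> * (t - 0)"
      proof (rule integral_bound)
        show "continuous_on {0..t} (\<lambda>s. ?f y' s - ?f y s)" by (intro continuous_on_diff cft)
        fix s assume "s \<in> {0..t}"
        then have "L * cmod (y' s - y s) \<le> L * \<delta>" using \<delta> L sub by (intro mult_left_mono) auto
        then show "norm (?f y' s - ?f y s) \<le> L * \<delta>" using lip[of "y' s" "x' s" "y s" "x' s"] by simp
      qed (use t in auto)
      also have "\<dots> \<le> L * \<delta> * T"
        using t L order_trans[OF norm_ge_zero \<delta>[OF t]] by (intro mult_left_mono) auto
      finally show ?thesis .
    qed
  qed
qed

text \<open>
  Collision-free solutions of the original system in complex notation, again with the factor \<open>1 / (2 * pi)\<close>
  included in the strengths \<open>c\<close> and \<open>cc\<close>.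
\<close>
definition complex_solution ::
  "nat \<Rightarrow> (nat \<Rightarrow> real) \<Rightarrow> real \<Rightarrow> (nat \<Rightarrow> complex) \<Rightarrow> real \<Rightarrow> (real \<Rightarrow> complex) \<Rightarrow> (nat \<Rightarrow> real \<Rightarrow> complex) \<Rightarrow> bool" where
  "complex_solution N c cc x0 T y x \<longleftrightarrow>
    (\<forall>i\<in>{1..N}. x i 0 = x0 i) \<and>
    (\<forall>t\<in>{0..T}. \<forall>i\<in>{1..N}. x i t \<noteq> y t \<and> (\<forall>j\<in>{1..N}. j \<noteq> i \<longrightarrow> x i t \<noteq> x j t)) \<and>
    (\<forall>i\<in>{1..N}. \<forall>t\<in>{0..T}. (x i has_vector_derivative
      (\<Sum>j\<in>{1..N} - {i}. of_real (c j) * (\<i> / cnj (x i t - x j t))) + of_real cc * (\<i> / cnj (x i t - y t)))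
      (at t within {0..T}))"

text \<open>
  By compactness a solution keeps a positive distance from the collisions; it therefore solves every regularised
  system with a sufficiently small radius.
\<close>
lemma complex_solution_field:
  assumes sol: "complex_solution N c cc x0 T y x" and "continuous_on {0..T} y"
  obtains \<rho>0 where "\<rho>0 > 0"
    "\<And>\<rho> t. 0 < \<rho> \<Longrightarrow> \<rho> \<le> \<rho>0 \<Longrightarrow> t \<in> {0..T} \<Longrightarrow> ((\<lambda>t. emb N (\<lambda>i. x i t)) has_vector_derivative
      vortex_field N c cc \<rho> (y t) (emb N (\<lambda>i. x i t))) (at t within {0..T})"
proof -
  have cx: "continuous_on {0..T} (x i)" if "i \<in> {1..N}" for i
    using sol that unfolding complex_solution_def
    by (meson continuous_on_eq_continuous_within has_vector_derivative_continuous)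
  have distinct: "x j t \<noteq> x i t" if "t \<in> {0..T}" "i \<in> {1..N}" "j \<in> {1..N}" "j \<noteq> i" for t i j
    using sol that by (simp add: complex_solution_def)
  have "\<exists>D>0. \<forall>t\<in>{0..T}. \<forall>i\<in>{1..N}. \<forall>j\<in>{1..N}. j \<noteq> i \<longrightarrow> D \<le> cmod (x j t - x i t)"
    by (rule uniformly_separated[OF cx distinct])
  then obtain D where D: "D > 0" "\<forall>t\<in>{0..T}. \<forall>i\<in>{1..N}. \<forall>j\<in>{1..N}. j \<noteq> i \<longrightarrow> D \<le> cmod (x j t - x i t)"
    by blast
  have 3: "continuous_on {0..T} (\<lambda>t. x i t - y t)" if "i \<in> {1..N}" for i
    using that by (intro continuous_intros cx assms)
  have 4: "x i t - y t \<noteq> 0" if "i \<in> {1..N}" "t \<in> {0..T}" for i t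
    using sol that by (auto simp: complex_solution_def)
  obtain D' where D': "D' > 0" "\<And>i t. i \<in> {1..N} \<Longrightarrow> t \<in> {0..T} \<Longrightarrow> D' \<le> cmod (x i t - y t)"
    using finite_continuous_bounded_below[of "{1..N}" 0 T "\<lambda>i t. x i t - y t"] 3 4 by blast
  show ?thesis
  proof (rule that[of "min D D'"])
    show "min D D' > 0" using D D' by simp
    fix \<rho> t assume \<rho>: "0 < \<rho>" "\<rho> \<le> min D D'" and t: "t \<in> {0..T}"
    have "emb N (\<lambda>i. (\<Sum>j\<in>{1..N} - {i}. of_real (c j) * (\<i> / cnj (x i t - x j t))) + of_real cc * (\<i> / cnj (x i t - y t)))
        = vortex_field N c cc \<rho> (y t) (emb N (\<lambda>i. x i t))"
      unfolding vortex_field_def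
    proof (rule coord_eqI)
      fix k
      have "vortex_kernel \<rho> (x k t - x j t) = \<i> / cnj (x k t - x j t)" if "k \<in> {1..N}" "j \<in> {1..N} - {k}" for j
      proof (rule vortex_kernel_eq)
        have "D \<le> cmod (x k t - x j t)" using D(2) that t by auto
        then show "\<rho> \<le> cmod (x k t - x j t)" using \<rho> by simp
      qed (use \<rho> in simp)
      moreover have "vortex_kernel \<rho> (x k t - y t) = \<i> / cnj (x k t - y t)" if "k \<in> {1..N}"
        using D'(2)[OF that t] \<rho> by (intro vortex_kernel_eq) auto
      ultimately show "coord (emb N (\<lambda>i. (\<Sum>j\<in>{1..N} - {i}. of_real (c j) * (\<i> / cnj (x i t - x j t)))
          + of_real cc * (\<i> / cnj (x i t - y t)))) k
        = coord (emb N (\<lambda>i. (\<Sum>j\<in>{1..N} - {i}. of_real (c j) * vortex_kernel \<rho> (coord (emb N (\<lambda>i. x i t)) i - coord (emb N (\<lambda>i. x i t)) j))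
          + of_real cc * vortex_kernel \<rho> (coord (emb N (\<lambda>i. x i t)) i - y t))) k"
        by (auto simp: coord_emb intro!: sum.cong)
    qed
    moreover have "((\<lambda>t. emb N (\<lambda>i. x i t)) has_vector_derivative
        emb N (\<lambda>i. (\<Sum>j\<in>{1..N} - {i}. of_real (c j) * (\<i> / cnj (x i t - x j t))) + of_real cc * (\<i> / cnj (x i t - y t))))
        (at t within {0..T})"
      using sol t unfolding complex_solution_def by (intro has_vector_derivative_emb) blast
    ultimately show "((\<lambda>t. emb N (\<lambda>i. x i t)) has_vector_derivative
      vortex_field N c cc \<rho> (y t) (emb N (\<lambda>i. x i t))) (at t within {0..T})" by simp
  qed
qed

lemma complex_solution_unique:
  assumes sol: "complex_solution N c cc x0 T y x" "complex_solution N c cc x0 T y x'"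
    and y: "continuous_on {0..T} y" and t: "t \<in> {0..T}" and k: "k \<in> {1..N}"
  shows "x k t = x' k t"
proof -
  define X X' where "X = (\<lambda>t. emb N (\<lambda>i. x i t))" and "X' = (\<lambda>t. emb N (\<lambda>i. x' i t))"
  obtain \<rho>1 where \<rho>1: "\<rho>1 > 0" "\<And>\<rho> t. 0 < \<rho> \<Longrightarrow> \<rho> \<le> \<rho>1 \<Longrightarrow> t \<in> {0..T} \<Longrightarrow>
      (X has_vector_derivative vortex_field N c cc \<rho> (y t) (X t)) (at t within {0..T})"
    using complex_solution_field[OF sol(1) y] unfolding X_def by blast
  obtain \<rho>2 where \<rho>2: "\<rho>2 > 0" "\<And>\<rho> t. 0 < \<rho> \<Longrightarrow> \<rho> \<le> \<rho>2 \<Longrightarrow> t \<in> {0..T} \<Longrightarrow>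
      (X' has_vector_derivative vortex_field N c cc \<rho> (y t) (X' t)) (at t within {0..T})"
    using complex_solution_field[OF sol(2) y] unfolding X'_def by blast
  define \<rho> where "\<rho> = min \<rho>1 \<rho>2"
  have \<rho>: "\<rho> > 0" "\<rho> \<le> \<rho>1" "\<rho> \<le> \<rho>2" using \<rho>1 \<rho>2 by (auto simp: \<rho>_def)
  note dX = \<rho>1(2)[OF \<rho>(1,2)] and dX' = \<rho>2(2)[OF \<rho>(1,3)]
  have "X 0 = X' 0" using sol unfolding X_def X'_def complex_solution_def
    by (intro coord_eqI) (simp add: coord_emb)
  have "norm (X t - X' t) \<le> ((((\<Sum>j\<in>{1..N}. \<bar>c j\<bar>) + \<bar>cc\<bar>) * (6 / \<rho>\<^sup>2)) * 0 * T)
      * exp ((((\<Sum>j\<in>{1..N}. \<bar>c j\<bar>) + \<bar>cc\<bar>) * (6 / \<rho>\<^sup>2)) * t)"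
    by (rule vortex_field_dependence[OF \<rho>(1) refl y y dX dX' \<open>X 0 = X' 0\<close> _ t]) simp_all
  then have "X t = X' t" by simp
  then have "coord (X t) k = coord (X' t) k" by simp
  then show ?thesis using k by (simp add: X_def X'_def coord_emb)
qed

lemma complex_solution_of_field:
  assumes "\<rho> > 0" and X0: "X 0 = emb N x0"
    and X: "\<And>t. t \<in> {0..T} \<Longrightarrow> (X has_vector_derivative vortex_field N c cc \<rho> (y t) (X t)) (at t within {0..T})"
    and far: "\<And>t i. t \<in> {0..T} \<Longrightarrow> i \<in> {1..N} \<Longrightarrow> \<rho> \<le> cmod (coord (X t) i - y t)"
    and sep: "\<And>t i j. t \<in> {0..T} \<Longrightarrow> i \<in> {1..N} \<Longrightarrow> j \<in> {1..N} \<Longrightarrow> j \<noteq> i \<Longrightarrow>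
      \<rho> \<le> cmod (coord (X t) i - coord (X t) j)"
  shows "complex_solution N c cc x0 T y (\<lambda>i t. coord (X t) i)"
  unfolding complex_solution_def
proof (intro conjI ballI impI)
  show "coord (X 0) i = x0 i" if "i \<in> {1..N}" for i using that by (simp add: X0 coord_emb)
  show "coord (X t) i \<noteq> y t" if "t \<in> {0..T}" "i \<in> {1..N}" for t i using far[OF that] \<open>\<rho> > 0\<close> by auto
  show "coord (X t) i \<noteq> coord (X t) j" if "t \<in> {0..T}" "i \<in> {1..N}" "j \<in> {1..N}" "j \<noteq> i" for t i j
    using sep[OF that] \<open>\<rho> > 0\<close> by auto
  fix i t assume i: "i \<in> {1..N}" and t: "t \<in> {0..T}"
  have "((\<lambda>t. coord (X t) i) has_vector_derivative coord (vortex_field N c cc \<rho> (y t) (X t)) i) (at t within {0..T})"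
    by (rule bounded_linear.has_vector_derivative[OF bounded_linear_coord X[OF t]])
  moreover have "vortex_kernel \<rho> (coord (X t) i - coord (X t) j) = \<i> / cnj (coord (X t) i - coord (X t) j)"
    if "j \<in> {1..N} - {i}" for j
    using that by (intro vortex_kernel_eq sep t i \<open>\<rho> > 0\<close>) auto
  moreover have "vortex_kernel \<rho> (coord (X t) i - y t) = \<i> / cnj (coord (X t) i - y t)"
    by (intro vortex_kernel_eq far t i \<open>\<rho> > 0\<close>)
  ultimately show "((\<lambda>t. coord (X t) i) has_vector_derivative
      (\<Sum>j\<in>{1..N} - {i}. of_real (c j) * (\<i> / cnj (coord (X t) i - coord (X t) j)))
      + of_real cc * (\<i> / cnj (coord (X t) i - y t))) (at t within {0..T})"
    using i by (simp add: vortex_field_def coord_emb)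
qed

section \<open>Exact control in complex notation\<close>

text \<open>
  The parameter \<open>z\<close> of the controls is normalised such that it displaces the final configuration by
  \<open>cc (T / K) z\<close>. The additional velocity is concentrated near time \<open>T\<close>, as \<open>\<sigma> t = (t / T)^k\<close> with \<open>k\<close> large.
  The integral of the displacement over time is then of order \<open>1 / K\<^sup>2\<close>, and so is its influence on the interaction of
  the vortices, whereas the displacement at time \<open>T\<close> is of order \<open>1 / K\<close>.
\<close>
lemma complex_control:
  fixes x0 xf :: "nat \<Rightarrow> complex"
  assumes "N \<ge> 1" "cc \<noteq> 0" "T > 0"
    and d0: "\<And>i j. i \<in> {1..N} \<Longrightarrow> j \<in> {1..N} \<Longrightarrow> i \<noteq> j \<Longrightarrow> x0 i \<noteq> x0 j"
    and df: "\<And>i j. i \<in> {1..N} \<Longrightarrow> j \<in> {1..N} \<Longrightarrow> i \<noteq> j \<Longrightarrow> xf i \<noteq> xf j"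
    and y0: "\<And>j. j \<in> {1..N} \<Longrightarrow> x0 j \<noteq> y0"
    and yf: "\<And>j. j \<in> {1..N} \<Longrightarrow> xf j \<noteq> yf"
  shows "\<exists>y x. polynomial_curve y \<and> y 0 = y0 \<and> y T = yf \<and> complex_solution N c cc x0 T y x \<and>
    (\<forall>i\<in>{1..N}. x i T = xf i)"
proof -
  have "\<exists>\<xi> \<xi>' :: nat \<Rightarrow> real \<Rightarrow> complex. (\<forall>i. \<xi> i 0 = x0 i \<and> \<xi> i T = xf i) \<and>
    (\<forall>i t S. (\<xi> i has_vector_derivative \<xi>' i t) (at t within S)) \<and> (\<forall>i S. continuous_on S (\<xi>' i)) \<and>
    (\<forall>t\<in>{0..T}. \<forall>i\<in>{1..N}. \<forall>j\<in>{1..N}. j \<noteq> i \<longrightarrow> \<xi> j t \<noteq> \<xi> i t)"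
    by (rule collision_free_motion[OF \<open>T > 0\<close> d0 df])
  then obtain \<xi> \<xi>' :: "nat \<Rightarrow> real \<Rightarrow> complex" where M: "(\<forall>i. \<xi> i 0 = x0 i \<and> \<xi> i T = xf i) \<and>
    (\<forall>i t S. (\<xi> i has_vector_derivative \<xi>' i t) (at t within S)) \<and> (\<forall>i S. continuous_on S (\<xi>' i)) \<and>
    (\<forall>t\<in>{0..T}. \<forall>i\<in>{1..N}. \<forall>j\<in>{1..N}. j \<noteq> i \<longrightarrow> \<xi> j t \<noteq> \<xi> i t)"
    by (elim exE)
  have \<xi>0: "\<xi> i 0 = x0 i" "\<xi> i T = xf i" for i using M by simp_all
  have d\<xi>: "(\<xi> i has_vector_derivative \<xi>' i t) (at t within S)" for i t S using M by simp
  have c\<xi>': "continuous_on S (\<xi>' i)" for i S using M by simp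
  have sep\<xi>: "\<xi> j t \<noteq> \<xi> i t" if "t \<in> {0..T}" "i \<in> {1..N}" "j \<in> {1..N}" "j \<noteq> i" for t i j
    using M that by simp
  have c\<xi>: "continuous_on S (\<xi> i)" for i S
    using d\<xi> by (meson continuous_on_eq_continuous_within has_vector_derivative_continuous)
  \<comment> \<open>\<open>v i\<close> is the velocity that the controlled vortex has to supply, in units of \<open>cc\<close>, and \<open>G i\<close> is the corresponding value of \<open>1 / (\<xi> i - y)\<close>.\<close>
  define v where "v = (\<lambda>i t. (\<xi>' i t - (\<Sum>j\<in>{1..N} - {i}. of_real (c j) * (\<i> / cnj (\<xi> i t - \<xi> j t)))) / of_real cc)"
  define G where "G = (\<lambda>i t. \<i> * cnj (v i t))"
  have cv: "continuous_on {0..T} (v i)" if i: "i \<in> {1..N}" for i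
  proof -
    have "\<xi> i t - \<xi> j t \<noteq> 0" if "t \<in> {0..T}" "j \<in> {1..N} - {i}" for t j using sep\<xi>[of t j i] that i by auto
    then show ?thesis unfolding v_def using \<open>cc \<noteq> 0\<close>
      by (intro continuous_intros c\<xi> c\<xi>') auto
  qed
  have cG: "continuous_on {0..T} (G i)" if "i \<in> {1..N}" for i
    unfolding G_def by (intro continuous_intros cv that)
  obtain D where D: "D > 0" "\<forall>t\<in>{0..T}. \<forall>i\<in>{1..N}. \<forall>j\<in>{1..N}. j \<noteq> i \<longrightarrow> D \<le> cmod (\<xi> j t - \<xi> i t)"
  proof -
    have "\<exists>D>0. \<forall>t\<in>{0..T}. \<forall>i\<in>{1..N}. \<forall>j\<in>{1..N}. j \<noteq> i \<longrightarrow> D \<le> cmod (\<xi> j t - \<xi> i t)"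
      by (rule uniformly_separated[OF c\<xi> sep\<xi>])
    then show thesis using that by blast
  qed
  then have sepD: "D \<le> cmod (\<xi> i t - \<xi> j t)" if "t \<in> {0..T}" "i \<in> {1..N}" "j \<in> {1..N}" "j \<noteq> i" for t i j
    using that by metis
  define W where "W = {w :: nat \<Rightarrow> complex. \<forall>i\<in>{1..N}. cmod (w i) \<le> 2}"
  have "\<exists>\<rho>>0. \<forall>\<sigma> \<epsilon>. continuous_on {0..T} \<sigma> \<longrightarrow> (\<forall>t\<in>{0..T}. \<sigma> t \<in> {0..1}) \<longrightarrow> 0 < \<epsilon> \<longrightarrow>
      (\<exists>Y B. control_family N W \<xi> (\<lambda>j w t. integral {0..t} (\<lambda>s. G j s + of_real (\<sigma> s) * w j)) \<rho> 0 T y0 yf Y B \<epsilon> \<epsilon>)"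
    unfolding W_def
    by (rule steering[OF \<open>0 < T\<close> \<open>N \<ge> 1\<close>]) (use c\<xi> cG sep\<xi> y0 yf \<xi>0 in auto)
  then obtain \<rho>0 where "\<rho>0 > 0" and "\<forall>\<sigma> \<epsilon>. continuous_on {0..T} \<sigma> \<longrightarrow> (\<forall>t\<in>{0..T}. \<sigma> t \<in> {0..1}) \<longrightarrow> 0 < \<epsilon> \<longrightarrow>
      (\<exists>Y B. control_family N W \<xi> (\<lambda>j w t. integral {0..t} (\<lambda>s. G j s + of_real (\<sigma> s) * w j)) \<rho>0 0 T y0 yf Y B \<epsilon> \<epsilon>)"
    by (elim exE conjE)
  note steer = this(2)[rule_format]
  \<comment> \<open>The radius of regularisation: curves within \<open>\<rho>\<close> of \<open>\<xi>\<close> stay in the region where the system is not modified.\<close>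
  define \<rho> where "\<rho> = min (\<rho>0 / 4) (D / 3)"
  have \<rho>: "\<rho> > 0" "4 * \<rho> \<le> \<rho>0" "3 * \<rho> \<le> D" using \<open>\<rho>0 > 0\<close> D by (auto simp: \<rho>_def)
  define L where "L = ((\<Sum>j\<in>{1..N}. \<bar>c j\<bar>) + \<bar>cc\<bar>) * (6 / \<rho>\<^sup>2)"
  have L: "L > 0" unfolding L_def using \<open>cc \<noteq> 0\<close> \<rho> by (intro mult_pos_pos add_nonneg_pos sum_nonneg) auto
  have lip: "norm (vortex_field N c cc \<rho> q x - vortex_field N c cc \<rho> q' x') \<le> L * (norm (x - x') + cmod (q - q'))" for q q' x x'
    unfolding L_def by (rule vortex_field_lipschitz[OF \<rho>(1)])
  define a where "a = \<bar>cc\<bar>"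
  have a: "a > 0" using \<open>cc \<noteq> 0\<close> by (simp add: a_def)
  obtain k :: nat where k: "max (8 * L * T * exp (L * T)) (3 * a * T / \<rho>) < real k" using reals_Archimedean2 by blast
  define K where "K = real k + 1"
  have K: "K > 0" "8 * L * T * exp (L * T) \<le> K + 1" "3 * a * T / \<rho> \<le> K" using k by (auto simp: K_def)
  define \<sigma> where "\<sigma> = (\<lambda>t. (t / T) ^ k)"
  define X where "X = (\<lambda>t. T / K * (t / T) ^ (k + 1))"
  have "K \<noteq> 0" using K by simp
  define \<epsilon> where "\<epsilon> = T / (4 * K) * exp (- L * T)"
  have "\<epsilon> > 0" using \<open>T > 0\<close> K by (simp add: \<epsilon>_def)
  have c\<sigma>: "continuous_on S \<sigma>" for S unfolding \<sigma>_def using \<open>T > 0\<close> by (intro continuous_intros) auto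
  have \<sigma>01: "\<sigma> t \<in> {0..1}" if "t \<in> {0..T}" for t using that \<open>T > 0\<close> by (auto simp: \<sigma>_def intro!: power_le_one)
  have dpow: "((\<lambda>t. b * (t / T) ^ (n + 1)) has_real_derivative b * (real (n + 1) * (s / T) ^ n * (1 / T))) (at s within S)"
    for b n s S
  proof -
    have "((\<lambda>t. t / T) has_real_derivative 1 / T) (at s within S)" by (rule DERIV_cdivide[OF DERIV_ident])
    then have "((\<lambda>t. (t / T) ^ Suc n) has_real_derivative (1 + of_nat n) * (1 / T * (s / T) ^ n)) (at s within S)"
      by (rule DERIV_power_Suc)
    from DERIV_cmult[OF this, of b] show ?thesis by (simp add: mult_ac add.commute)
  qed
  have dX: "(X has_real_derivative \<sigma> t) (at t within S)" for t S
  proof -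
    have "((\<lambda>t. T / K * (t / T) ^ (k + 1)) has_real_derivative T / K * (real (k + 1) * (t / T) ^ k * (1 / T))) (at t within S)"
      by (rule dpow)
    moreover have "T / K * (real (k + 1) * (t / T) ^ k * (1 / T)) = \<sigma> t"
    proof -
      have "real (k + 1) = K" by (simp add: K_def)
      then show ?thesis using \<open>T > 0\<close> \<open>K \<noteq> 0\<close> by (simp add: \<sigma>_def del: of_nat_add)
    qed
    ultimately show ?thesis unfolding X_def by simp
  qed
  have X0: "X 0 = 0" and XT: "X T = T / K" using \<open>T > 0\<close> by (simp_all add: X_def)
  have Xnn: "X t \<ge> 0" "X t \<le> T / K" if "t \<in> {0..T}" for t
  proof -
    show "X t \<ge> 0" using that \<open>T > 0\<close> K by (simp add: X_def)
    have "(t / T) ^ (k + 1) \<le> 1" using that \<open>T > 0\<close> by (intro power_le_one) auto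
    then have "T / K * (t / T) ^ (k + 1) \<le> T / K * 1" using \<open>T > 0\<close> K by (intro mult_left_mono) auto
    then show "X t \<le> T / K" by (simp add: X_def)
  qed
  have cX: "continuous_on S X" for S using dX by (intro DERIV_continuous_on)
  have IX: "integral {0..t} X \<le> T / K * (T / (K + 1))" if t: "t \<in> {0..T}" for t
  proof -
    define b where "b = T / K * (T / (K + 1))"
    have "((\<lambda>t. b * (t / T) ^ (k + 1 + 1)) has_real_derivative X s) (at s within S)" for s S
    proof -
      have "real (k + 1 + 1) = K + 1" "K + 1 \<noteq> 0" using K by (auto simp: K_def)
      moreover from this(2) have "b * (K + 1) = T / K * T" by (simp add: b_def)
      ultimately have "b * real (k + 1 + 1) = T / K * T" by (simp only:)
      then have "b * (real (k + 1 + 1) * (s / T) ^ (k + 1) * (1 / T)) = T / K * T * ((s / T) ^ (k + 1) * (1 / T))"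
        by (simp only: mult.assoc[symmetric])
      also have "\<dots> = X s" using \<open>T > 0\<close> by (simp add: X_def)
      finally have "b * (real (k + 1 + 1) * (s / T) ^ (k + 1) * (1 / T)) = X s" .
      then show ?thesis using dpow[of b "k + 1" s S] by simp
    qed
    then have "(X has_integral b * (t / T) ^ (k + 1 + 1) - b * (0 / T) ^ (k + 1 + 1)) {0..t}"
      using t by (intro fundamental_theorem_of_calculus) (auto simp flip: has_real_derivative_iff_has_vector_derivative)
    then have "integral {0..t} X = T / K * (T / (K + 1)) * (t / T) ^ (k + 1 + 1)"
      by (simp add: integral_unique b_def)
    also have "\<dots> \<le> T / K * (T / (K + 1)) * 1"
      using t \<open>T > 0\<close> K by (intro mult_left_mono power_le_one) auto
    finally show ?thesis by simp
  qed
  define F where "F = (\<lambda>j (w :: nat \<Rightarrow> complex) t. integral {0..t} (\<lambda>s. G j s + of_real (\<sigma> s) * w j))"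
  have "\<exists>Y B. control_family N W \<xi> F \<rho>0 0 T y0 yf Y B (\<epsilon> / 2) (\<epsilon> / 2)"
    unfolding F_def by (rule steer) (use c\<sigma> \<sigma>01 \<open>\<epsilon> > 0\<close> in auto)
  then obtain Y0 B0 where "control_family N W \<xi> F \<rho>0 0 T y0 yf Y0 B0 (\<epsilon> / 2) (\<epsilon> / 2)" by blast
  then have "control_family N W \<xi> F (2 * (\<rho>0 / 2)) 0 T y0 yf Y0 B0 (\<epsilon> / 2) (\<epsilon> / 2)" by simp
  then have "\<exists>Y B. polynomial_curve Y \<and> (\<forall>i\<in>{1..N}. polynomial_curve (B i)) \<and>
      control_family N W \<xi> F (\<rho>0 / 2) 0 T y0 yf Y B (\<epsilon> / 2 + \<epsilon> / 2) (\<epsilon> / 2 + \<epsilon> / 2)"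
    unfolding W_def
    by (intro control_family_polynomial c\<xi>) (use \<open>T > 0\<close> \<open>\<rho>0 > 0\<close> \<open>\<epsilon> > 0\<close> in auto)
  then obtain Y B where YB: "polynomial_curve Y \<and> (\<forall>i\<in>{1..N}. polynomial_curve (B i)) \<and>
      control_family N W \<xi> F (\<rho>0 / 2) 0 T y0 yf Y B (\<epsilon> / 2 + \<epsilon> / 2) (\<epsilon> / 2 + \<epsilon> / 2)"
    by (elim exE)
  have poly: "polynomial_curve Y" "\<And>i. i \<in> {1..N} \<Longrightarrow> polynomial_curve (B i)" using YB by simp_all
  have fam: "control_family N W \<xi> F (\<rho>0 / 2) 0 T y0 yf Y B \<epsilon> \<epsilon>" using YB by simp
  define Q where "Q = {z :: nat \<Rightarrow> complex. \<forall>i\<in>{1..N}. Re (z i) \<in> {-1..1} \<and> Im (z i) \<in> {-1..1}}"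
  \<comment> \<open>The parameter of the averages that corresponds to an additional velocity \<open>cc \<sigma> z\<close>.\<close>
  define w where "w = (\<lambda>z :: nat \<Rightarrow> complex. \<lambda>i. \<i> * cnj (z i))"
  define y where "y = (\<lambda>z. ctrl N Y B (w z))"
  have Qn: "cmod (z i) \<le> 2" if "z \<in> Q" "i \<in> {1..N}" for z i
  proof -
    have "\<bar>Re (z i)\<bar> \<le> 1" "\<bar>Im (z i)\<bar> \<le> 1" using that by (auto simp: Q_def abs_le_iff)
    then show ?thesis using cmod_le[of "z i"] by linarith
  qed
  have wW: "w z \<in> W" if "z \<in> Q" for z using Qn[OF that] by (simp add: W_def w_def norm_mult)
  have ypoly: "polynomial_curve (y z)" for z
    unfolding y_def by (intro polynomial_curve_ctrl poly)
  have cy: "continuous_on S (y z)" for z S by (rule continuous_on_polynomial_curve[OF ypoly])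
  have yend: "y z 0 = y0" "y z T = yf" for z unfolding y_def by (rule control_family_ends[OF fam])+
  have yfar: "2 * \<rho> \<le> cmod (\<xi> j t - y z t)" if "z \<in> Q" "j \<in> {1..N}" "t \<in> {0..T}" for z j t
  proof -
    have "\<rho>0 / 2 \<le> cmod (\<xi> j t - y z t)"
      using fam wW[OF that(1)] that unfolding control_family_def y_def by blast
    then show ?thesis using \<rho>(2) by linarith
  qed
  have yint: "cmod (integral {0..t} (\<lambda>s. 1 / (\<xi> j s - y z s)) - F j (w z) t) \<le> \<epsilon>"
    if "z \<in> Q" "j \<in> {1..N}" "t \<in> {0..T}" for z j t
  proof -
    have "cmod (integral {0..t} (\<lambda>s. 1 / (\<xi> j s - y z s)) - (F j (w z) t - F j (w z) 0)) \<le> \<epsilon>"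
      using fam wW[OF that(1)] that unfolding control_family_def y_def by blast
    then show ?thesis by (simp add: F_def)
  qed
  have "\<exists>x. x 0 = emb N x0 \<and> (\<forall>t\<in>{0..T}. (x has_vector_derivative vortex_field N c cc \<rho> (y z t) (x t)) (at t within {0..T}))" for z
  proof -
    have "continuous_on ({0..T} \<times> UNIV) (\<lambda>p. vortex_field N c cc \<rho> (y z (fst p)) (snd p))"
      by (intro continuous_on_vortex_field \<rho> continuous_on_compose2[OF cy[of UNIV]] continuous_intros) auto
    show ?thesis
    proof (rule picard[where f = "\<lambda>t. vortex_field N c cc \<rho> (y z t)" and T = T and L = L and a = "emb N x0"])
      show "0 \<le> T" "0 < L" using \<open>T > 0\<close> L by auto
      show "continuous_on ({0..T} \<times> UNIV) (\<lambda>p. vortex_field N c cc \<rho> (y z (fst p)) (snd p))" by fact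
      show "norm (vortex_field N c cc \<rho> (y z t) x - vortex_field N c cc \<rho> (y z t) x') \<le> L * norm (x - x')" for t x x'
        using lip[of "y z t" x "y z t" x'] by simp
    qed blast
  qed
  then have "\<forall>z. \<exists>x. x 0 = emb N x0 \<and> (\<forall>t\<in>{0..T}. (x has_vector_derivative vortex_field N c cc \<rho> (y z t) (x t)) (at t within {0..T}))"
    by (rule allI)
  from choice[OF this] obtain x where x: "\<forall>z. x z 0 = emb N x0 \<and>
      (\<forall>t\<in>{0..T}. (x z has_vector_derivative vortex_field N c cc \<rho> (y z t) (x z t)) (at t within {0..T}))"
    by (elim exE)
  have x0: "x z 0 = emb N x0" for z using x by blast
  have dx: "(x z has_vector_derivative vortex_field N c cc \<rho> (y z t) (x z t)) (at t within {0..T})" if "t \<in> {0..T}" for z t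
    using x that by blast
  have cx: "continuous_on {0..T} (x z)" for z
    using dx by (meson continuous_on_eq_continuous_within has_vector_derivative_continuous)
  have cf: "continuous_on {0..T} (\<lambda>t. vortex_field N c cc \<rho> (y z t) (h t))" if "continuous_on {0..T} h" for z h
    by (intro continuous_on_vortex_field \<rho> cy that)
  define \<Xi> where "\<Xi> = (\<lambda>t. emb N (\<lambda>i. \<xi> i t))"
  \<comment> \<open>The motion that the vortices are expected to follow under the control with parameter \<open>z\<close>.\<close>
  define \<Xi>z where "\<Xi>z = (\<lambda>z t. emb N (\<lambda>i. \<xi> i t + of_real (cc * X t) * z i))"
  have c\<Xi>: "continuous_on {0..T} \<Xi>" unfolding \<Xi>_def by (intro continuous_on_emb c\<xi>)
  have c\<Xi>z: "continuous_on {0..T} (\<Xi>z z)" for z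
    unfolding \<Xi>z_def by (intro continuous_on_emb continuous_intros c\<xi> cX)
  have \<Xi>close: "norm (\<Xi>z z t - \<Xi> t) \<le> 2 * a * X t" if "z \<in> Q" "t \<in> {0..T}" for z t
    unfolding \<Xi>_def \<Xi>z_def emb_diff
  proof (rule norm_emb_le)
    fix i assume "i \<in> {1..N}"
    then have "\<bar>cc * X t\<bar> * cmod (z i) \<le> \<bar>cc * X t\<bar> * 2" using Qn[OF that(1)] by (intro mult_left_mono) auto
    then show "cmod (\<xi> i t + of_real (cc * X t) * z i - \<xi> i t) \<le> 2 * a * X t"
      using Xnn[OF that(2)] by (simp add: norm_mult abs_mult a_def del: of_real_mult)
  qed (use a Xnn[OF that(2)] in auto)
  \<comment> \<open>The defect of \<open>\<Xi>z z\<close> in the integrated equation: the first term comes from the displacement, the second from the averaging.\<close>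
  define \<eta> where "\<eta> = 2 * a * L * (T / K * (T / (K + 1))) + a * \<epsilon>"
  have \<eta>: "\<eta> * exp (L * T) \<le> a * T / (2 * K)" "\<eta> \<ge> 0"
  proof -
    have "8 * L * T * exp (L * T) / (K + 1) \<le> 1" using K by simp
    then have "a * T / (4 * K) * (8 * L * T * exp (L * T) / (K + 1)) \<le> a * T / (4 * K) * 1"
      using a \<open>T > 0\<close> K by (intro mult_left_mono) auto
    moreover have "2 * a * L * (T / K * (T / (K + 1))) * exp (L * T) = a * T / (4 * K) * (8 * L * T * exp (L * T) / (K + 1))"
      by simp
    moreover have "a * \<epsilon> * exp (L * T) = a * T / (4 * K)"
      by (simp add: \<epsilon>_def exp_minus)
    moreover have "\<eta> * exp (L * T) = 2 * a * L * (T / K * (T / (K + 1))) * exp (L * T) + a * \<epsilon> * exp (L * T)"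
      by (simp add: \<eta>_def distrib_right)
    moreover have "a * T / (2 * K) = a * T / (4 * K) + a * T / (4 * K)" by simp
    ultimately show "\<eta> * exp (L * T) \<le> a * T / (2 * K)" by linarith
    show "\<eta> \<ge> 0" using a L \<open>T > 0\<close> K \<open>\<epsilon> > 0\<close> by (simp add: \<eta>_def)
  qed
  have defect: "norm (\<Xi>z z t - x z 0 - integral {0..t} (\<lambda>s. vortex_field N c cc \<rho> (y z s) (\<Xi>z z s))) \<le> \<eta>"
    if z: "z \<in> Q" and t: "t \<in> {0..T}" for z t
  proof -
    have sub: "{0..t} \<subseteq> {0..T}" using t by auto
    let ?f = "\<lambda>h s. vortex_field N c cc \<rho> (y z s) (h s)"
    have int: "?f h integrable_on {0..t}" if "continuous_on {0..T} h" for h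
      by (intro integrable_continuous_real continuous_on_subset[OF cf[OF that] sub])
    have "norm (integral {0..t} (\<lambda>s. ?f (\<Xi>z z) s - ?f \<Xi> s)) \<le> integral {0..t} (\<lambda>s. L * (2 * a) * X s)"
    proof (intro integral_norm_bound_integral integrable_diff int c\<Xi> c\<Xi>z integrable_continuous_real continuous_intros cX)
      fix s assume "s \<in> {0..t}"
      then have s: "s \<in> {0..T}" using sub by auto
      have "norm (?f (\<Xi>z z) s - ?f \<Xi> s) \<le> L * norm (\<Xi>z z s - \<Xi> s)"
        using lip[of "y z s" "\<Xi>z z s" "y z s" "\<Xi> s"] by simp
      also have "\<dots> \<le> L * (2 * a * X s)" using \<Xi>close[OF z s] L by simp
      finally show "norm (?f (\<Xi>z z) s - ?f \<Xi> s) \<le> L * (2 * a) * X s" by (simp add: mult.assoc)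
    qed
    also have "\<dots> = L * (2 * a) * integral {0..t} X" by simp
    also have "\<dots> \<le> L * (2 * a) * (T / K * (T / (K + 1)))" using IX[OF t] L a by (intro mult_left_mono) auto
    finally have 1: "norm (integral {0..t} (\<lambda>s. ?f (\<Xi>z z) s - ?f \<Xi> s)) \<le> 2 * a * L * (T / K * (T / (K + 1)))"
      by (simp add: mult_ac)
    have 2: "norm (\<Xi>z z t - x z 0 - integral {0..t} (?f \<Xi>)) \<le> a * \<epsilon>"
    proof (rule norm_le_coordI)
      fix i
      have coordI: "coord (integral {0..t} (?f \<Xi>)) i = integral {0..t} (\<lambda>s. coord (?f \<Xi> s) i)"
        using integral_linear[OF int[OF c\<Xi>] bounded_linear_coord] by (simp add: o_def)
      show "cmod (coord (\<Xi>z z t - x z 0 - integral {0..t} (?f \<Xi>)) i) \<le> a * \<epsilon>"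
      proof (cases "i \<in> {1..N}")
        case False
        then have "coord (vortex_field N c cc \<rho> q h) i = 0" for q h
          unfolding vortex_field_def coord_emb by (rule if_not_P)
        then have "coord (integral {0..t} (?f \<Xi>)) i = 0" unfolding coordI by simp
        moreover have "coord (\<Xi>z z t) i = 0" "coord (x z 0) i = 0"
          using False unfolding \<Xi>z_def x0 coord_emb by (simp_all only: if_False simp_thms)
        ultimately have "coord (\<Xi>z z t - x z 0 - integral {0..t} (?f \<Xi>)) i = 0"
          by (simp only: coord_diff diff_0_right)
        then show ?thesis using a \<open>\<epsilon> > 0\<close> by simp
      next
        case i: True
        have nz: "\<xi> i s - y z s \<noteq> 0" if "s \<in> {0..T}" for s using yfar[OF z i that] \<rho> by auto
        have ci: "continuous_on {0..t} (\<lambda>s. 1 / (\<xi> i s - y z s))"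
          using nz sub by (intro continuous_intros c\<xi> cy) auto
        have cg: "continuous_on {0..t} (\<lambda>s. G i s + of_real (\<sigma> s) * w z i)"
          by (intro continuous_intros continuous_on_subset[OF cG[OF i] sub] c\<sigma>)
        have field: "coord (?f \<Xi> s) i = (\<xi>' i s + of_real (cc * \<sigma> s) * z i)
            + of_real cc * cnj (- \<i> * (1 / (\<xi> i s - y z s) - (G i s + of_real (\<sigma> s) * w z i)))"
          if s: "s \<in> {0..t}" for s
        proof -
          have sT: "s \<in> {0..T}" using s sub by auto
          have kj: "vortex_kernel \<rho> (\<xi> i s - \<xi> j s) = \<i> / cnj (\<xi> i s - \<xi> j s)" if "j \<in> {1..N} - {i}" for j
            using sepD[OF sT i, of j] that \<rho> by (intro vortex_kernel_eq) auto
          have ky: "vortex_kernel \<rho> (\<xi> i s - y z s) = \<i> / cnj (\<xi> i s - y z s)"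
            using yfar[OF z i sT] \<rho> by (intro vortex_kernel_eq) auto
          have "coord (?f \<Xi> s) i = (\<Sum>j\<in>{1..N} - {i}. of_real (c j) * (\<i> / cnj (\<xi> i s - \<xi> j s)))
              + of_real cc * (\<i> / cnj (\<xi> i s - y z s))"
            using i kj ky by (simp add: vortex_field_def coord_emb \<Xi>_def)
          also have "(\<Sum>j\<in>{1..N} - {i}. of_real (c j) * (\<i> / cnj (\<xi> i s - \<xi> j s))) = \<xi>' i s - of_real cc * v i s"
            using \<open>cc \<noteq> 0\<close> by (simp add: v_def)
          finally show ?thesis by (simp add: G_def w_def algebra_simps)
        qed
        have E: "integral {0..t} (\<lambda>s. 1 / (\<xi> i s - y z s) - (G i s + of_real (\<sigma> s) * w z i))
            = integral {0..t} (\<lambda>s. 1 / (\<xi> i s - y z s)) - F i (w z) t"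
          unfolding F_def by (intro integral_diff integrable_continuous_real ci cg)
        have "((\<lambda>s. \<xi>' i s + of_real (cc * \<sigma> s) * z i) has_integral
            (\<xi> i t + of_real (cc * X t) * z i) - (\<xi> i 0 + of_real (cc * X 0) * z i)) {0..t}"
        proof (intro fundamental_theorem_of_calculus)
          fix s
          have "((\<lambda>t. cc * X t) has_real_derivative cc * \<sigma> s) (at s within {0..t})" by (intro DERIV_cmult dX)
          then have "((\<lambda>t. of_real (cc * X t) * z i) has_vector_derivative of_real (cc * \<sigma> s) * z i) (at s within {0..t})"
            by (intro has_vector_derivative_mult_left has_vector_derivative_of_real)
              (simp add: has_real_derivative_iff_has_vector_derivative)
          then show "((\<lambda>t. \<xi> i t + of_real (cc * X t) * z i) has_vector_derivative
              \<xi>' i s + of_real (cc * \<sigma> s) * z i) (at s within {0..t})"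
            by (intro has_vector_derivative_add d\<xi>)
        qed (use t in auto)
        moreover have "((\<lambda>s. of_real cc * cnj (- \<i> * (1 / (\<xi> i s - y z s) - (G i s + of_real (\<sigma> s) * w z i)))) has_integral
            of_real cc * cnj (- \<i> * (integral {0..t} (\<lambda>s. 1 / (\<xi> i s - y z s)) - F i (w z) t))) {0..t}"
        proof -
          have "((\<lambda>s. 1 / (\<xi> i s - y z s) - (G i s + of_real (\<sigma> s) * w z i)) has_integral
              integral {0..t} (\<lambda>s. 1 / (\<xi> i s - y z s)) - F i (w z) t) {0..t}"
            unfolding E[symmetric]
            by (intro integrable_integral integrable_continuous_real continuous_on_diff ci cg)
          then have "((\<lambda>s. - \<i> * (1 / (\<xi> i s - y z s) - (G i s + of_real (\<sigma> s) * w z i))) has_integral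
              - \<i> * (integral {0..t} (\<lambda>s. 1 / (\<xi> i s - y z s)) - F i (w z) t)) {0..t}"
            by (rule has_integral_mult_right)
          then have "((\<lambda>s. cnj (- \<i> * (1 / (\<xi> i s - y z s) - (G i s + of_real (\<sigma> s) * w z i)))) has_integral
              cnj (- \<i> * (integral {0..t} (\<lambda>s. 1 / (\<xi> i s - y z s)) - F i (w z) t))) {0..t}"
            by (subst (asm) has_integral_cnj[symmetric]) (simp only: o_def)
          then show ?thesis by (rule has_integral_mult_right)
        qed
        ultimately have "((\<lambda>s. (\<xi>' i s + of_real (cc * \<sigma> s) * z i)
            + of_real cc * cnj (- \<i> * (1 / (\<xi> i s - y z s) - (G i s + of_real (\<sigma> s) * w z i)))) has_integral
            (\<xi> i t + of_real (cc * X t) * z i) - (\<xi> i 0 + of_real (cc * X 0) * z i)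
            + of_real cc * cnj (- \<i> * (integral {0..t} (\<lambda>s. 1 / (\<xi> i s - y z s)) - F i (w z) t))) {0..t}"
          by (rule has_integral_add)
        then have "integral {0..t} (\<lambda>s. coord (?f \<Xi> s) i) = (\<xi> i t + of_real (cc * X t) * z i) - x0 i
            + of_real cc * cnj (- \<i> * (integral {0..t} (\<lambda>s. 1 / (\<xi> i s - y z s)) - F i (w z) t))"
          using field by (intro integral_unique) (subst has_integral_cong, auto simp: X0 \<xi>0)
        then have "coord (\<Xi>z z t - x z 0 - integral {0..t} (?f \<Xi>)) i
            = - of_real cc * cnj (- \<i> * (integral {0..t} (\<lambda>s. 1 / (\<xi> i s - y z s)) - F i (w z) t))"
          using i by (simp add: coord_diff coordI \<Xi>z_def x0 coord_emb)
        also have "cmod \<dots> = a * cmod (integral {0..t} (\<lambda>s. 1 / (\<xi> i s - y z s)) - F i (w z) t)"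
          by (simp only: norm_mult norm_minus_cancel complex_mod_cnj norm_of_real norm_ii mult_1 a_def)
        also have "\<dots> \<le> a * \<epsilon>" using yint[OF z i t] a by (intro mult_left_mono) auto
        finally show ?thesis .
      qed
    qed
    have "\<Xi>z z t - x z 0 - integral {0..t} (?f (\<Xi>z z))
        = (\<Xi>z z t - x z 0 - integral {0..t} (?f \<Xi>)) - integral {0..t} (\<lambda>s. ?f (\<Xi>z z) s - ?f \<Xi> s)"
      by (subst integral_diff[OF int[OF c\<Xi>z] int[OF c\<Xi>]]) simp
    also have "norm \<dots> \<le> a * \<epsilon> + 2 * a * L * (T / K * (T / (K + 1)))"
      using 1 2 norm_triangle_ineq4 by (meson add_mono order_trans)
    finally show ?thesis by (simp add: \<eta>_def)
  qed
  have track: "norm (x z t - \<Xi>z z t) \<le> a * T / (2 * K)" if z: "z \<in> Q" and t: "t \<in> {0..T}" for z t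
  proof -
    have "norm (x z t - \<Xi>z z t) \<le> \<eta> * exp (L * t)"
    proof (rule ode_difference[where f = "\<lambda>t. vortex_field N c cc \<rho> (y z t)", OF dx _ _ c\<Xi>z _ defect[OF z] _ t])
      show "norm (vortex_field N c cc \<rho> (y z t) (x z t) - vortex_field N c cc \<rho> (y z t) (\<Xi>z z t))
          \<le> L * norm (x z t - \<Xi>z z t)" for t using lip[of "y z t" "x z t" "y z t" "\<Xi>z z t"] by simp
    qed (use cf cx c\<Xi>z L in auto)
    also have "\<dots> \<le> \<eta> * exp (L * T)" using \<eta>(2) L t by (intro mult_left_mono) auto
    finally show ?thesis using \<eta>(1) by linarith
  qed
  \<comment> \<open>The final error in units of the displacement; it is close to \<open>z\<close>.\<close>
  define H where "H = (\<lambda>z i. (coord (x z T) i - xf i) / of_real (cc * (T / K)))"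
  have nz: "cc * (T / K) \<noteq> 0" and anz: "\<bar>cc * (T / K)\<bar> = a * T / K"
    using \<open>cc \<noteq> 0\<close> \<open>T > 0\<close> K by (auto simp: a_def abs_mult)
  have TT: "T \<in> {0..T}" using \<open>T > 0\<close> by simp
  have cB: "continuous_on {0..T} (B i)" if "i \<in> {1..N}" for i
    by (rule continuous_on_polynomial_curve[OF poly(2)[OF that]])
  obtain M where M: "M > 0" "\<And>i t. i \<in> {1..N} \<Longrightarrow> t \<in> {0..T} \<Longrightarrow> cmod (B i t) \<le> M"
    using finite_continuous_bounded[where A = "{1..N}" and f = B, OF finite_atLeastAtMost cB] by blast
  obtain z where z: "z \<in> Q" "\<forall>i\<in>{1..N}. H z i = 0"
  proof (rule poincare_miranda_complex[of Q N H, OF Q_def])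
    fix e :: real assume "e > 0"
    define S where "S = L * T * exp (L * T) * (real N * M) / (a * T / K)"
    have S: "S > 0" using L \<open>T > 0\<close> M \<open>N \<ge> 1\<close> a K by (simp add: S_def)
    have "cmod (H z i - H z' i) < e"
      if zz: "z \<in> Q" "z' \<in> Q" "\<forall>i\<in>{1..N}. cmod (z i - z' i) < e / (2 * S)" and i: "i \<in> {1..N}" for z z' i
    proof -
      define d where "d = e / (2 * S)"
      have "d > 0" using \<open>e > 0\<close> S by (simp add: d_def)
      have ydiff: "cmod (y z' t - y z t) \<le> real N * (d * M)" if "t \<in> {0..T}" for t
      proof -
        have "y z' t - y z t = (\<Sum>j\<in>{1..N}. (w z' j - w z j) * B j t)"
          by (simp add: y_def ctrl_def left_diff_distrib sum_subtractf)
        also have "cmod \<dots> \<le> (\<Sum>j\<in>{1..N}. d * M)"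
        proof (rule sum_norm_le)
          fix j assume j: "j \<in> {1..N}"
          have "w z' j - w z j = - \<i> * cnj (z j - z' j)" by (simp add: w_def algebra_simps)
          then have "cmod (w z' j - w z j) = cmod (z j - z' j)"
            by (simp only: norm_mult norm_minus_cancel norm_ii mult_1 complex_mod_cnj)
          then have "cmod (w z' j - w z j) \<le> d" using zz(3) j by (simp add: d_def less_imp_le)
          then show "cmod ((w z' j - w z j) * B j t) \<le> d * M"
            unfolding norm_mult using M(2)[OF j that] \<open>d > 0\<close> by (intro mult_mono) auto
        qed
        finally show ?thesis by simp
      qed
      have "norm (x z T - x z' T) \<le> (L * (real N * (d * M)) * T) * exp (L * T)"
        by (rule vortex_field_dependence[OF \<rho>(1) L_def cy cy dx dx _ ydiff TT]) (simp_all add: x0)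
      then have "cmod (coord (x z T) i - coord (x z' T) i) \<le> (L * (real N * (d * M)) * T) * exp (L * T)"
        using norm_coord_le[of "x z T - x z' T" i] by (simp add: coord_diff)
      then have "cmod (coord (x z T) i - coord (x z' T) i) / (a * T / K) \<le> (L * (real N * (d * M)) * T) * exp (L * T) / (a * T / K)"
        using a \<open>T > 0\<close> K by (intro divide_right_mono) auto
      also have "\<dots> = S * d" by (simp add: S_def)
      also have "\<dots> < e" using S \<open>e > 0\<close> by (simp add: d_def)
      finally have "cmod (coord (x z T) i - coord (x z' T) i) / (a * T / K) < e" .
      moreover have "H z i - H z' i = (coord (x z T) i - coord (x z' T) i) / of_real (cc * (T / K))"
      proof -
        have "(p - r) / d - (q - r) / d = (p - q) / d" for p q r d :: complex by (simp add: diff_divide_distrib)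
        then show ?thesis unfolding H_def .
      qed
      ultimately show ?thesis by (simp only: norm_divide norm_of_real anz)
    qed
    then show "\<exists>d>0. \<forall>z z'. z \<in> Q \<longrightarrow> z' \<in> Q \<longrightarrow> (\<forall>i\<in>{1..N}. cmod (z i - z' i) < d) \<longrightarrow>
      (\<forall>i\<in>{1..N}. cmod (H z i - H z' i) < e)"
      using S \<open>e > 0\<close> by (intro exI[of _ "e / (2 * S)"]) auto
  next
    fix z i assume z: "z \<in> Q" and i: "i \<in> {1..N}"
    have "H z i - z i = (coord (x z T) i - (xf i + of_real (cc * (T / K)) * z i)) / of_real (cc * (T / K))"
      using nz by (simp add: H_def field_simps del: of_real_mult)
    also have "xf i + of_real (cc * (T / K)) * z i = coord (\<Xi>z z T) i"
      using i by (simp add: \<Xi>z_def coord_emb \<xi>0 XT)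
    also have "cmod ((coord (x z T) i - coord (\<Xi>z z T) i) / of_real (cc * (T / K))) \<le> (a * T / (2 * K)) / (a * T / K)"
      unfolding norm_divide norm_of_real anz
      using order_trans[OF norm_coord_le track[OF z TT], of i] a \<open>T > 0\<close> K
      by (intro divide_right_mono) (auto simp: coord_diff)
    also have "\<dots> \<le> 1" using a \<open>T > 0\<close> K by simp
    finally show "cmod (H z i - z i) \<le> 1" .
  qed
  have close: "norm (x z t - \<Xi> t) \<le> \<rho>" if t: "t \<in> {0..T}" for t
  proof -
    have "norm (x z t - \<Xi> t) \<le> norm (x z t - \<Xi>z z t) + norm (\<Xi>z z t - \<Xi> t)"
      using norm_triangle_ineq[of "x z t - \<Xi>z z t" "\<Xi>z z t - \<Xi> t"] by simp
    also have "\<dots> \<le> a * T / (2 * K) + 2 * a * (T / K)"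
    proof (rule add_mono[OF track[OF z(1) t]])
      have "2 * a * X t \<le> 2 * a * (T / K)" using Xnn[OF t] a by (intro mult_left_mono) auto
      then show "norm (\<Xi>z z t - \<Xi> t) \<le> 2 * a * (T / K)" using \<Xi>close[OF z(1) t] by linarith
    qed
    also have "\<dots> \<le> 3 * a * T / K" using a \<open>T > 0\<close> K by (simp add: field_simps)
    also have "\<dots> \<le> \<rho>" using K \<rho> by (simp add: field_simps)
    finally show ?thesis .
  qed
  have closei: "cmod (coord (x z t) i - \<xi> i t) \<le> \<rho>" if "t \<in> {0..T}" "i \<in> {1..N}" for t i
    using order_trans[OF norm_coord_le close[OF that(1)], of i] that by (simp add: coord_diff \<Xi>_def coord_emb)
  have "complex_solution N c cc x0 T (y z) (\<lambda>i t. coord (x z t) i)"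
  proof (rule complex_solution_of_field[OF \<rho>(1) x0 dx])
    show "\<rho> \<le> cmod (coord (x z t) i - y z t)" if t: "t \<in> {0..T}" and i: "i \<in> {1..N}" for t i
      using closei[OF t i] yfar[OF z(1) i t] norm_triangle_ineq4[of "coord (x z t) i - y z t" "coord (x z t) i - \<xi> i t"]
      by simp
    show "\<rho> \<le> cmod (coord (x z t) i - coord (x z t) j)" if t: "t \<in> {0..T}" and ij: "i \<in> {1..N}" "j \<in> {1..N}" "j \<noteq> i" for t i j
    proof -
      have "\<xi> i t - \<xi> j t = (coord (x z t) i - coord (x z t) j) - (coord (x z t) i - \<xi> i t) + (coord (x z t) j - \<xi> j t)"
        by simp
      also have "cmod \<dots> \<le> cmod (coord (x z t) i - coord (x z t) j) + cmod (coord (x z t) i - \<xi> i t) + cmod (coord (x z t) j - \<xi> j t)"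
        by (meson add_right_mono norm_triangle_ineq norm_triangle_ineq4 order_trans)
      finally show ?thesis using sepD[OF t ij] closei[OF t ij(1)] closei[OF t ij(2)] \<rho>(3) by linarith
    qed
  qed
  moreover have "coord (x z T) i = xf i" if "i \<in> {1..N}" for i
    using z(2) that nz by (auto simp: H_def simp del: of_real_mult)
  ultimately show ?thesis using ypoly[of z] yend[of z] by blast
qed

section \<open>The system in the real plane\<close>

text \<open>The identification of the real plane with the complex numbers, in both directions.\<close>
definition of_vec :: "real ^ 2 \<Rightarrow> complex" where
  "of_vec v = Complex (v $ 1) (v $ 2)"

definition to_vec :: "complex \<Rightarrow> real ^ 2" where
  "to_vec z = vector [Re z, Im z]"

lemma of_to_vec [simp]: "of_vec (to_vec z) = z"
  and to_of_vec [simp]: "to_vec (of_vec v) = v"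
  by (simp_all add: of_vec_def to_vec_def vec_eq_iff forall_2)

lemma of_vec_eq_iff [simp]: "of_vec u = of_vec v \<longleftrightarrow> u = v"
  by (metis to_of_vec)

lemma bounded_linear_of_vec: "bounded_linear of_vec"
  by (rule linear_conv_bounded_linear[THEN iffD1], rule linearI)
    (simp_all add: of_vec_def complex_eq_iff)

lemma bounded_linear_to_vec: "bounded_linear to_vec"
  by (rule linear_conv_bounded_linear[THEN iffD1], rule linearI)
    (simp_all add: to_vec_def vec_eq_iff forall_2)

lemma of_vec_diff: "of_vec (u - v) = of_vec u - of_vec v"
  by (simp add: of_vec_def complex_eq_iff)

lemma norm_of_vec: "cmod (of_vec v) = norm v"
  by (simp add: of_vec_def cmod_def norm_vec_def L2_set_def sum_2)

lemma of_vec_velocity: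
  "of_vec (vortex_velocity g a b) = of_real (g / (2 * pi)) * (\<i> / cnj (of_vec a - of_vec b))"
proof -
  define z where "z = of_vec (a - b)"
  have "of_vec (vortex_velocity g a b) = of_real (g / (2 * pi)) * (\<i> * z / of_real ((norm (a - b))\<^sup>2))"
    by (simp add: vortex_velocity_def perp_def of_vec_def z_def complex_eq_iff Re_divide_of_real Im_divide_of_real
      del: of_real_power)
  also have "\<i> * z / of_real ((norm (a - b))\<^sup>2) = \<i> / cnj z"
  proof (cases "z = 0")
    case False
    have "complex_of_real ((norm (a - b))\<^sup>2) = z * cnj z"
      unfolding z_def norm_of_vec[symmetric] by (rule complex_norm_square)
    then show ?thesis using False by simp
  qed simp
  finally show ?thesis by (simp add: z_def of_vec_diff)
qed

lemma has_vector_derivative_of_vec_iff: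
  "((\<lambda>t. of_vec (f t)) has_vector_derivative of_vec f') F \<longleftrightarrow> (f has_vector_derivative f') F"
proof
  assume "((\<lambda>t. of_vec (f t)) has_vector_derivative of_vec f') F"
  from bounded_linear.has_vector_derivative[OF bounded_linear_to_vec this]
  show "(f has_vector_derivative f') F" by simp
qed (rule bounded_linear.has_vector_derivative[OF bounded_linear_of_vec])

lemma is_vortex_solution_iff:
  "is_vortex_solution N \<gamma> \<gamma>c x0 T y x \<longleftrightarrow>
    complex_solution N (\<lambda>i. \<gamma> i / (2 * pi)) (\<gamma>c / (2 * pi)) (\<lambda>i. of_vec (x0 i)) T (\<lambda>t. of_vec (y t)) (\<lambda>i t. of_vec (x i t))"
proof -
  have "of_vec ((\<Sum>j\<in>{1..N} - {i}. vortex_velocity (\<gamma> j) (x i t) (x j t)) + vortex_velocity \<gamma>c (x i t) (y t))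
      = (\<Sum>j\<in>{1..N} - {i}. of_real (\<gamma> j / (2 * pi)) * (\<i> / cnj (of_vec (x i t) - of_vec (x j t))))
        + of_real (\<gamma>c / (2 * pi)) * (\<i> / cnj (of_vec (x i t) - of_vec (y t)))" for i t
    by (simp only: linear_add[OF bounded_linear.linear[OF bounded_linear_of_vec]]
        linear_sum[OF bounded_linear.linear[OF bounded_linear_of_vec]] of_vec_velocity)
  note velocity = this[symmetric]
  have distinct: "distinct_points N (\<lambda>i. x i t) (y t) \<longleftrightarrow> (\<forall>i\<in>{1..N}. of_vec (x i t) \<noteq> of_vec (y t) \<and>
      (\<forall>j\<in>{1..N}. j \<noteq> i \<longrightarrow> of_vec (x i t) \<noteq> of_vec (x j t)))" for t
    unfolding distinct_points_def of_vec_eq_iff by (metis (no_types, lifting))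
  show ?thesis
    unfolding is_vortex_solution_def complex_solution_def distinct velocity has_vector_derivative_of_vec_iff of_vec_eq_iff
    by (rule refl)
qed

lemma smooth_on_polynomial_curve:
  assumes "polynomial_curve f"
  shows "smooth_on S (\<lambda>t. to_vec (f t))"
proof -
  obtain p q where f: "\<And>t. f t = Complex (poly p t) (poly q t)"
    using assms unfolding polynomial_curve_def by blast
  define D where "D = (\<lambda>k t. Complex (poly ((pderiv ^^ k) p) t) (poly ((pderiv ^^ k) q) t))"
  have "(D k has_vector_derivative D (Suc k) t) (at t within S)" for k t
  proof -
    have "((\<lambda>t. poly r t) has_vector_derivative poly (pderiv r) t) (at t within S)" for r :: "real poly"
      using poly_DERIV[of r t]
      by (auto simp: has_real_derivative_iff_has_vector_derivative intro: has_vector_derivative_at_within)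
    then show ?thesis by (simp add: D_def has_vector_derivative_complex_iff has_real_derivative_iff_has_vector_derivative)
  qed
  then have "((\<lambda>t. to_vec (D k t)) has_vector_derivative to_vec (D (Suc k) t)) (at t within S)" for k t
    by (rule bounded_linear.has_vector_derivative[OF bounded_linear_to_vec])
  moreover have "to_vec (D 0 t) = to_vec (f t)" for t by (simp add: D_def f)
  ultimately show ?thesis
    unfolding smooth_on_def by (intro exI[of _ "\<lambda>k t. to_vec (D k t)"]) blast
qed

theorem theorem1:
  fixes N :: nat and \<gamma> :: "nat \<Rightarrow> real" and \<gamma>c T :: real
    and x0 xf :: "nat \<Rightarrow> real ^ 2" and y0 yf :: "real ^ 2"
  assumes "N \<ge> 1"
    and "\<forall>i\<in>{1..N}. \<gamma> i \<noteq> 0" and "\<gamma>c \<noteq> 0"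
    and "T > 0"
    and "distinct_points N x0 y0"
    and "distinct_points N xf yf"
  shows "\<exists>y :: real \<Rightarrow> real ^ 2. smooth_on {0..T} y \<and> y 0 = y0 \<and> y T = yf \<and>
    (\<exists>x. is_vortex_solution N \<gamma> \<gamma>c x0 T y x) \<and>
    (\<forall>x. is_vortex_solution N \<gamma> \<gamma>c x0 T y x \<longrightarrow> (\<forall>i\<in>{1..N}. x i T = xf i))"
proof -
  define c where "c = (\<lambda>i. \<gamma> i / (2 * pi))"
  define cc where "cc = \<gamma>c / (2 * pi)"
  have "\<exists>y x. polynomial_curve y \<and> y 0 = of_vec y0 \<and> y T = of_vec yf \<and>
    complex_solution N c cc (\<lambda>i. of_vec (x0 i)) T y x \<and> (\<forall>i\<in>{1..N}. x i T = of_vec (xf i))"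
    using assms by (intro complex_control) (auto simp: distinct_points_def cc_def)
  then obtain y x where y: "polynomial_curve y" "y 0 = of_vec y0" "y T = of_vec yf"
    and x: "complex_solution N c cc (\<lambda>i. of_vec (x0 i)) T y x" "\<forall>i\<in>{1..N}. x i T = of_vec (xf i)"
    by (elim exE conjE)
  define Y where "Y = (\<lambda>t. to_vec (y t))"
  have sol: "is_vortex_solution N \<gamma> \<gamma>c x0 T Y x' \<longleftrightarrow>
      complex_solution N c cc (\<lambda>i. of_vec (x0 i)) T y (\<lambda>i t. of_vec (x' i t))" for x'
    unfolding is_vortex_solution_iff c_def cc_def Y_def by simp
  show ?thesis
  proof (intro exI[of _ Y] conjI allI impI ballI)
    show "smooth_on {0..T} Y" unfolding Y_def by (rule smooth_on_polynomial_curve[OF y(1)])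
    show "Y 0 = y0" "Y T = yf" by (simp_all add: Y_def y)
    show "\<exists>x. is_vortex_solution N \<gamma> \<gamma>c x0 T Y x"
      using x(1) by (intro exI[of _ "\<lambda>i t. to_vec (x i t)"]) (simp add: sol)
    fix x' i assume x': "is_vortex_solution N \<gamma> \<gamma>c x0 T Y x'" and i: "i \<in> {1..N}"
    have "of_vec (x' i T) = x i T"
      using x' \<open>T > 0\<close> unfolding sol
      by (intro complex_solution_unique[OF _ x(1) continuous_on_polynomial_curve[OF y(1)] _ i]) auto
    then have "of_vec (x' i T) = of_vec (xf i)" using x(2) i by simp
    then show "x' i T = xf i" by simp
  qed
qed

end
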